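(* Assume that $\langle\mathcal L r,r\rangle\ge\lambda\|r\|^2$ for all $r\in H^1_0(\Omega)$, where $\lambda\ge0$ is some constant. Suppose that a unique solution $u$ of the problem $$\sum_{i=1}^\ell q_i(t)D_t^{\alpha_i}u(x,t)+\mathcal L u(x,t)=f(x,t)\ \text{ in }\Omega\times(0,T],\quad u(\cdot,0)=u_0\text{ in }\Omega,\quad u=0\text{ on }\partial\Omega\times(0,T],$$ and its approximation $u_h$ are in $C([0,T];L_2(\Omega))\cap W^{1,\infty}(\epsilon,T;L_2(\Omega))$ for each $\epsilon\in(0,T]$, and also in $H^1_0(\Omega)$ for each $t>0$. Let $$R_h(\cdot,t):=\Bigl(\sum_{i=1}^\ell q_i(t)D_t^{\alpha_i}+\mathcal L\Bigr)u_h(\cdot,t)-f(\cdot,t).$$ Suppose also that $$\|R_h(\cdot,t)\|\le\Bigl(\sum_{i=1}^\ell q_i(t)D_t^{\alpha_i}+\lambda\Bigr)\mathcal E(t)\qquad\forall\,t>0$$ for some barrier function $\mathcal E$ with $\mathcal E\in C[0,T]\cap W^{1,\infty}(\epsilon,t)$ for all $0<\epsilon<t\le T$ (and, if $\alpha_1=1$, with $\mathcal E'$ left-continuous on $(0,T]$, possibly with jump discontinuities), and with $\mathcal E(t)\ge0$ for all $t\ge0$. Then $\|(u_h-u)(\cdot,t)\|\le\mathcal E(t)$ for all $t\ge0$ (i.e. $t\in[0,T]$).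
   Context: $\Omega\subset\mathbb R^d$, $d\in\{1,2,3\}$, is a bounded Lipschitz domain; $T>0$; $\mathcal L$ is a spatial linear second-order elliptic operator; $\|\cdot\|$ and $\langle\cdot,\cdot\rangle$ are the norm and inner product of $L_2(\Omega)$. $\ell$ is a positive integer; $0<\alpha_\ell<\dots<\alpha_1\le1$ are constants; $q_i\in C[0,T]$ with $q_i\ge0$ and $\sum_{i=1}^\ell q_i(t)>0$ on $[0,T]$. For $\alpha_i<1$ and $0<t\le T$, $$\Gamma(1-\alpha_i)\,D_t^{\alpha_i}y(\cdot,t)=t^{-\alpha_i}[y(\cdot,t)-y(\cdot,0)]+\int_0^t\alpha_i(t-s)^{-\alpha_i-1}[y(\cdot,t)-y(\cdot,s)]\,ds,$$ and $D_t^1y:=\partial_ty$ (piecewise continuous time derivatives are regarded as left-continuous on $(0,T]$). Standing assumption on the approximate solution $u_h$: $u_h(\cdot,0)=u(\cdot,0)$ on $\Omega$ and $u_h(x,t)=u(x,t)$ for $x\in\partial\Omega$, $t>0$. *)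

theory Defs
  imports "HOL-Analysis.Analysis"
begin

text \<open>
  The type \<open>'a L2\<close> is the Hilbert space of square-integrable functions on the whole Euclidean
  space, modulo equality almost everywhere.  For a domain \<open>\<Omega>\<close>, the space $L_2(\Omega)$ is its closed
  subspace \<open>L2_on \<Omega>\<close> of functions that vanish almost everywhere outside \<open>\<Omega>\<close> (extension by zero is
  an isometry), so that \<open>norm\<close> and \<open>inner\<close> are the norm and the inner product of $L_2(\Omega)$.
  Completeness and separability are proved so that continuity, measurability and Bochner integrals
  of $L_2$-valued functions of time are those of the library.
\<close>

definition square_integrable :: "('a::euclidean_space \<Rightarrow> real) \<Rightarrow> bool" where
  "square_integrable f \<longleftrightarrow>
     f \<in> borel_measurable lebesgue \<and> integrable lebesgue (\<lambda>x. (f x)\<^sup>2)"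

lemma square_integrable_measurable [measurable_dest]:
  "square_integrable f \<Longrightarrow> f \<in> borel_measurable lebesgue"
  by (simp add: square_integrable_def)

lemma square_integrable_mult:
  assumes "square_integrable f" "square_integrable g"
  shows "integrable lebesgue (\<lambda>x. f x * g x)"
proof (rule Bochner_Integration.integrable_bound)
  show "integrable lebesgue (\<lambda>x. (f x)\<^sup>2 + (g x)\<^sup>2)"
    using assms by (simp add: square_integrable_def)
  show "(\<lambda>x. f x * g x) \<in> borel_measurable lebesgue"
    using assms by (intro borel_measurable_times) (simp_all add: square_integrable_def)
  have "\<bar>a * b\<bar> \<le> a\<^sup>2 + b\<^sup>2" for a b :: real
  proof -
    have "2 * (\<bar>a\<bar> * \<bar>b\<bar>) \<le> \<bar>a\<bar>\<^sup>2 + \<bar>b\<bar>\<^sup>2"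
      using sum_squares_bound[of "\<bar>a\<bar>" "\<bar>b\<bar>"] by simp
    moreover have "0 \<le> \<bar>a\<bar> * \<bar>b\<bar>" by simp
    ultimately have "\<bar>a\<bar> * \<bar>b\<bar> \<le> \<bar>a\<bar>\<^sup>2 + \<bar>b\<bar>\<^sup>2" by linarith
    then show ?thesis by (simp add: abs_mult)
  qed
  then show "AE x in lebesgue. norm (f x * g x) \<le> norm ((f x)\<^sup>2 + (g x)\<^sup>2)"
    by simp
qed

lemma square_integrable_add:
  assumes "square_integrable f" "square_integrable g"
  shows "square_integrable (\<lambda>x. f x + g x)"
  using assms square_integrable_mult[OF assms]
  by (auto simp: square_integrable_def power2_sum mult.assoc)

lemma square_integrable_scale:
  "square_integrable f \<Longrightarrow> square_integrable (\<lambda>x. c * f x)"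
  using borel_measurable_times[of "\<lambda>x. c" lebesgue f]
  by (simp add: square_integrable_def power_mult_distrib)

lemma square_integrable_uminus:
  "square_integrable f \<Longrightarrow> square_integrable (\<lambda>x. - f x)"
  by (simp add: square_integrable_def)

lemma square_integrable_diff:
  assumes "square_integrable f" "square_integrable g"
  shows "square_integrable (\<lambda>x. f x - g x)"
  using square_integrable_add[OF assms(1) square_integrable_uminus[OF assms(2)]] by simp

lemma square_integrable_zero: "square_integrable (\<lambda>x. 0)"
  by (simp add: square_integrable_def)

definition L2_rel :: "('a::euclidean_space \<Rightarrow> real) \<Rightarrow> ('a \<Rightarrow> real) \<Rightarrow> bool" where
  "L2_rel f g \<longleftrightarrow> square_integrable f \<and> square_integrable g \<and> (AE x in lebesgue. f x = g x)"

lemma part_equivp_L2_rel: "part_equivp L2_rel"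
proof (rule part_equivpI)
  show "\<exists>f. L2_rel f f"
    using square_integrable_zero by (auto simp: L2_rel_def)
  show "symp L2_rel"
    by (auto simp: symp_def L2_rel_def)
  show "transp L2_rel"
    by (auto simp: transp_def L2_rel_def elim: eventually_elim2)
qed

quotient_type (overloaded) 'a L2 = "'a::euclidean_space \<Rightarrow> real" / partial: L2_rel
  by (rule part_equivp_L2_rel)

lemma L2_rel_rep: "L2_rel (rep_L2 v) (rep_L2 v)"
  using Quotient3_rep_reflp[OF Quotient3_L2] .

lemma square_integrable_rep_L2: "square_integrable (rep_L2 v)"
  using L2_rel_rep by (auto simp: L2_rel_def)

lemma rep_abs_L2:
  assumes "square_integrable f"
  shows "AE x in lebesgue. rep_L2 (abs_L2 f) x = f x"
proof -
  have "L2_rel f f" using assms by (simp add: L2_rel_def)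
  then have "L2_rel (rep_L2 (abs_L2 f)) f"
    by (metis Quotient3_L2 rep_abs_rsp_left)
  then show ?thesis by (simp add: L2_rel_def)
qed

lemma abs_rep_L2: "abs_L2 (rep_L2 v) = v"
  using Quotient3_abs_rep[OF Quotient3_L2] .

lemma abs_L2_eq_iff:
  assumes "square_integrable f" "square_integrable g"
  shows "abs_L2 f = abs_L2 g \<longleftrightarrow> (AE x in lebesgue. f x = g x)"
  using Quotient3_rel[OF Quotient3_L2, of f g] assms by (auto simp: L2_rel_def)

instantiation L2 :: (euclidean_space) real_vector
begin

lift_definition zero_L2 :: "'a L2" is "\<lambda>x. 0"
  by (simp add: L2_rel_def square_integrable_zero)

lift_definition plus_L2 :: "'a L2 \<Rightarrow> 'a L2 \<Rightarrow> 'a L2" is "\<lambda>f g x. f x + g x"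
  by (auto simp: L2_rel_def square_integrable_add elim: eventually_elim2)

lift_definition minus_L2 :: "'a L2 \<Rightarrow> 'a L2 \<Rightarrow> 'a L2" is "\<lambda>f g x. f x - g x"
  by (auto simp: L2_rel_def square_integrable_diff elim: eventually_elim2)

lift_definition uminus_L2 :: "'a L2 \<Rightarrow> 'a L2" is "\<lambda>f x. - f x"
  by (auto simp: L2_rel_def square_integrable_uminus elim: eventually_elim2)

lift_definition scaleR_L2 :: "real \<Rightarrow> 'a L2 \<Rightarrow> 'a L2" is "\<lambda>c f x. c * f x"
  by (auto simp: L2_rel_def square_integrable_scale elim: eventually_elim2)

instance
proof
  fix a b :: real and u v w :: "'a L2"
  show "u + v + w = u + (v + w)"
    by transfer (auto simp: L2_rel_def add.assoc intro!: square_integrable_add)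
  show "u + v = v + u"
    by transfer (auto simp: L2_rel_def add.commute intro!: square_integrable_add)
  show "0 + u = u"
    by transfer (auto simp: L2_rel_def)
  show "- u + u = 0"
    by transfer (auto simp: L2_rel_def square_integrable_zero)
  show "u - v = u + - v"
    by transfer (auto simp: L2_rel_def intro!: square_integrable_diff)
  show "a *\<^sub>R (u + v) = a *\<^sub>R u + a *\<^sub>R v"
    by transfer (auto simp: L2_rel_def distrib_left
        intro!: square_integrable_add square_integrable_scale)
  show "(a + b) *\<^sub>R u = a *\<^sub>R u + b *\<^sub>R u"
    by transfer (auto simp: L2_rel_def distrib_right
        intro!: square_integrable_add square_integrable_scale)
  show "a *\<^sub>R b *\<^sub>R u = (a * b) *\<^sub>R u"
    by transfer (auto simp: L2_rel_def mult.assoc intro!: square_integrable_scale)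
  show "1 *\<^sub>R u = u"
    by transfer (auto simp: L2_rel_def)
qed

end

instantiation L2 :: (euclidean_space) real_inner
begin

lift_definition inner_L2 :: "'a L2 \<Rightarrow> 'a L2 \<Rightarrow> real"
  is "\<lambda>f g. integral\<^sup>L lebesgue (\<lambda>x. f x * g x)"
  by (rule integral_cong_AE) (auto simp: L2_rel_def square_integrable_def elim: eventually_elim2)

definition norm_L2 :: "'a L2 \<Rightarrow> real" where "norm_L2 v = sqrt (inner v v)"
definition dist_L2 :: "'a L2 \<Rightarrow> 'a L2 \<Rightarrow> real" where "dist_L2 v w = norm (v - w)"
definition sgn_L2 :: "'a L2 \<Rightarrow> 'a L2" where "sgn_L2 v = inverse (norm v) *\<^sub>R v"
definition uniformity_L2 :: "('a L2 \<times> 'a L2) filter" where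
  "uniformity_L2 = (INF e\<in>{0<..}. principal {(v, w). dist v w < e})"
definition open_L2 :: "'a L2 set \<Rightarrow> bool" where
  "open_L2 U \<longleftrightarrow> (\<forall>v\<in>U. \<forall>\<^sub>F (v', w) in uniformity. v' = v \<longrightarrow> w \<in> U)"

instance
proof
  fix a b :: real and u v w :: "'a L2"
  show "dist u v = norm (u - v)" by (rule dist_L2_def)
  show "sgn u = u /\<^sub>R norm u" by (rule sgn_L2_def)
  show "uniformity = (INF e\<in>{0<..}. principal {(v::'a L2, w). dist v w < e})"
    by (rule uniformity_L2_def)
  show "open U \<longleftrightarrow> (\<forall>v\<in>U. \<forall>\<^sub>F (v', w) in uniformity. v' = v \<longrightarrow> w \<in> U)" for U :: "'a L2 set"
    by (rule open_L2_def)
  show "u \<bullet> v = v \<bullet> u"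
    by transfer (simp add: mult.commute)
  show "(u + v) \<bullet> w = u \<bullet> w + v \<bullet> w"
    by transfer (auto simp: L2_rel_def distrib_right square_integrable_mult)
  show "a *\<^sub>R u \<bullet> v = a * (u \<bullet> v)"
    by transfer (auto simp: L2_rel_def mult.assoc)
  show "0 \<le> u \<bullet> u"
    by transfer (auto intro!: integral_nonneg_AE)
  show "u \<bullet> u = 0 \<longleftrightarrow> u = 0"
  proof transfer
    fix f :: "'a \<Rightarrow> real" assume "L2_rel f f"
    then have f: "square_integrable f" by (simp add: L2_rel_def)
    have "integral\<^sup>L lebesgue (\<lambda>x. f x * f x) = 0 \<longleftrightarrow> (AE x in lebesgue. f x * f x = 0)"
      using square_integrable_mult[OF f f] by (intro integral_nonneg_eq_0_iff_AE) auto
    then show "integral\<^sup>L lebesgue (\<lambda>x. f x * f x) = 0 \<longleftrightarrow> L2_rel f (\<lambda>x. 0)"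
      using f square_integrable_zero[where 'a='a] by (simp add: L2_rel_def)
  qed
  show "norm u = sqrt (u \<bullet> u)" by (rule norm_L2_def)
qed

end

lemma rep_L2_diff: "AE x in lebesgue. rep_L2 (v - w) x = rep_L2 v x - rep_L2 w x"
proof -
  have "v - w = abs_L2 (\<lambda>x. rep_L2 v x - rep_L2 w x)"
    using minus_L2.abs_eq[OF L2_rel_rep[of v] L2_rel_rep[of w]] by (simp add: abs_rep_L2)
  then show ?thesis
    using rep_abs_L2[OF square_integrable_diff[OF square_integrable_rep_L2 square_integrable_rep_L2]]
    by simp
qed

lemma norm_L2_abs:
  assumes "square_integrable f"
  shows "(norm (abs_L2 f))\<^sup>2 = integral\<^sup>L lebesgue (\<lambda>x. (f x)\<^sup>2)"
proof -
  have "(norm (abs_L2 f))\<^sup>2 = abs_L2 f \<bullet> abs_L2 f"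
    by (simp add: power2_norm_eq_inner)
  also have "\<dots> = integral\<^sup>L lebesgue (\<lambda>x. f x * f x)"
    using assms by (intro inner_L2.abs_eq) (auto simp: L2_rel_def)
  finally show ?thesis by (simp add: power2_eq_square)
qed

lemma norm_L2_rep: "(norm v)\<^sup>2 = integral\<^sup>L lebesgue (\<lambda>x. (rep_L2 v x)\<^sup>2)"
  using norm_L2_abs[OF square_integrable_rep_L2, of v] by (simp add: abs_rep_L2)

lemma abs_L2_add:
  assumes "square_integrable f" "square_integrable g"
  shows "abs_L2 f + abs_L2 g = abs_L2 (\<lambda>x. f x + g x)"
  using assms by (intro plus_L2.abs_eq) (auto simp: L2_rel_def)

lemma abs_L2_diff:
  assumes "square_integrable f" "square_integrable g"
  shows "abs_L2 f - abs_L2 g = abs_L2 (\<lambda>x. f x - g x)"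
  using assms by (intro minus_L2.abs_eq) (auto simp: L2_rel_def)

lemma nn_integral_square:
  assumes "square_integrable f"
  shows "(\<integral>\<^sup>+x. ennreal ((f x)\<^sup>2) \<partial>lebesgue) = ennreal ((norm (abs_L2 f))\<^sup>2)"
  using assms by (simp add: norm_L2_abs nn_integral_eq_integral square_integrable_def)

lemma square_integrableI_nn_integral:
  assumes "f \<in> borel_measurable lebesgue"
    and "(\<integral>\<^sup>+x. ennreal ((f x)\<^sup>2) \<partial>lebesgue) < \<infinity>"
  shows "square_integrable f"
  using assms by (auto simp: square_integrable_def intro!: integrableI_nonneg)

lemma L2_Cauchy_convergent:
  fixes X :: "nat \<Rightarrow> 'a::euclidean_space L2"
  assumes "Cauchy X"
  shows "convergent X"
proof -
  have "\<exists>N. \<forall>m\<ge>N. \<forall>n\<ge>N. norm (X m - X n) < (1/2)^k" for k :: nat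
    using CauchyD[OF assms, of "(1/2)^k"] by simp
  then obtain N :: "nat \<Rightarrow> nat"
    where N: "\<And>k m n. m \<ge> N k \<Longrightarrow> n \<ge> N k \<Longrightarrow> norm (X m - X n) < (1/2)^k"
    by metis
  define r where "r k = (\<Sum>j\<le>k. Suc (N j))" for k
  have rN: "r m \<ge> N k" if "m \<ge> k" for m k
  proof -
    have "N k \<le> Suc (N k)" by simp
    also have "\<dots> \<le> r m" unfolding r_def using that by (intro member_le_sum) auto
    finally show ?thesis .
  qed
  define f where "f k = rep_L2 (X (r k))" for k
  have sq_f: "square_integrable (f k)" for k
    by (simp add: f_def square_integrable_rep_L2)
  have abs_f: "abs_L2 (f k) = X (r k)" for k by (simp add: f_def abs_rep_L2)
  define g where "g k x = \<bar>f (Suc k) x - f k x\<bar>" for k x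
  have sq_g: "square_integrable (g k)" for k
    using square_integrable_diff[OF sq_f[of "Suc k"] sq_f[of k]]
    by (auto simp: square_integrable_def g_def [abs_def])
  have norm_g: "norm (abs_L2 (g k)) \<le> (1/2)^k" for k
  proof -
    have "(norm (abs_L2 (g k)))\<^sup>2 = (norm (X (r (Suc k)) - X (r k)))\<^sup>2"
      unfolding norm_L2_abs[OF sq_g] abs_f[symmetric] abs_L2_diff[OF sq_f sq_f]
        norm_L2_abs[OF square_integrable_diff[OF sq_f sq_f]]
      by (simp add: g_def)
    then have "norm (abs_L2 (g k)) = norm (X (r (Suc k)) - X (r k))"
      by (simp add: power2_eq_iff_nonneg)
    also have "\<dots> \<le> (1/2)^k" using N[of k "r (Suc k)" "r k"] rN[of k] by simp
    finally show ?thesis .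
  qed
  define S where "S K x = (\<Sum>k<K. g k x)" for K x
  have S: "square_integrable (S K) \<and> norm (abs_L2 (S K)) \<le> (\<Sum>k<K. (1/2)^k)" for K
  proof (induction K)
    case 0
    have "abs_L2 (\<lambda>x::'a. 0) = 0" by (simp add: zero_L2_def)
    then show ?case by (simp add: S_def [abs_def] square_integrable_zero)
  next
    case (Suc K)
    have *: "S (Suc K) = (\<lambda>x. S K x + g K x)" by (simp add: S_def [abs_def])
    have "abs_L2 (S (Suc K)) = abs_L2 (S K) + abs_L2 (g K)"
      unfolding * using Suc.IH sq_g by (intro abs_L2_add[symmetric]) auto
    moreover have "norm (abs_L2 (S K) + abs_L2 (g K)) \<le> (\<Sum>k<K. (1/2)^k) + (1/2)^K"
      using Suc.IH norm_g[of K] by (intro norm_triangle_mono) auto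
    ultimately show ?case using Suc.IH sq_g unfolding * by (auto intro: square_integrable_add)
  qed
  have S_nonneg: "0 \<le> S K x" for K x by (auto simp: S_def g_def intro: sum_nonneg)
  have S_mono: "S K x \<le> S (Suc K) x" for K x by (simp add: S_def g_def)
  have int_S: "(\<integral>\<^sup>+x. ennreal ((S K x)\<^sup>2) \<partial>lebesgue) \<le> 4" for K
  proof -
    have "(\<Sum>k<K. (1/2)^k) \<le> (2::real)"
    proof -
      have "(\<Sum>k<K. (1/2)^k) = (2::real) - 2 * (1/2)^K" by (induction K) auto
      then show ?thesis by simp
    qed
    then have "norm (abs_L2 (S K)) \<le> 2" using S[of K] by linarith
    then have "(norm (abs_L2 (S K)))\<^sup>2 \<le> 2\<^sup>2" by (intro power_mono) auto
    then show ?thesis using S[of K] by (simp add: nn_integral_square ennreal_le_iff flip: ennreal_numeral)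
  qed
  have meas_S: "S K \<in> borel_measurable lebesgue" for K
    using S[of K] by (simp add: square_integrable_def)
  have "(\<integral>\<^sup>+x. (SUP K. ennreal ((S K x)\<^sup>2)) \<partial>lebesgue) = (SUP K. \<integral>\<^sup>+x. ennreal ((S K x)\<^sup>2) \<partial>lebesgue)"
  proof (rule nn_integral_monotone_convergence_SUP)
    show "incseq (\<lambda>K x. ennreal ((S K x)\<^sup>2))"
      using S_mono S_nonneg by (auto intro!: incseq_SucI le_funI ennreal_leI power_mono)
    show "(\<lambda>x. ennreal ((S K x)\<^sup>2)) \<in> borel_measurable lebesgue" for K
      using S[of K] by (auto simp: square_integrable_def)
  qed
  also have "\<dots> \<le> 4" using int_S by (auto intro: SUP_least)
  finally have "(\<integral>\<^sup>+x. (SUP K. ennreal ((S K x)\<^sup>2)) \<partial>lebesgue) \<noteq> \<infinity>"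
    by (auto simp: top_unique)
  then have "AE x in lebesgue. (SUP K. ennreal ((S K x)\<^sup>2)) \<noteq> \<infinity>"
  proof (rule nn_integral_PInf_AE[rotated])
    have "(\<lambda>x. ennreal ((S K x)\<^sup>2)) \<in> borel_measurable lebesgue" for K
      using S[of K] by (auto simp: square_integrable_def)
    then show "(\<lambda>x. SUP K. ennreal ((S K x)\<^sup>2)) \<in> borel_measurable lebesgue"
      by (intro borel_measurable_SUP) auto
  qed
  then have conv: "AE x in lebesgue. convergent (\<lambda>k. f k x)"
  proof (rule eventually_mono)
    fix x assume fin: "(SUP K. ennreal ((S K x)\<^sup>2)) \<noteq> \<infinity>"
    then obtain c where c: "c \<ge> 0" "(SUP K. ennreal ((S K x)\<^sup>2)) = ennreal c"
      by (cases "SUP K. ennreal ((S K x)\<^sup>2)") auto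
    have "ennreal ((S K x)\<^sup>2) \<le> ennreal c" for K
      unfolding c(2)[symmetric] by (rule SUP_upper) simp
    then have "(S K x)\<^sup>2 \<le> c" for K using c(1) by simp
    then have "S K x \<le> sqrt c" for K by (simp add: real_le_rsqrt)
    then have "summable (\<lambda>k. g k x)"
      unfolding S_def by (intro summableI_nonneg_bounded[where x="sqrt c"]) (auto simp: g_def)
    then have "summable (\<lambda>k. f (Suc k) x - f k x)"
      unfolding g_def by (rule summable_rabs_cancel)
    then have "convergent (\<lambda>n. \<Sum>k<n. f (Suc k) x - f k x)"
      by (simp add: summable_iff_convergent)
    then have "convergent (\<lambda>n. f n x - f 0 x)"
      by (subst (asm) sum_lessThan_telescope)
    then show "convergent (\<lambda>k. f k x)"
      using convergent_add[OF _ convergent_const[of "f 0 x"]] by fastforce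
  qed
  define F where "F x = lim (\<lambda>k. f k x)" for x
  have meas_f: "f k \<in> borel_measurable lebesgue" for k
    using sq_f[of k] by (simp add: square_integrable_def)
  have meas_F: "F \<in> borel_measurable lebesgue"
    unfolding F_def [abs_def] using meas_f by (rule borel_measurable_lim_metric)
  have lim_F: "AE x in lebesgue. (\<lambda>k. f k x) \<longlonglongrightarrow> F x"
    using conv by eventually_elim (simp add: F_def convergent_LIMSEQ_iff)
  have close: "(\<integral>\<^sup>+x. ennreal ((f k x - F x)\<^sup>2) \<partial>lebesgue) \<le> ennreal (((1/2)^k)\<^sup>2)" for k
  proof -
    have "(\<integral>\<^sup>+x. ennreal ((f k x - F x)\<^sup>2) \<partial>lebesgue)
        = (\<integral>\<^sup>+x. liminf (\<lambda>m. ennreal ((f k x - f m x)\<^sup>2)) \<partial>lebesgue)"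
    proof (rule nn_integral_cong_AE)
      show "AE x in lebesgue. ennreal ((f k x - F x)\<^sup>2) = liminf (\<lambda>m. ennreal ((f k x - f m x)\<^sup>2))"
        using lim_F
      proof eventually_elim
        fix x assume "(\<lambda>k. f k x) \<longlonglongrightarrow> F x"
        then have "(\<lambda>m. ennreal ((f k x - f m x)\<^sup>2)) \<longlonglongrightarrow> ennreal ((f k x - F x)\<^sup>2)"
          by (intro tendsto_ennrealI tendsto_intros)
        then show "ennreal ((f k x - F x)\<^sup>2) = liminf (\<lambda>m. ennreal ((f k x - f m x)\<^sup>2))"
          using lim_imp_Liminf[OF sequentially_bot] by fastforce
      qed
    qed
    also have "\<dots> \<le> liminf (\<lambda>m. \<integral>\<^sup>+x. ennreal ((f k x - f m x)\<^sup>2) \<partial>lebesgue)"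
    proof (rule nn_integral_liminf)
      show "(\<lambda>x. ennreal ((f k x - f m x)\<^sup>2)) \<in> borel_measurable lebesgue" for m
        using square_integrable_diff[OF sq_f[of k] sq_f[of m]]
        by (auto simp: square_integrable_def)
    qed
    also have "\<dots> \<le> limsup (\<lambda>m. \<integral>\<^sup>+x. ennreal ((f k x - f m x)\<^sup>2) \<partial>lebesgue)"
      by (rule Liminf_le_Limsup) simp
    also have "\<dots> \<le> ennreal (((1/2)^k)\<^sup>2)"
    proof (rule Limsup_bounded)
      have "(\<integral>\<^sup>+x. ennreal ((f k x - f m x)\<^sup>2) \<partial>lebesgue) \<le> ennreal (((1/2)^k)\<^sup>2)" if "m \<ge> k" for m
      proof -
        have "norm (X (r k) - X (r m)) \<le> (1/2)^k"
          using N[of k "r k" "r m"] rN that by (simp add: less_imp_le)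
        then have "(norm (X (r k) - X (r m)))\<^sup>2 \<le> ((1/2)^k)\<^sup>2"
          by (intro power_mono) auto
        then show ?thesis
          using nn_integral_square[OF square_integrable_diff[OF sq_f[of k] sq_f[of m]]]
          by (simp add: abs_L2_diff[OF sq_f sq_f, symmetric] abs_f ennreal_leI)
      qed
      then show "\<forall>\<^sub>F m in sequentially.
          (\<integral>\<^sup>+x. ennreal ((f k x - f m x)\<^sup>2) \<partial>lebesgue) \<le> ennreal (((1/2)^k)\<^sup>2)"
        using eventually_ge_at_top[of k] by (rule eventually_mono[rotated])
    qed
    finally show ?thesis .
  qed
  have sq_d: "square_integrable (\<lambda>x. f k x - F x)" for k
  proof (rule square_integrableI_nn_integral)
    show "(\<lambda>x. f k x - F x) \<in> borel_measurable lebesgue"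
      using meas_f meas_F by (intro borel_measurable_diff)
    show "(\<integral>\<^sup>+x. ennreal ((f k x - F x)\<^sup>2) \<partial>lebesgue) < \<infinity>"
      using close[of k] by (simp add: le_less_trans[OF _ ennreal_less_top])
  qed
  have sq_F: "square_integrable F"
    using square_integrable_diff[OF sq_f[of 0] sq_d[of 0]] by simp
  have norm_d: "norm (X (r k) - abs_L2 F) \<le> (1/2)^k" for k
  proof -
    have "(norm (X (r k) - abs_L2 F))\<^sup>2 \<le> ((1/2)^k)\<^sup>2"
      using close[of k]
      unfolding nn_integral_square[OF sq_d] abs_L2_diff[OF sq_f sq_F, symmetric] abs_f
      by (subst (asm) ennreal_le_iff) auto
    then show ?thesis by (rule power2_le_imp_le) simp
  qed
  have "X \<longlonglongrightarrow> abs_L2 F"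
  proof (rule LIMSEQ_I)
    fix e :: real assume "0 < e"
    then obtain k where k: "(1/2)^k < e / 2"
      using real_arch_pow_inv[of "e/2" "1/2"] by auto
    have "norm (X n - abs_L2 F) < e" if "n \<ge> N k" for n
    proof -
      have "norm (X n - abs_L2 F) \<le> norm (X n - X (r k)) + norm (X (r k) - abs_L2 F)"
        using norm_triangle_ineq[of "X n - X (r k)" "X (r k) - abs_L2 F"] by simp
      also have "\<dots> < e"
        using N[of k n "r k"] rN[of k k] that norm_d[of k] k by simp
      finally show ?thesis .
    qed
    then show "\<exists>no. \<forall>n\<ge>no. norm (X n - abs_L2 F) < e" by blast
  qed
  then show ?thesis by (rule convergentI)
qed

instance L2 :: (euclidean_space) banach
  by standard (rule L2_Cauchy_convergent)

lemma abs_L2_scale: "square_integrable f \<Longrightarrow> c *\<^sub>R abs_L2 f = abs_L2 (\<lambda>x. c * f x)"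
  by (intro scaleR_L2.abs_eq) (auto simp: L2_rel_def)

lemma countable_dense_subspace:
  fixes C :: "'b::real_normed_vector set"
  assumes "countable C"
  obtains D where "countable D" "C \<subseteq> D" "subspace (closure D)"
proof
  define h :: "(rat \<times> 'b) list \<Rightarrow> 'b" where "h xs = sum_list (map (\<lambda>(q, c). of_rat q *\<^sub>R c) xs)" for xs
  define D where "D = h ` lists (UNIV \<times> C)"
  show "countable D" unfolding D_def using assms by auto
  show "C \<subseteq> D"
  proof
    fix c assume "c \<in> C"
    then have "h [(1, c)] \<in> D" by (auto simp: D_def)
    then show "c \<in> D" by (simp add: h_def)
  qed
  have D_add: "u + v \<in> D" if "u \<in> D" "v \<in> D" for u v
  proof -
    from that obtain xs ys where "xs \<in> lists (UNIV \<times> C)" "u = h xs" "ys \<in> lists (UNIV \<times> C)" "v = h ys"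
      by (auto simp: D_def)
    then have "u + v = h (xs @ ys)" "xs @ ys \<in> lists (UNIV \<times> C)" by (auto simp: h_def)
    then show ?thesis by (auto simp: D_def)
  qed
  have D_rat: "of_rat q *\<^sub>R u \<in> D" if "u \<in> D" for q u
  proof -
    from that obtain xs where xs: "xs \<in> lists (UNIV \<times> C)" "u = h xs" by (auto simp: D_def)
    have "of_rat q *\<^sub>R h xs = h (map (\<lambda>(p, c). (q * p, c)) xs)"
      by (induction xs) (auto simp: h_def scaleR_add_right of_rat_mult)
    moreover have "map (\<lambda>(p, c). (q * p, c)) xs \<in> lists (UNIV \<times> C)"
      using xs(1) by (induction xs) auto
    ultimately show ?thesis using xs(2) by (auto simp: D_def)
  qed
  show "subspace (closure D)"
  proof (rule subspaceI)
    have "h [] \<in> D" by (auto simp: D_def)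
    then show "0 \<in> closure D" using closure_subset by (auto simp: h_def)
  next
    fix u v assume "u \<in> closure D" "v \<in> closure D"
    then obtain a b where "\<And>n::nat. a n \<in> D" "a \<longlonglongrightarrow> u" "\<And>n::nat. b n \<in> D" "b \<longlonglongrightarrow> v"
      unfolding closure_sequential by blast
    then show "u + v \<in> closure D"
      unfolding closure_sequential using D_add
      by (intro exI[of _ "\<lambda>n. a n + b n"]) (auto intro: tendsto_add)
  next
    fix c :: real and u assume "u \<in> closure D"
    then obtain a where a: "\<And>n::nat. a n \<in> D" "a \<longlonglongrightarrow> u"
      unfolding closure_sequential by blast
    have "\<exists>q. \<bar>of_rat q - c\<bar> < 1 / real (Suc n)" for n
    proof -
      obtain q where "c < of_rat q" "of_rat q < c + 1 / real (Suc n)"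
        using of_rat_dense[of c "c + 1 / real (Suc n)"] by auto
      then show ?thesis by (intro exI[of _ q]) auto
    qed
    then obtain q where q: "\<And>n. \<bar>of_rat (q n) - c\<bar> < 1 / real (Suc n)" by metis
    have "(\<lambda>n. of_rat (q n) - c) \<longlonglongrightarrow> 0"
    proof (rule tendsto_rabs_zero_cancel, rule tendsto_sandwich)
      show "\<forall>\<^sub>F n in sequentially. 0 \<le> \<bar>of_rat (q n) - c\<bar>" by simp
      show "\<forall>\<^sub>F n in sequentially. \<bar>of_rat (q n) - c\<bar> \<le> 1 / real (Suc n)"
        using q by (intro always_eventually allI less_imp_le)
      show "(\<lambda>n. 1 / real (Suc n)) \<longlonglongrightarrow> 0" by (rule lim_1_over_n[THEN LIMSEQ_Suc])
    qed simp
    then have "(\<lambda>n. of_rat (q n)) \<longlonglongrightarrow> c" by (rule LIM_zero_cancel)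
    then have "(\<lambda>n. of_rat (q n) *\<^sub>R a n) \<longlonglongrightarrow> c *\<^sub>R u"
      using a(2) by (rule tendsto_scaleR)
    then show "c *\<^sub>R u \<in> closure D"
      unfolding closure_sequential using a(1) D_rat
      by (intro exI[of _ "\<lambda>n. of_rat (q n) *\<^sub>R a n"] conjI allI) auto
  qed
qed

lemma square_integrable_indicator:
  "A \<in> lmeasurable \<Longrightarrow> square_integrable (indicat_real A)"
proof -
  assume A: "A \<in> lmeasurable"
  have *: "(indicat_real A x)\<^sup>2 = indicat_real A x" for x by (simp add: indicator_def)
  show ?thesis
    unfolding square_integrable_def * using A by (auto simp: fmeasurable_def)
qed

lemma norm_indicator_diff:
  assumes "A \<in> lmeasurable" "B \<in> lmeasurable" "B \<subseteq> A"
  shows "(norm (abs_L2 (indicat_real A) - abs_L2 (indicat_real B)))\<^sup>2 = measure lebesgue (A - B)"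
proof -
  have sq: "square_integrable (indicat_real A)" "square_integrable (indicat_real B)"
    using assms by (auto intro: square_integrable_indicator)
  have *: "(indicat_real A x - indicat_real B x)\<^sup>2 = indicat_real (A - B) x" for x
    using assms(3) by (auto simp: indicator_def)
  show ?thesis
    unfolding abs_L2_diff[OF sq] norm_L2_abs[OF square_integrable_diff[OF sq]] *
    using assms by (simp add: fmeasurable.Diff)
qed

lemma L2_countable_dense:
  "\<exists>D::'a::euclidean_space L2 set. countable D \<and> closure D = UNIV"
proof -
  obtain B :: "'a set set" where B: "countable B" "topological_basis B"
    using ex_countable_basis by blast
  define C :: "'a L2 set" where
    "C = (\<lambda>\<D>. abs_L2 (indicat_real (\<Union>\<D>))) ` {\<D>. finite \<D> \<and> \<D> \<subseteq> B}"
  have "countable C"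
    unfolding C_def using countable_Collect_finite_subset[OF B(1)]
    by (auto simp: conj_commute)
  then obtain D where D: "countable D" "C \<subseteq> D" "subspace (closure D)"
    by (rule countable_dense_subspace)
  define M where "M = closure D"
  have CM: "C \<subseteq> M" using D(2) closure_subset unfolding M_def by blast
  have subM: "subspace M" using D(3) by (simp add: M_def)
  have limM: "v \<in> M" if "\<And>e. e > 0 \<Longrightarrow> \<exists>w\<in>M. norm (v - w) < e" for v
  proof -
    have "v \<in> closure M" unfolding closure_approachable using that by (simp add: dist_norm norm_minus_commute[of _ v])
    then show ?thesis by (simp add: M_def)
  qed

  have openM: "abs_L2 (indicat_real U) \<in> M" if U: "open U" "U \<in> lmeasurable" for U
  proof (rule limM)
    fix e :: real assume "e > 0"
    obtain B' where B': "B' \<subseteq> B" "\<Union>B' = U"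
      using B(2) U(1) unfolding topological_basis_def by metis
    have cB': "countable B'" using B(1) B'(1) countable_subset by blast
    have oB': "open V" if "V \<in> B'" for V
      using B'(1) that by (intro topological_basis_open[OF B(2)]) auto
    show "\<exists>w\<in>M. norm (abs_L2 (indicat_real U) - w) < e"
    proof (cases "B' = {}")
      case True
      then have "U = \<Union>{}" using B' by simp
      then have "abs_L2 (indicat_real U) \<in> C" unfolding C_def by blast
      then show ?thesis using CM \<open>e > 0\<close> by (intro bexI[of _ "abs_L2 (indicat_real U)"]) auto
    next
      case False
      define V where "V n = \<Union> (from_nat_into B' ` {..<n})" for n :: nat
      have rng: "range (from_nat_into B') = B'" using False cB' by (rule range_from_nat_into)
      have oV: "open (V n)" for n
        unfolding V_def
      proof (intro open_Union ballI)
        fix W assume "W \<in> from_nat_into B' ` {..<n}"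
        then have "W \<in> B'" using rng by blast
        then show "open W" by (rule oB')
      qed
      have VU: "V n \<subseteq> U" for n unfolding V_def using rng B'(2) by blast
      have UV: "(\<Union>n. V n) = U"
      proof -
        have "(\<Union>n. V n) = \<Union> (range (from_nat_into B'))"
          unfolding V_def by (auto intro: lessI)
        then show ?thesis using rng B'(2) by simp
      qed
      have Vs: "V n \<in> sets lebesgue" for n
        using oV[of n] by (metis borel_open sets_completionI_sets sets_lborel)
      have Vl: "V n \<in> lmeasurable" for n
        using VU Vs U(2) fmeasurableI2 by blast
      have VC: "abs_L2 (indicat_real (V n)) \<in> M" for n
      proof -
        have "finite (from_nat_into B' ` {..<n})" "from_nat_into B' ` {..<n} \<subseteq> B"
          using rng B'(1) by auto
        then have "abs_L2 (indicat_real (V n)) \<in> C" unfolding C_def V_def by blast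
        then show ?thesis using CM by blast
      qed
      have "(\<lambda>n. measure lebesgue (V n)) \<longlonglongrightarrow> measure lebesgue (\<Union>n. V n)"
      proof (rule Lim_measure_incseq)
        show "range V \<subseteq> sets lebesgue" using Vs by blast
        show "incseq V" by (rule incseq_SucI) (force simp: V_def)
        show "emeasure lebesgue (\<Union>n. V n) \<noteq> \<infinity>"
          unfolding UV infinity_ennreal_def using U(2) by (rule fmeasurableD2)
      qed
      then have "(\<lambda>n. measure lebesgue (V n)) \<longlonglongrightarrow> measure lebesgue U" by (simp add: UV)
      then obtain n where "\<bar>measure lebesgue (V n) - measure lebesgue U\<bar> < e\<^sup>2"
        using LIMSEQ_D[of _ _ "e\<^sup>2"] \<open>e > 0\<close> by (metis order_refl real_norm_def zero_less_power)
      moreover have "measure lebesgue (U - V n) = measure lebesgue U - measure lebesgue (V n)"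
        using U(2) Vl VU by (intro measurable_measure_Diff) (auto simp: fmeasurableD)
      ultimately have "(norm (abs_L2 (indicat_real U) - abs_L2 (indicat_real (V n))))\<^sup>2 < e\<^sup>2"
        using norm_indicator_diff[OF U(2) Vl VU] by simp
      then have "norm (abs_L2 (indicat_real U) - abs_L2 (indicat_real (V n))) < e"
        using \<open>e > 0\<close> by (intro power_less_imp_less_base[of _ 2 e]) auto
      then show ?thesis using VC by blast
    qed
  qed

  have indM: "abs_L2 (indicat_real A) \<in> M" if A: "A \<in> lmeasurable" for A
  proof (rule limM)
    fix e :: real assume "e > 0"
    then have "e\<^sup>2 > 0" by simp
    then obtain U where U: "open U" "A \<subseteq> U" "U - A \<in> lmeasurable" "emeasure lebesgue (U - A) < ennreal (e\<^sup>2)"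
      using sets_lebesgue_outer_open[OF fmeasurableD[OF A]] by blast
    have "U = A \<union> (U - A)" using U(2) by blast
    then have Ul: "U \<in> lmeasurable" using A U(3) by (metis fmeasurable.Un)
    have "measure lebesgue (U - A) < e\<^sup>2"
      using U(3,4) by (simp add: emeasure_eq_measure2 ennreal_less_iff)
    then have "(norm (abs_L2 (indicat_real U) - abs_L2 (indicat_real A)))\<^sup>2 < e\<^sup>2"
      using norm_indicator_diff[OF Ul A U(2)] by simp
    then have "norm (abs_L2 (indicat_real U) - abs_L2 (indicat_real A)) < e"
      using \<open>e > 0\<close> by (intro power_less_imp_less_base[of _ 2 e]) auto
    then show "\<exists>w\<in>M. norm (abs_L2 (indicat_real A) - w) < e"
      using openM[OF U(1) Ul]
      by (intro bexI[of _ "abs_L2 (indicat_real U)"]) (subst norm_minus_commute)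
  qed

  have simpleM: "square_integrable s \<and> abs_L2 s \<in> M"
    if s: "simple_function lebesgue s" "integrable lebesgue (\<lambda>x. (s x)\<^sup>2)" for s :: "'a \<Rightarrow> real"
  proof -
    have fin: "finite (range s)" using simple_functionD(1)[OF s(1)] by simp
    have lv: "s -` {y} \<in> lmeasurable" if "y \<noteq> 0" for y
    proof -
      have sets: "s -` {y} \<in> sets lebesgue" using simple_functionD(2)[OF s(1), of "{y}"] by simp
      have "integrable lebesgue (indicat_real (s -` {y}))"
      proof (rule Bochner_Integration.integrable_bound)
        show "integrable lebesgue (\<lambda>x. (s x)\<^sup>2 / y\<^sup>2)" using s(2) by simp
        show "indicat_real (s -` {y}) \<in> borel_measurable lebesgue" using sets by simp
        show "AE x in lebesgue. norm (indicat_real (s -` {y}) x) \<le> norm ((s x)\<^sup>2 / y\<^sup>2)"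
          using that by (auto simp: indicator_def)
      qed
      then show ?thesis using sets by (simp add: integrable_indicator_iff fmeasurable_def)
    qed
    have Y: "square_integrable (\<lambda>x. \<Sum>y\<in>Y. y * indicat_real (s -` {y}) x)
        \<and> abs_L2 (\<lambda>x. \<Sum>y\<in>Y. y * indicat_real (s -` {y}) x) \<in> M"
      if "finite Y" "0 \<notin> Y" for Y
      using that
    proof (induction Y)
      case empty
      have "abs_L2 (\<lambda>x::'a. 0) = 0" by (simp add: zero_L2_def)
      then show ?case using subspace_0[OF subM] by (simp add: square_integrable_zero)
    next
      case (insert y Y)
      have lvy: "s -` {y} \<in> lmeasurable" using insert.prems lv by auto
      have sq: "square_integrable (\<lambda>x. y * indicat_real (s -` {y}) x)"
        using lvy by (intro square_integrable_scale square_integrable_indicator)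
      have IH: "square_integrable (\<lambda>x. \<Sum>y\<in>Y. y * indicat_real (s -` {y}) x)"
        "abs_L2 (\<lambda>x. \<Sum>y\<in>Y. y * indicat_real (s -` {y}) x) \<in> M"
        using insert by auto
      have "abs_L2 (\<lambda>x. y * indicat_real (s -` {y}) x) \<in> M"
        using abs_L2_scale[OF square_integrable_indicator[OF lvy], of y] indM[OF lvy]
          subspace_scale[OF subM] by metis
      moreover note IH(2)
      ultimately have "abs_L2 (\<lambda>x. y * indicat_real (s -` {y}) x + (\<Sum>y\<in>Y. y * indicat_real (s -` {y}) x)) \<in> M"
        using subspace_add[OF subM] by (subst abs_L2_add[OF sq IH(1), symmetric])
      then show ?case
        using square_integrable_add[OF sq IH(1)]
        unfolding sum.insert[OF insert.hyps] by blast
    qed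
    have "s x = (\<Sum>y\<in>range s - {0}. y * indicat_real (s -` {y}) x)" for x
    proof -
      have "(\<Sum>y\<in>range s - {0}. y * indicat_real (s -` {y}) x)
          = (\<Sum>y\<in>range s - {0}. if y = s x then y else 0)"
        by (intro sum.cong) (auto simp: indicator_def)
      also have "\<dots> = s x" using fin by (auto simp: sum.delta)
      finally show ?thesis by simp
    qed
    then have "s = (\<lambda>x. \<Sum>y\<in>range s - {0}. y * indicat_real (s -` {y}) x)" by blast
    then show ?thesis using Y[of "range s - {0}"] fin by auto
  qed

  have "v \<in> M" for v
  proof (rule limM)
    fix e :: real assume "e > 0"
    define f where "f = rep_L2 v"
    have f: "square_integrable f" "abs_L2 f = v"
      by (simp_all add: f_def square_integrable_rep_L2 abs_rep_L2)
    have fm: "f \<in> borel_measurable lebesgue" using f(1) by (simp add: square_integrable_def)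
    from borel_measurable_implies_sequence_metric[OF fm, of 0] obtain s where
      s: "\<And>i. simple_function lebesgue (s i)" "\<And>x. (\<lambda>i. s i x) \<longlonglongrightarrow> f x"
        "\<And>i x. \<bar>s i x\<bar> \<le> 2 * \<bar>f x\<bar>"
      by (simp add: dist_real_def) metis
    have sm: "s i \<in> borel_measurable lebesgue" for i
      using s(1) by (rule borel_measurable_simple_function)
    have sint: "integrable lebesgue (\<lambda>x. (s i x)\<^sup>2)" for i
    proof (rule Bochner_Integration.integrable_bound)
      show "integrable lebesgue (\<lambda>x. 4 * (f x)\<^sup>2)" using f(1) by (simp add: square_integrable_def)
      show "(\<lambda>x. (s i x)\<^sup>2) \<in> borel_measurable lebesgue" using sm by (intro borel_measurable_power)
      have "(s i x)\<^sup>2 \<le> 4 * (f x)\<^sup>2" for x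
        using power_mono[OF s(3)[of i x], of 2] by (simp add: power_mult_distrib)
      then show "AE x in lebesgue. norm ((s i x)\<^sup>2) \<le> norm (4 * (f x)\<^sup>2)" by simp
    qed
    have sM: "square_integrable (s i)" "abs_L2 (s i) \<in> M" for i
      using simpleM[OF s(1) sint] by auto
    have "(\<lambda>i. integral\<^sup>L lebesgue (\<lambda>x. (f x - s i x)\<^sup>2)) \<longlonglongrightarrow> integral\<^sup>L lebesgue (\<lambda>x::'a. 0)"
    proof (rule integral_dominated_convergence)
      show "integrable lebesgue (\<lambda>x. 9 * (f x)\<^sup>2)" using f(1) by (simp add: square_integrable_def)
      show "(\<lambda>x. (f x - s i x)\<^sup>2) \<in> borel_measurable lebesgue" for i
        using fm sm by (intro borel_measurable_power borel_measurable_diff)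
      have "(\<lambda>i. (f x - s i x)\<^sup>2) \<longlonglongrightarrow> (f x - f x)\<^sup>2" for x
        using s(2)[of x] by (intro tendsto_intros)
      then show "AE x in lebesgue. (\<lambda>i. (f x - s i x)\<^sup>2) \<longlonglongrightarrow> 0" by simp
      have "(f x - s i x)\<^sup>2 \<le> 9 * (f x)\<^sup>2" for i x
      proof -
        have "\<bar>f x - s i x\<bar> \<le> 3 * \<bar>f x\<bar>" using s(3)[of i x] by linarith
        then have "\<bar>f x - s i x\<bar>\<^sup>2 \<le> (3 * \<bar>f x\<bar>)\<^sup>2" by (intro power_mono) auto
        then show ?thesis by (simp add: power_mult_distrib)
      qed
      then show "AE x in lebesgue. norm ((f x - s i x)\<^sup>2) \<le> 9 * (f x)\<^sup>2" for i by simp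
    qed simp
    then have "(\<lambda>i. (norm (v - abs_L2 (s i)))\<^sup>2) \<longlonglongrightarrow> 0"
      unfolding f(2)[symmetric] abs_L2_diff[OF f(1) sM(1)]
        norm_L2_abs[OF square_integrable_diff[OF f(1) sM(1)]] by simp
    then obtain i where "(norm (v - abs_L2 (s i)))\<^sup>2 < e\<^sup>2"
      using LIMSEQ_D[of _ 0 "e\<^sup>2"] \<open>e > 0\<close> by fastforce
    then have "norm (v - abs_L2 (s i)) < e"
      using \<open>e > 0\<close> by (intro power_less_imp_less_base[of _ 2 e]) auto
    then show "\<exists>w\<in>M. norm (v - w) < e" using sM(2) by blast
  qed
  then have "closure D = UNIV" unfolding M_def by (intro UNIV_eq_I[symmetric])
  with D(1) show ?thesis by (intro exI[of _ D] conjI)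
qed

instance L2 :: (euclidean_space) second_countable_topology
proof
  obtain D :: "'a L2 set" where D: "countable D" "closure D = UNIV"
    using L2_countable_dense by blast
  define B where "B = (\<lambda>(d, n). ball d (1 / real (Suc n))) ` (D \<times> (UNIV :: nat set))"
  have "countable B" unfolding B_def using D(1) by simp
  moreover have "topological_basis B"
  proof (rule topological_basisI)
    show "open U" if "U \<in> B" for U using that by (auto simp: B_def)
    fix U and v :: "'a L2" assume "open U" "v \<in> U"
    then obtain e where e: "e > 0" "ball v e \<subseteq> U" by (meson open_contains_ball)
    obtain n where n: "1 / real (Suc n) < e / 2"
      using reals_Archimedean[of "e/2"] e(1) by (auto simp: inverse_eq_divide)
    have "v \<in> closure D" using D(2) by simp
    then obtain d where d: "d \<in> D" "dist d v < 1 / real (Suc n)"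
      by (metis closure_approachable of_nat_0_less_iff zero_less_Suc zero_less_divide_1_iff)
    have "ball d (1 / real (Suc n)) \<subseteq> ball v e"
    proof
      fix w assume "w \<in> ball d (1 / real (Suc n))"
      then show "w \<in> ball v e"
        using dist_triangle[of v w d] d(2) n by (simp add: dist_commute)
    qed
    then show "\<exists>V\<in>B. v \<in> V \<and> V \<subseteq> U"
      using d e(2) unfolding B_def by (intro bexI[of _ "ball d (1 / real (Suc n))"]) auto
  qed
  ultimately show "\<exists>B::'a L2 set set. countable B \<and> open = generate_topology B"
    using topological_basis_imp_subbasis by (intro exI[of _ B] conjI)
qed


definition L2_on :: "'a::euclidean_space set \<Rightarrow> 'a L2 set" where
  "L2_on \<Omega> = {v. AE x in lebesgue. x \<notin> \<Omega> \<longrightarrow> rep_L2 v x = 0}"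

definition Linfty :: "'a::euclidean_space set \<Rightarrow> ('a \<Rightarrow> 'b::{banach, second_countable_topology}) set" where
  "Linfty S = {g. g \<in> borel_measurable (lebesgue_on S) \<and>
     (\<exists>M. AE x in lebesgue_on S. norm (g x) \<le> M)}"

definition locally_integrable_on :: "('a::euclidean_space \<Rightarrow> real) \<Rightarrow> 'a set \<Rightarrow> bool"
    (infixr "locally'_integrable'_on" 46) where
  "g locally_integrable_on \<Omega> \<longleftrightarrow>
     (\<forall>K. compact K \<and> K \<subseteq> \<Omega> \<longrightarrow> set_integrable lebesgue K g)"


subsection \<open>Test functions and Sobolev spaces\<close>

definition partial_deriv :: "'a::euclidean_space \<Rightarrow> ('a \<Rightarrow> real) \<Rightarrow> 'a \<Rightarrow> real" where
  "partial_deriv b \<phi> x = frechet_derivative \<phi> (at x) b"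

primrec times_cont_diff :: "nat \<Rightarrow> ('a::euclidean_space \<Rightarrow> real) \<Rightarrow> bool" where
  "times_cont_diff 0 \<phi> \<longleftrightarrow> continuous_on UNIV \<phi>"
| "times_cont_diff (Suc k) \<phi> \<longleftrightarrow>
     (\<forall>x. \<phi> differentiable (at x)) \<and> (\<forall>b\<in>Basis. times_cont_diff k (partial_deriv b \<phi>))"

definition test_functions :: "'a::euclidean_space set \<Rightarrow> ('a \<Rightarrow> real) set" where
  "test_functions \<Omega> = {\<phi>. (\<forall>k. times_cont_diff k \<phi>) \<and>
     compact (closure {x. \<phi> x \<noteq> 0}) \<and> closure {x. \<phi> x \<noteq> 0} \<subseteq> \<Omega>}"

definition has_weak_partial :: "'a::euclidean_space set \<Rightarrow> 'a \<Rightarrow> 'a L2 \<Rightarrow> 'a L2 \<Rightarrow> bool" where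
  "has_weak_partial \<Omega> b v g \<longleftrightarrow> g \<in> L2_on \<Omega> \<and>
     (\<forall>\<phi>\<in>test_functions \<Omega>. v \<bullet> abs_L2 (partial_deriv b \<phi>) = - (g \<bullet> abs_L2 \<phi>))"

definition weak_partial :: "'a::euclidean_space set \<Rightarrow> 'a \<Rightarrow> 'a L2 \<Rightarrow> 'a L2" where
  "weak_partial \<Omega> b v = (THE g. has_weak_partial \<Omega> b v g)"

definition weak_grad :: "(real^'n) set \<Rightarrow> (real^'n) L2 \<Rightarrow> real^'n \<Rightarrow> real^'n" where
  "weak_grad \<Omega> v x = (\<chi> i. rep_L2 (weak_partial \<Omega> (axis i 1) v) x)"

definition H1 :: "'a::euclidean_space set \<Rightarrow> 'a L2 set" where
  "H1 \<Omega> = {v \<in> L2_on \<Omega>. \<forall>b\<in>Basis. \<exists>g. has_weak_partial \<Omega> b v g}"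

definition H1_norm :: "'a::euclidean_space set \<Rightarrow> 'a L2 \<Rightarrow> real" where
  "H1_norm \<Omega> v = sqrt ((norm v)\<^sup>2 + (\<Sum>b\<in>Basis. (norm (weak_partial \<Omega> b v))\<^sup>2))"

definition H10 :: "'a::euclidean_space set \<Rightarrow> 'a L2 set" where
  "H10 \<Omega> = {v \<in> H1 \<Omega>. \<forall>e>0. \<exists>\<phi>\<in>test_functions \<Omega>. H1_norm \<Omega> (v - abs_L2 \<phi>) < e}"

text \<open>The Bochner--Sobolev space $W^{1,\infty}(a,b;X)$.\<close>

definition W1_infty :: "real \<Rightarrow> real \<Rightarrow> (real \<Rightarrow> 'b::{banach, second_countable_topology}) set" where
  "W1_infty a b = {y \<in> Linfty {a<..<b}. \<exists>z\<in>Linfty {a<..<b}. \<forall>\<phi>\<in>test_functions {a<..<b}.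
     (LINT t|lebesgue_on {a<..<b}. deriv \<phi> t *\<^sub>R y t) =
     - (LINT t|lebesgue_on {a<..<b}. \<phi> t *\<^sub>R z t)}"


subsection \<open>Domain and elliptic operator\<close>

text \<open>
  Near each boundary point, in coordinates with \<open>e\<close> as last axis, \<open>\<Omega>\<close> is the set above the graph
  of a Lipschitz function \<open>\<gamma>\<close> of the remaining coordinates.
\<close>

definition bounded_Lipschitz_domain :: "'a::euclidean_space set \<Rightarrow> bool" where
  "bounded_Lipschitz_domain \<Omega> \<longleftrightarrow> \<Omega> \<noteq> {} \<and> open \<Omega> \<and> connected \<Omega> \<and> bounded \<Omega> \<and>
     (\<forall>z\<in>frontier \<Omega>. \<exists>e r K \<gamma>. norm e = 1 \<and> r > 0 \<and> K-lipschitz_on {y. y \<bullet> e = 0} \<gamma> \<and>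
        (\<forall>x\<in>ball z r. x \<in> \<Omega> \<longleftrightarrow> \<gamma> (x - (x \<bullet> e) *\<^sub>R e) < x \<bullet> e))"

text \<open>
  A linear second-order elliptic operator in general divergence form with bounded measurable
  coefficients,
  $\mathcal L v = -\mathrm{div}(A\nabla v + a v) + b\cdot\nabla v + c v$,
  as the operator $H^1_0(\Omega)\to H^{-1}(\Omega)$:  \<open>L v w\<close> is the duality pairing
  $\langle\mathcal L v,w\rangle$, which is the $L_2(\Omega)$ inner product if
  $\mathcal L v\in L_2(\Omega)$.
\<close>

definition elliptic_operator ::
    "(real^'n) set \<Rightarrow> ((real^'n) L2 \<Rightarrow> (real^'n) L2 \<Rightarrow> real) \<Rightarrow> bool" where
  "elliptic_operator \<Omega> L \<longleftrightarrow>
     (\<exists>(A :: real^'n \<Rightarrow> real^'n^'n) (a :: real^'n \<Rightarrow> real^'n) (b :: real^'n \<Rightarrow> real^'n)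
        (c :: real^'n \<Rightarrow> real).
        A \<in> Linfty \<Omega> \<and> a \<in> Linfty \<Omega> \<and> b \<in> Linfty \<Omega> \<and> c \<in> Linfty \<Omega> \<and>
        (\<exists>\<theta>>0. AE x in lebesgue_on \<Omega>. \<forall>\<xi>. \<xi> \<bullet> (A x *v \<xi>) \<ge> \<theta> * (norm \<xi>)\<^sup>2) \<and>
        (\<forall>v\<in>H10 \<Omega>. \<forall>w\<in>H10 \<Omega>. L v w =
           (LINT x|lebesgue_on \<Omega>.
              (A x *v weak_grad \<Omega> v x + rep_L2 v x *\<^sub>R a x) \<bullet> weak_grad \<Omega> w x
              + (b x \<bullet> weak_grad \<Omega> v x + c x * rep_L2 v x) * rep_L2 w x)))"


subsection \<open>The multiterm time-fractional problem\<close>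

text \<open>
  For \<open>\<alpha> = 1\<close> the time derivative is the left one: it is the usual derivative wherever that exists,
  and where \<open>\<partial>\<^sub>t y\<close> has a jump it is the value of its left-continuous version.
\<close>

definition time_deriv :: "real \<Rightarrow> (real \<Rightarrow> 'b::{banach, second_countable_topology}) \<Rightarrow> real \<Rightarrow> 'b" where
  "time_deriv \<alpha> y t =
     (if \<alpha> = 1 then vector_derivative y (at_left t)
      else inverse (Gamma (1 - \<alpha>)) *\<^sub>R
        ((t powr (- \<alpha>)) *\<^sub>R (y t - y 0)
         + (LBINT s:{0..t}. (\<alpha> * (t - s) powr (- \<alpha> - 1)) *\<^sub>R (y t - y s))))"

definition multiterm_deriv ::
    "nat \<Rightarrow> (nat \<Rightarrow> real) \<Rightarrow> (nat \<Rightarrow> real \<Rightarrow> real) \<Rightarrow>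
     (real \<Rightarrow> 'b::{banach, second_countable_topology}) \<Rightarrow> real \<Rightarrow> 'b" where
  "multiterm_deriv l \<alpha> q y t = (\<Sum>i=1..l. q i t *\<^sub>R time_deriv (\<alpha> i) y t)"

text \<open>
  The last condition makes \<open>\<partial>\<^sub>t y\<close> meaningful at every \<open>t\<close> in \<open>(0,T]\<close> when it occurs in the equation,
  i.e. when \<open>\<alpha>\<^sub>1 = 1\<close>.  Homogeneous boundary values are expressed by membership in \<open>H10 \<Omega>\<close>.
\<close>

definition solution_class ::
    "(real^'n) set \<Rightarrow> real \<Rightarrow> (nat \<Rightarrow> real) \<Rightarrow> (real \<Rightarrow> (real^'n) L2) set" where
  "solution_class \<Omega> T \<alpha> = {y.
     (\<forall>t\<in>{0..T}. y t \<in> L2_on \<Omega>) \<and> continuous_on {0..T} y \<and>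
     (\<forall>\<epsilon>\<in>{0<..T}. y \<in> W1_infty \<epsilon> T) \<and>
     (\<forall>t\<in>{0<..T}. y t \<in> H10 \<Omega>) \<and>
     (\<alpha> 1 = 1 \<longrightarrow> (\<forall>t\<in>{0<..T}. y differentiable (at_left t)))}"

text \<open>
  \<open>residual \<Omega> l \<alpha> q L f y t\<close> is the distribution
  $\bigl(\sum_i q_i(t) D_t^{\alpha_i} + \mathcal L\bigr) y(\cdot,t) - f(\cdot,t)$ on \<open>\<Omega>\<close>,
  given by its values on test functions.
\<close>

definition residual ::
    "(real^'n) set \<Rightarrow> nat \<Rightarrow> (nat \<Rightarrow> real) \<Rightarrow> (nat \<Rightarrow> real \<Rightarrow> real) \<Rightarrow>
     ((real^'n) L2 \<Rightarrow> (real^'n) L2 \<Rightarrow> real) \<Rightarrow> (real^'n \<Rightarrow> real \<Rightarrow> real) \<Rightarrow>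
     (real \<Rightarrow> (real^'n) L2) \<Rightarrow> real \<Rightarrow> (real^'n \<Rightarrow> real) \<Rightarrow> real" where
  "residual \<Omega> l \<alpha> q L f y t \<phi> =
     multiterm_deriv l \<alpha> q y t \<bullet> abs_L2 \<phi> + L (y t) (abs_L2 \<phi>)
     - (LINT x|lebesgue_on \<Omega>. f x t * \<phi> x)"

definition solves_problem ::
    "(real^'n) set \<Rightarrow> real \<Rightarrow> nat \<Rightarrow> (nat \<Rightarrow> real) \<Rightarrow> (nat \<Rightarrow> real \<Rightarrow> real) \<Rightarrow>
     ((real^'n) L2 \<Rightarrow> (real^'n) L2 \<Rightarrow> real) \<Rightarrow> (real^'n \<Rightarrow> real \<Rightarrow> real) \<Rightarrow> (real^'n) L2 \<Rightarrow>
     (real \<Rightarrow> (real^'n) L2) \<Rightarrow> bool" where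
  "solves_problem \<Omega> T l \<alpha> q L f u0 u \<longleftrightarrow>
     u \<in> solution_class \<Omega> T \<alpha> \<and> u 0 = u0 \<and>
     (\<forall>t\<in>{0<..T}. \<forall>\<phi>\<in>test_functions \<Omega>. residual \<Omega> l \<alpha> q L f u t \<phi> = 0)"

definition barrier_class :: "real \<Rightarrow> (nat \<Rightarrow> real) \<Rightarrow> (real \<Rightarrow> real) set" where
  "barrier_class T \<alpha> = {E.
     continuous_on {0..T} E \<and>
     (\<forall>\<epsilon> t. 0 < \<epsilon> \<and> \<epsilon> < t \<and> t \<le> T \<longrightarrow> E \<in> W1_infty \<epsilon> t) \<and>
     (\<alpha> 1 = 1 \<longrightarrow> (\<forall>t\<in>{0<..T}. E differentiable (at_left t) \<and>
        continuous (at_left t) (\<lambda>s. vector_derivative E (at_left s)))) \<and>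
     (\<forall>t\<in>{0..T}. E t \<ge> 0)}"

end

theory Submission
  imports Defs
begin

text \<open>
  Let $e=u_h-u$.  Subtracting the two weak equations, \<open>R_h\<close> is the residual of $e$ for the
  homogeneous problem, so testing with $e(t)$ itself and using coercivity gives
  \[ \langle De(t),e(t)\rangle+\lambda\|e(t)\|^2\le\langle R_h(t),e(t)\rangle
     \le\|e(t)\|\,(D+\lambda)\mathcal E(t),\qquad D=\sum_i q_iD_t^{\alpha_i}. \]
  The bound $\|e\|\le\mathcal E$ follows by a maximum principle
  (\<open>multiterm_comparison\<close>).  If it failed, then at a negative minimum $t>0$ of
  $\mathcal E-\|e\|$, slightly tilted in time, the function
  $g(s)=\langle e(s),e(t)\rangle-\|e(t)\|\,\mathcal E(s)$ would have a strict maximum over the past.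
  Every fractional derivative is positive at such a point
  (\<open>time_deriv_pos_at_maximum\<close>), so
  $\langle De(t),e(t)\rangle>\|e(t)\|\,D\mathcal E(t)$, which contradicts the inequality above
  because $\lambda\|e(t)\|^2\ge\lambda\|e(t)\|\,\mathcal E(t)$.

  Two analytic facts support this argument.  In space, the equations are tested with smooth functions
  only, and the passage to the test function $e(t)\in H^1_0(\Omega)$
  (\<open>weak_equation_extends_to_H10\<close>) needs that the elliptic form is bounded in the
  $H^1$ norm and respects differences.  This rests on the uniqueness of weak derivatives, that is, on the fundamental lemma
  of the calculus of variations (\<open>L2_on_eq_0_if_orthogonal\<close>).  In time,
  the operators $D_t^{\alpha}$ are linear only where their defining integrals converge.  They do, because a
  continuous function in $W^{1,\infty}(\epsilon,T)$ for all $\epsilon>0$ is Lipschitz away from zero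
  (\<open>W1_infty_lipschitz\<close>).  Both facts require smooth cut-off functions, which are
  built from $e^{-1/x}$.
\<close>

section \<open>Smooth functions\<close>

lemma partial_deriv_eq:
  assumes "(\<phi> has_derivative D) (at x)"
  shows "partial_deriv b \<phi> x = D b"
  using frechet_derivative_at[OF assms] by (simp add: partial_deriv_def)

lemma times_cont_diff_SucI:
  assumes "\<And>x. (\<phi> has_derivative D x) (at x)"
    and "\<And>b. b \<in> Basis \<Longrightarrow> times_cont_diff k (\<lambda>x. D x b)"
  shows "times_cont_diff (Suc k) \<phi>"
proof -
  have "partial_deriv b \<phi> = (\<lambda>x. D x b)" for b
    using assms(1) by (intro ext partial_deriv_eq)
  then show ?thesis using assms by (auto simp: differentiable_def)
qed

lemma times_cont_diff_SucD:
  assumes "times_cont_diff (Suc k) \<phi>"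
  shows "(\<phi> has_derivative frechet_derivative \<phi> (at x)) (at x)"
    and "b \<in> Basis \<Longrightarrow> times_cont_diff k (\<lambda>x. frechet_derivative \<phi> (at x) b)"
  using assms by (auto simp: frechet_derivative_works partial_deriv_def[abs_def])

lemma times_cont_diff_pred: "times_cont_diff (Suc k) \<phi> \<Longrightarrow> times_cont_diff k \<phi>"
proof (induction k arbitrary: \<phi>)
  case 0
  then show ?case
    by (auto intro!: continuous_at_imp_continuous_on differentiable_imp_continuous_within)
next
  case (Suc k)
  have "(\<forall>x. \<phi> differentiable (at x)) \<and> (\<forall>b\<in>Basis. times_cont_diff (Suc k) (partial_deriv b \<phi>))"
    by (rule times_cont_diff.simps(2)[THEN iffD1, OF Suc.prems])
  then have "(\<forall>x. \<phi> differentiable (at x)) \<and> (\<forall>b\<in>Basis. times_cont_diff k (partial_deriv b \<phi>))"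
    using Suc.IH by blast
  then show ?case by (rule times_cont_diff.simps(2)[THEN iffD2])
qed

lemma times_cont_diff_const: "times_cont_diff k (\<lambda>x. c)"
proof (induction k arbitrary: c)
  case (Suc k)
  show ?case by (rule times_cont_diff_SucI[where D="\<lambda>x h. 0"]) (auto intro: Suc)
qed simp

lemma times_cont_diff_add:
  "times_cont_diff k f \<Longrightarrow> times_cont_diff k g \<Longrightarrow> times_cont_diff k (\<lambda>x. f x + g x)"
proof (induction k arbitrary: f g)
  case (Suc k)
  note f = times_cont_diff_SucD[OF Suc.prems(1)] and g = times_cont_diff_SucD[OF Suc.prems(2)]
  show ?case
    by (rule times_cont_diff_SucI[OF has_derivative_add[OF f(1) g(1)]]) (intro Suc.IH f(2) g(2))
qed (simp add: continuous_on_add)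

lemma times_cont_diff_mult:
  "times_cont_diff k f \<Longrightarrow> times_cont_diff k g \<Longrightarrow> times_cont_diff k (\<lambda>x. f x * g x)"
proof (induction k arbitrary: f g)
  case (Suc k)
  note f = times_cont_diff_SucD[OF Suc.prems(1)] and g = times_cont_diff_SucD[OF Suc.prems(2)]
  show ?case
    by (rule times_cont_diff_SucI[OF has_derivative_mult[OF f(1) g(1)]])
      (intro times_cont_diff_add Suc.IH f(2) g(2) Suc.prems[THEN times_cont_diff_pred])
qed (simp add: continuous_on_mult)

lemma times_cont_diff_diff:
  assumes "times_cont_diff k f" "times_cont_diff k g"
  shows "times_cont_diff k (\<lambda>x. f x - g x)"
  using times_cont_diff_add[OF assms(1) times_cont_diff_mult[OF times_cont_diff_const[where c="-1"] assms(2)]]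
  by simp

lemma times_cont_diff_prod:
  assumes "finite I" "\<And>i. i \<in> I \<Longrightarrow> times_cont_diff k (f i)"
  shows "times_cont_diff k (\<lambda>x. \<Prod>i\<in>I. f i x)"
  using assms by (induction I) (simp_all add: times_cont_diff_mult times_cont_diff_const)

lemma times_cont_diff_power:
  "times_cont_diff k f \<Longrightarrow> times_cont_diff k (\<lambda>x. f x ^ n)"
  by (induction n) (simp_all add: times_cont_diff_mult times_cont_diff_const)

lemma times_cont_diff_inverse:
  assumes "\<And>x. f x \<noteq> 0"
  shows "times_cont_diff k f \<Longrightarrow> times_cont_diff k (\<lambda>x. inverse (f x))"
proof (induction k)
  case 0
  then show ?case using assms by (simp add: continuous_on_inverse)
next
  case (Suc k)
  note f = times_cont_diff_SucD[OF Suc.prems]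
  have inv: "times_cont_diff k (\<lambda>x. inverse (f x))"
    using Suc.prems by (rule Suc.IH[OF times_cont_diff_pred])
  have "times_cont_diff k (\<lambda>x. (inverse (f x) * frechet_derivative f (at x) b) * inverse (f x))"
    if "b \<in> Basis" for b
    by (intro times_cont_diff_mult inv f(2) that)
  from times_cont_diff_mult[OF times_cont_diff_const[where c="-1"] this]
  show ?case
    by (intro times_cont_diff_SucI[OF Deriv.has_derivative_inverse[OF assms f(1)]]) simp
qed

lemma times_cont_diff_compose_affine:
  fixes h :: "real \<Rightarrow> real" and m :: "'a::euclidean_space \<Rightarrow> real"
  assumes m: "bounded_linear m"
  shows "times_cont_diff k h \<Longrightarrow> times_cont_diff k (\<lambda>x. h (m x + c))"
proof (induction k arbitrary: h)
  case 0
  then show ?case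
    by (auto intro!: continuous_on_compose2[of UNIV h] continuous_on_add linear_continuous_on[OF m])
next
  case (Suc k)
  let ?D = "\<lambda>x. frechet_derivative h (at x)"
  note h = times_cont_diff_SucD[OF Suc.prems]
  have 1: "((\<lambda>x. m x + c) has_derivative m) (at x)" for x
    using bounded_linear_imp_has_derivative[OF m] by (auto intro!: derivative_eq_intros)
  have lin: "?D x y = y * ?D x 1" for x y
    using linear_scale[OF linear_frechet_derivative, of h "at x" y 1] h(1)[of x]
    by (auto simp: differentiable_def)
  show ?case
  proof (rule times_cont_diff_SucI)
    show "((\<lambda>x. h (m x + c)) has_derivative (\<lambda>y. m y * ?D (m x + c) 1)) (at x)" for x
      using has_derivative_compose[OF 1 h(1)] by (subst lin[symmetric])
    show "times_cont_diff k (\<lambda>x. m b * ?D (m x + c) 1)" for b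
      using Suc.IH[OF h(2)[of 1]] by (intro times_cont_diff_mult times_cont_diff_const) simp
  qed
qed

lemma times_cont_diff_realI:
  assumes "\<And>x. (f has_real_derivative f' x) (at x)" "times_cont_diff k f'"
  shows "times_cont_diff (Suc k) f"
proof (rule times_cont_diff_SucI)
  show "(f has_derivative (\<lambda>h. f' x * h)) (at x)" for x
    using assms(1) by (simp add: has_field_derivative_def)
qed (use assms(2) in simp)

text \<open>
  The flat functions $p(1/x)e^{-1/x}$, extended by zero to $x\le 0$, with $p$ a polynomial, are closed
  under differentiation: the derivative belongs to the polynomial $X^2(p-p')$, and at zero
  exponential decay beats every power of $1/x$.
\<close>

definition flat_exp :: "real poly \<Rightarrow> real \<Rightarrow> real" where
  "flat_exp p x = (if x \<le> 0 then 0 else poly p (1 / x) * exp (- (1 / x)))"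

lemma tendsto_poly_exp_0: "((\<lambda>x::real. poly p x * exp (- x)) \<longlongrightarrow> 0) at_top"
proof -
  have "((\<lambda>x::real. \<Sum>i\<le>degree p. coeff p i * (x ^ i / exp x)) \<longlongrightarrow> (\<Sum>i\<le>degree p. coeff p i * 0)) at_top"
    by (intro tendsto_intros tendsto_power_div_exp_0)
  then show ?thesis
    by (simp add: poly_altdef sum_distrib_right exp_minus divide_inverse mult.assoc)
qed

lemma tendsto_flat_exp_0: "(flat_exp p \<longlongrightarrow> 0) (at 0)"
proof (rule filterlim_split_at_real)
  show "(flat_exp p \<longlongrightarrow> 0) (at_left 0)"
    by (rule tendsto_eventually)
      (auto simp: eventually_at_left_field flat_exp_def intro!: exI[of _ "-1"])
  have "((\<lambda>x. poly p (inverse x) * exp (- inverse x)) \<longlongrightarrow> 0) (at_right 0)"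
    by (rule filterlim_compose[OF tendsto_poly_exp_0 filterlim_inverse_at_top_right])
  then show "(flat_exp p \<longlongrightarrow> 0) (at_right 0)"
    by (rule Lim_transform_eventually)
      (auto simp: flat_exp_def inverse_eq_divide eventually_at_right_field intro!: exI[of _ 1])
qed

lemma flat_exp_deriv:
  "(flat_exp p has_real_derivative flat_exp ([:0, 0, 1:] * (p - pderiv p)) x) (at x)"
proof -
  consider "x < 0" | "x = 0" | "x > 0" by linarith
  then show ?thesis
  proof cases
    case 1
    have "((\<lambda>x. 0) has_real_derivative 0) (at x)" by simp
    then have "(flat_exp p has_real_derivative 0) (at x)"
      by (rule DERIV_cong_ev[THEN iffD1, rotated -1])
        (use 1 in \<open>auto simp: flat_exp_def eventually_nhds intro!: exI[of _ "{..<0}"]\<close>)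
    then show ?thesis using 1 by (simp add: flat_exp_def)
  next
    case 2
    have "((\<lambda>h. flat_exp p h / h) \<longlongrightarrow> 0) (at 0)"
    proof (rule Lim_transform_eventually[OF tendsto_flat_exp_0[of "[:0, 1:] * p"]])
      show "\<forall>\<^sub>F h in at 0. flat_exp ([:0, 1:] * p) h = flat_exp p h / h"
        by (auto simp: flat_exp_def)
    qed
    then show ?thesis using 2 by (simp add: DERIV_def flat_exp_def)
  next
    case 3
    have "((\<lambda>x. poly p (1 / x) * exp (- (1 / x))) has_real_derivative
        flat_exp ([:0, 0, 1:] * (p - pderiv p)) x) (at x)"
      using 3 by (auto intro!: derivative_eq_intros simp: flat_exp_def field_simps power2_eq_square)
    then show ?thesis
      by (rule DERIV_cong_ev[THEN iffD1, rotated -1])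
        (use 3 in \<open>auto simp: flat_exp_def eventually_nhds intro!: exI[of _ "{0<..}"]\<close>)
  qed
qed

lemma times_cont_diff_flat_exp: "times_cont_diff k (flat_exp p)"
proof (induction k arbitrary: p)
  case 0
  show ?case
    using DERIV_isCont[OF flat_exp_deriv] by (auto intro: continuous_at_imp_continuous_on)
next
  case (Suc k)
  show ?case by (rule times_cont_diff_realI[OF flat_exp_deriv Suc])
qed

lemma flat_exp_1: "flat_exp 1 x = (if x \<le> 0 then 0 else exp (- (1 / x)))"
  by (simp add: flat_exp_def)

definition smooth_step :: "real \<Rightarrow> real" where
  "smooth_step x = flat_exp 1 x * inverse (flat_exp 1 x + flat_exp 1 (1 - x))"

lemma flat_exp_1_nonneg: "0 \<le> flat_exp 1 x"
  by (simp add: flat_exp_1)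

lemma flat_exp_sum_pos: "0 < flat_exp 1 x + flat_exp 1 (1 - x)"
  by (auto simp: flat_exp_1 add_pos_pos)

lemma smooth_step_eq_0: "x \<le> 0 \<Longrightarrow> smooth_step x = 0"
  and smooth_step_eq_1: "1 \<le> x \<Longrightarrow> smooth_step x = 1"
  by (simp_all add: smooth_step_def flat_exp_1)

lemma smooth_step_bounds: "0 \<le> smooth_step x" "smooth_step x \<le> 1"
  using flat_exp_1_nonneg[of x] flat_exp_1_nonneg[of "1 - x"] flat_exp_sum_pos[of x]
  by (auto simp: smooth_step_def field_simps)

lemma times_cont_diff_smooth_step: "times_cont_diff k smooth_step"
proof -
  have "times_cont_diff k (\<lambda>x. flat_exp 1 (- x + 1))"
    by (rule times_cont_diff_compose_affine[OF _ times_cont_diff_flat_exp])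
      (simp add: bounded_linear_minus bounded_linear_ident)
  then have "times_cont_diff k (\<lambda>x. flat_exp 1 x + flat_exp 1 (1 - x))"
    by (intro times_cont_diff_add times_cont_diff_flat_exp) (simp add: algebra_simps)
  moreover have "flat_exp 1 x + flat_exp 1 (1 - x) \<noteq> 0" for x
    using flat_exp_sum_pos[of x] by simp
  ultimately show ?thesis
    unfolding smooth_step_def[abs_def]
    by (intro times_cont_diff_mult times_cont_diff_flat_exp times_cont_diff_inverse)
qed

section \<open>Test functions and the fundamental lemma of the calculus of variations\<close>

lemma test_functionsI:
  assumes "\<And>k. times_cont_diff k \<phi>" "compact K" "K \<subseteq> \<Omega>" "\<And>x. x \<notin> K \<Longrightarrow> \<phi> x = 0"
  shows "\<phi> \<in> test_functions \<Omega>"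
proof -
  have "closure {x. \<phi> x \<noteq> 0} \<subseteq> K"
    using assms(2,4) by (intro closure_minimal) (auto intro: compact_imp_closed)
  moreover from this have "compact (closure {x. \<phi> x \<noteq> 0})"
    using assms(2) by (metis closed_closure compact_Int_closed inf.absorb_iff2)
  ultimately show ?thesis
    using assms(1,3) by (auto simp: test_functions_def)
qed

lemma test_functionsE:
  assumes "\<phi> \<in> test_functions \<Omega>"
  obtains K where "\<And>k. times_cont_diff k \<phi>" "compact K" "K \<subseteq> \<Omega>" "\<And>x. x \<notin> K \<Longrightarrow> \<phi> x = 0"
  by (rule that[of "closure {x. \<phi> x \<noteq> 0}"])
    (use assms closure_subset[of "{x. \<phi> x \<noteq> 0}"] in \<open>auto simp: test_functions_def\<close>)

lemma partial_deriv_eq_0_outside: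
  assumes "compact K" "\<And>x. x \<notin> K \<Longrightarrow> \<phi> x = 0" "x \<notin> K"
  shows "partial_deriv b \<phi> x = 0"
proof -
  have "(\<phi> has_derivative (\<lambda>h. 0)) (at x)"
  proof (rule has_derivative_transform_within_open)
    show "((\<lambda>x. 0) has_derivative (\<lambda>h. 0)) (at x)" by simp
    show "open (- K)" using assms(1) by (simp add: compact_imp_closed open_Compl)
  qed (use assms in auto)
  then show ?thesis by (rule partial_deriv_eq)
qed

lemma test_functions_partial_deriv:
  assumes "\<phi> \<in> test_functions \<Omega>" "b \<in> Basis"
  shows "partial_deriv b \<phi> \<in> test_functions \<Omega>"
proof -
  obtain K where K: "\<And>k. times_cont_diff k \<phi>" "compact K" "K \<subseteq> \<Omega>" "\<And>x. x \<notin> K \<Longrightarrow> \<phi> x = 0"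
    using assms(1) by (rule test_functionsE) blast
  have "times_cont_diff k (partial_deriv b \<phi>)" for k
    using K(1)[of "Suc k"] assms(2) by simp
  then show ?thesis
    using K partial_deriv_eq_0_outside[OF K(2,4)] by (intro test_functionsI)
qed

lemma test_functions_diff:
  assumes "\<phi> \<in> test_functions \<Omega>" "\<psi> \<in> test_functions \<Omega>"
  shows "(\<lambda>x. \<phi> x - \<psi> x) \<in> test_functions \<Omega>"
proof -
  obtain K where K: "\<And>k. times_cont_diff k \<phi>" "compact K" "K \<subseteq> \<Omega>" "\<And>x. x \<notin> K \<Longrightarrow> \<phi> x = 0"
    using assms(1) by (rule test_functionsE) blast
  obtain J where J: "\<And>k. times_cont_diff k \<psi>" "compact J" "J \<subseteq> \<Omega>" "\<And>x. x \<notin> J \<Longrightarrow> \<psi> x = 0"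
    using assms(2) by (rule test_functionsE) blast
  show ?thesis
  proof (rule test_functionsI[of _ "K \<union> J"])
    show "times_cont_diff k (\<lambda>x. \<phi> x - \<psi> x)" for k
      by (rule times_cont_diff_diff[OF K(1) J(1)])
  qed (use K J in auto)
qed

lemma continuous_on_test_function: "\<phi> \<in> test_functions \<Omega> \<Longrightarrow> continuous_on S \<phi>"
  by (rule continuous_on_subset[of UNIV])
    (auto simp: test_functions_def dest: spec[of _ 0])

lemma compact_support_integrable:
  fixes f :: "'a::euclidean_space \<Rightarrow> real"
  assumes "continuous_on UNIV f" "compact K" "\<And>x. x \<notin> K \<Longrightarrow> f x = 0"
  shows "integrable lborel f" "integrable lebesgue f"
proof -
  have "(\<lambda>x. indicator K x *\<^sub>R f x) = f"
    using assms(3) by (force simp: indicator_def)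
  then show "integrable lborel f"
    using borel_integrable_compact[OF assms(2) continuous_on_subset[OF assms(1)]] by simp
  then show "integrable lebesgue f"
    by (simp add: integrable_completion)
qed

lemma square_integrable_test_function:
  assumes "\<phi> \<in> test_functions \<Omega>"
  shows "square_integrable \<phi>"
proof -
  obtain K where K: "compact K" "\<And>x. x \<notin> K \<Longrightarrow> \<phi> x = 0"
    using assms by (rule test_functionsE) blast
  have c: "continuous_on UNIV \<phi>" using assms by (rule continuous_on_test_function)
  have "integrable lebesgue (\<lambda>x. (\<phi> x)\<^sup>2)"
    using K by (intro compact_support_integrable[of _ K] continuous_on_power c) simp_all
  moreover have "\<phi> \<in> borel_measurable lebesgue"
    using compact_support_integrable(2)[OF c K] by (rule borel_measurable_integrable)
  ultimately show ?thesis by (simp add: square_integrable_def)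
qed

text \<open>
  Translation invariance of Lebesgue measure makes the integrals of all difference quotients
  vanish; they are dominated because the derivative is bounded with compact support.
\<close>

lemma integral_partial_deriv_eq_0:
  fixes F :: "'a::euclidean_space \<Rightarrow> real"
  assumes F: "F \<in> test_functions \<Omega>" and b: "b \<in> Basis"
  shows "integral\<^sup>L lebesgue (partial_deriv b F) = 0"
proof -
  obtain K where K: "\<And>k. times_cont_diff k F" "compact K" "\<And>x. x \<notin> K \<Longrightarrow> F x = 0"
    using F by (rule test_functionsE) blast
  have cF: "continuous_on UNIV F" using F by (rule continuous_on_test_function)
  have P: "partial_deriv b F \<in> test_functions \<Omega>"
    using F b by (rule test_functions_partial_deriv)
  have cP: "continuous_on S (partial_deriv b F)" for S
    using P by (rule continuous_on_test_function)
  have P0: "partial_deriv b F x = 0" if "x \<notin> K" for x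
    using K(2,3) that by (rule partial_deriv_eq_0_outside)
  obtain C where C: "C > 0" "\<And>x. x \<in> K \<Longrightarrow> \<bar>partial_deriv b F x\<bar> \<le> C"
    using compact_imp_bounded[OF compact_continuous_image[OF cP K(2)]]
    by (auto simp: bounded_pos)
  have C': "\<bar>partial_deriv b F x\<bar> \<le> C" for x
    using C P0[of x] by (cases "x \<in> K") auto
  obtain R where R: "R > 0" "K \<subseteq> cball 0 R"
    using compact_imp_bounded[OF K(2)] by (force simp: bounded_pos)
  have nb: "norm b = 1" using b by simp
  have along_line: "((\<lambda>t. F (x + t *\<^sub>R b)) has_real_derivative partial_deriv b F (x + t *\<^sub>R b)) (at t)" for x t
  proof -
    let ?D = "frechet_derivative F (at (x + t *\<^sub>R b))"
    have D: "(F has_derivative ?D) (at (x + t *\<^sub>R b))"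
      by (rule times_cont_diff_SucD(1)[OF K(1)[of "Suc 0"]])
    have "((\<lambda>t. x + t *\<^sub>R b) has_derivative (\<lambda>h. h *\<^sub>R b)) (at t)"
      by (auto intro!: derivative_eq_intros)
    then have "((\<lambda>t. F (x + t *\<^sub>R b)) has_derivative (\<lambda>h. ?D (h *\<^sub>R b))) (at t)"
      using D by (rule has_derivative_compose)
    moreover have "?D (h *\<^sub>R b) = partial_deriv b F (x + t *\<^sub>R b) * h" for h
      using linear_scale[OF has_derivative_linear[OF D]] by (simp add: partial_deriv_def)
    ultimately show ?thesis by (simp add: has_field_derivative_def)
  qed
  define h where "h n = 1 / real (Suc n)" for n
  have h: "0 < h n" "h n \<le> 1" for n by (auto simp: h_def)
  define D where "D n x = (F (x + h n *\<^sub>R b) - F x) / h n" for n x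
  have iF: "integrable lborel F"
    using compact_support_integrable(1)[OF cF K(2,3)] .
  have shift: "integrable lborel (\<lambda>x. F (x + c))" "integral\<^sup>L lborel (\<lambda>x. F (x + c)) = integral\<^sup>L lborel F" for c
  proof -
    have m: "(+) c \<in> borel_measurable lborel" "F \<in> borel_measurable borel"
      using cF by (auto intro: borel_measurable_continuous_onI)
    show "integrable lborel (\<lambda>x. F (x + c))"
      using integrable_distr_eq[of "(+) c" lborel borel F] m iF
      by (simp add: lborel_distr_plus add.commute)
    show "integral\<^sup>L lborel (\<lambda>x. F (x + c)) = integral\<^sup>L lborel F"
      using integral_distr[of "(+) c" lborel borel F] m
      by (simp add: lborel_distr_plus add.commute)
  qed
  have D0: "integral\<^sup>L lborel (D n) = 0" for n
    unfolding D_def using shift iF by simp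
  have "(\<lambda>n. integral\<^sup>L lborel (D n)) \<longlonglongrightarrow> integral\<^sup>L lborel (partial_deriv b F)"
  proof (rule integral_dominated_convergence)
    show "integrable lborel (\<lambda>x. C * indicat_real (cball 0 (R + 1)) x)"
      using emeasure_bounded_finite[OF bounded_cball, of 0 "R + 1"]
      by (intro integrable_mult_right integrable_real_indicator) auto
    show "partial_deriv b F \<in> borel_measurable lborel"
      using borel_measurable_continuous_onI[OF cP[of UNIV]] by simp
    show "D n \<in> borel_measurable lborel" for n
      using borel_measurable_integrable[OF shift(1)] borel_measurable_integrable[OF iF]
      unfolding D_def[abs_def] by (intro borel_measurable_divide borel_measurable_diff) auto
    show "AE x in lborel. (\<lambda>n. D n x) \<longlonglongrightarrow> partial_deriv b F x"
    proof (rule AE_I2)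
      fix x
      have "((\<lambda>t. (F (x + t *\<^sub>R b) - F x) / t) \<longlongrightarrow> partial_deriv b F x) (at 0)"
        using along_line[of x 0] by (simp add: DERIV_def)
      moreover have "filterlim h (at 0) sequentially"
        unfolding filterlim_at h_def using LIMSEQ_Suc[OF lim_1_over_n] by auto
      ultimately show "(\<lambda>n. D n x) \<longlonglongrightarrow> partial_deriv b F x"
        unfolding D_def by (rule filterlim_compose)
    qed
    have "\<bar>D n x\<bar> \<le> C * indicat_real (cball 0 (R + 1)) x" for n x
    proof (cases "x \<in> cball 0 (R + 1)")
      case True
      have "\<exists>z>0. z < h n \<and> F (x + h n *\<^sub>R b) - F (x + 0 *\<^sub>R b) = (h n - 0) * partial_deriv b F (x + z *\<^sub>R b)"
        by (rule MVT2[OF h(1)]) (rule along_line)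
      then obtain z where "D n x = partial_deriv b F (x + z *\<^sub>R b)"
        using h(1)[of n] by (auto simp: D_def)
      then show ?thesis using C' True by simp
    next
      case False
      have "norm x \<le> norm (x + h n *\<^sub>R b) + norm (h n *\<^sub>R b)"
        using norm_triangle_ineq4[of "x + h n *\<^sub>R b" "h n *\<^sub>R b"] by simp
      then have "x + h n *\<^sub>R b \<notin> K" "x \<notin> K"
        using False R h[of n] nb by (auto simp: subset_iff)
      then show ?thesis using False K(3) by (simp add: D_def)
    qed
    then show "AE x in lborel. norm (D n x) \<le> C * indicat_real (cball 0 (R + 1)) x" for n
      by simp
  qed
  then have "integral\<^sup>L lborel (partial_deriv b F) = 0"
    unfolding D0 by (simp add: LIMSEQ_const_iff)
  then show ?thesis
    using borel_measurable_continuous_onI[OF cP[of UNIV]] by (simp add: integral_completion)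
qed

text \<open>
  This bump is positive exactly on the open box, so that every open set is the union of the
  positivity sets of countably many bumps supported inside it.
\<close>

definition box_bump :: "'a::euclidean_space \<Rightarrow> 'a \<Rightarrow> 'a \<Rightarrow> real" where
  "box_bump a b x = (\<Prod>i\<in>Basis. flat_exp 1 (x \<bullet> i - a \<bullet> i) * flat_exp 1 (b \<bullet> i - x \<bullet> i))"

lemma flat_exp_1_le_1: "flat_exp 1 x \<le> 1"
  by (simp add: flat_exp_1)

lemma box_bump_nonneg: "0 \<le> box_bump a b x"
  unfolding box_bump_def by (intro prod_nonneg mult_nonneg_nonneg ballI flat_exp_1_nonneg)

lemma box_bump_le_1: "box_bump a b x \<le> 1"
  unfolding box_bump_def
  by (intro prod_le_1 conjI mult_nonneg_nonneg mult_le_one flat_exp_1_nonneg flat_exp_1_le_1)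

lemma box_bump_pos_iff: "0 < box_bump a b x \<longleftrightarrow> x \<in> box a b"
proof -
  have "box_bump a b x = 0 \<longleftrightarrow> x \<notin> box a b"
    by (auto simp: box_bump_def mem_box flat_exp_1 not_less)
  then show ?thesis using box_bump_nonneg[of a b x] by linarith
qed

lemma times_cont_diff_box_bump: "times_cont_diff k (box_bump a b)"
proof -
  have "times_cont_diff k (\<lambda>x::'a. flat_exp 1 (x \<bullet> i + (- (a \<bullet> i))))"
    "times_cont_diff k (\<lambda>x::'a. flat_exp 1 (- (x \<bullet> i) + b \<bullet> i))" for i
    by (rule times_cont_diff_compose_affine[OF _ times_cont_diff_flat_exp],
        simp add: bounded_linear_minus bounded_linear_inner_left)+
  then show ?thesis
    unfolding box_bump_def[abs_def]
    by (intro times_cont_diff_prod times_cont_diff_mult) simp_all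
qed

lemma open_Union_boxes:
  assumes "open (V :: 'a::euclidean_space set)"
  obtains a b where "\<And>n::nat. cbox (a n) (b n) \<subseteq> V" "V = (\<Union>n. box (a n) (b n))"
proof (cases "V = {}")
  case True
  have "box One (0::'a) = {}" "cbox One (0::'a) = {}"
    using SOME_Basis by (auto simp: box_eq_empty)
  with True show ?thesis by (intro that[of "\<lambda>n. One" "\<lambda>n. 0"]) auto
next
  case False
  define \<F> where "\<F> = {B. \<exists>a b. B = box a b \<and> cbox a b \<subseteq> V}"
  obtain \<F>' where F': "\<F>' \<subseteq> \<F>" "countable \<F>'" "\<Union>\<F>' = \<Union>\<F>"
    using Lindelof[of \<F>] unfolding \<F>_def by (auto simp: open_box)
  have UV: "\<Union>\<F> = V"
  proof
    show "\<Union>\<F> \<subseteq> V" unfolding \<F>_def using box_subset_cbox by blast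
    show "V \<subseteq> \<Union>\<F>"
    proof
      fix x assume "x \<in> V"
      with assms obtain a b where "cbox a b \<subseteq> V" "x \<in> box a b"
        by (rule open_contains_cbox)
      then show "x \<in> \<Union>\<F>" unfolding \<F>_def by blast
    qed
  qed
  have ne: "\<F>' \<noteq> {}" using False UV F'(3) by auto
  then have rng: "range (from_nat_into \<F>') = \<F>'"
    using F'(2) by (rule range_from_nat_into)
  have "\<forall>n. \<exists>a b. from_nat_into \<F>' n = box a b \<and> cbox a b \<subseteq> V"
  proof
    fix n
    have "from_nat_into \<F>' n \<in> \<F>" using rng F'(1) by blast
    then show "\<exists>a b. from_nat_into \<F>' n = box a b \<and> cbox a b \<subseteq> V" by (simp add: \<F>_def)
  qed
  then obtain a b where ab: "\<And>n. from_nat_into \<F>' n = box (a n) (b n)" "\<And>n. cbox (a n) (b n) \<subseteq> V"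
    by metis
  have "(\<Union>n. box (a n) (b n)) = \<Union> (range (from_nat_into \<F>'))" by (simp add: ab(1))
  then have "V = (\<Union>n. box (a n) (b n))" using rng UV F'(3) by simp
  with ab(2) show ?thesis by (rule that)
qed

text \<open>
  If $V$ is the union of the positivity sets of bumps $\beta_i\le 1$, then
  $1-\prod_{i<n}(1-\beta_i)^n$ tends to the indicator of $V$: a factor with $\beta_i(x)>0$ makes the
  product tend to zero, and outside $V$ every factor is one.
\<close>

lemma test_functions_tendsto_indicator:
  assumes "open (V :: 'a::euclidean_space set)"
  obtains \<phi> where "\<And>n. \<phi> n \<in> test_functions V" "\<And>n x. 0 \<le> \<phi> n x \<and> \<phi> n x \<le> 1"
    "\<And>x. (\<lambda>n. \<phi> n x) \<longlonglongrightarrow> indicator V x"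
proof -
  obtain a b where ab: "\<And>n::nat. cbox (a n) (b n) \<subseteq> V" "V = (\<Union>n. box (a n) (b n))"
    using assms by (rule open_Union_boxes) blast
  define \<beta> where "\<beta> i = box_bump (a i) (b i)" for i
  define P where "P n x = (\<Prod>i<n. (1 - \<beta> i x) ^ n)" for n x
  have \<beta>: "0 \<le> 1 - \<beta> i x" "1 - \<beta> i x \<le> 1" for i x
    using box_bump_nonneg[of "a i" "b i" x] box_bump_le_1[of "a i" "b i" x] by (auto simp: \<beta>_def)
  have P01: "0 \<le> P n x" "P n x \<le> 1" for n x
    unfolding P_def using \<beta> by (auto intro!: prod_nonneg prod_le_1 power_le_one)
  show ?thesis
  proof (rule that[of "\<lambda>n x. 1 - P n x"])
    fix n
    show "(\<lambda>x. 1 - P n x) \<in> test_functions V"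
    proof (rule test_functionsI)
      show "times_cont_diff k (\<lambda>x. 1 - P n x)" for k
        unfolding P_def \<beta>_def
        by (intro times_cont_diff_diff times_cont_diff_const times_cont_diff_prod
            times_cont_diff_power times_cont_diff_box_bump finite_lessThan)
      show "compact (\<Union>i<n. cbox (a i) (b i))" by (intro compact_UN) auto
      show "(\<Union>i<n. cbox (a i) (b i)) \<subseteq> V" using ab(1) by blast
      fix x assume x: "x \<notin> (\<Union>i<n. cbox (a i) (b i))"
      have "\<beta> i x = 0" if "i < n" for i
      proof -
        have "x \<notin> box (a i) (b i)" using x that box_subset_cbox by blast
        then show ?thesis
          using box_bump_pos_iff[of "a i" "b i" x] box_bump_nonneg[of "a i" "b i" x]
          unfolding \<beta>_def by linarith
      qed
      then show "1 - P n x = 0" by (simp add: P_def)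
    qed
  next
    show "0 \<le> 1 - P n x \<and> 1 - P n x \<le> 1" for n x using P01[of n x] by simp
  next
    fix x
    show "(\<lambda>n. 1 - P n x) \<longlonglongrightarrow> indicator V x"
    proof (cases "x \<in> V")
      case True
      then obtain i where i: "x \<in> box (a i) (b i)" using ab(2) by blast
      then have "1 - \<beta> i x < 1" by (simp add: \<beta>_def box_bump_pos_iff)
      have le: "P n x \<le> (1 - \<beta> i x) ^ n" if "i < n" for n
      proof -
        have "P n x = (1 - \<beta> i x) ^ n * (\<Prod>j\<in>{..<n} - {i}. (1 - \<beta> j x) ^ n)"
          unfolding P_def using that by (intro prod.remove) auto
        also have "\<dots> \<le> (1 - \<beta> i x) ^ n * 1"
          using \<beta> by (intro mult_left_mono prod_le_1) (auto intro: power_le_one)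
        finally show ?thesis by simp
      qed
      have "(\<lambda>n. P n x) \<longlonglongrightarrow> 0"
      proof (rule tendsto_sandwich)
        show "\<forall>\<^sub>F n in sequentially. 0 \<le> P n x" using P01 by simp
        show "\<forall>\<^sub>F n in sequentially. P n x \<le> (1 - \<beta> i x) ^ n"
          using eventually_gt_at_top[of i] by eventually_elim (rule le)
        show "(\<lambda>n. (1 - \<beta> i x) ^ n) \<longlonglongrightarrow> 0"
          using \<beta>[of i x] \<open>1 - \<beta> i x < 1\<close> by (intro LIMSEQ_realpow_zero)
      qed simp
      then have "(\<lambda>n. 1 - P n x) \<longlonglongrightarrow> 1 - 0" by (intro tendsto_intros)
      then show ?thesis using True by simp
    next
      case False
      have "\<beta> i x = 0" for i
      proof -
        have "x \<notin> box (a i) (b i)" using False ab(2) by blast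
        then show ?thesis
          using box_bump_pos_iff[of "a i" "b i" x] box_bump_nonneg[of "a i" "b i" x]
          unfolding \<beta>_def by linarith
      qed
      then show ?thesis using False by (simp add: P_def)
    qed
  qed
qed

lemma integrable_square_integrable_on:
  assumes "square_integrable f" "S \<in> lmeasurable"
  shows "integrable lebesgue (\<lambda>x. f x * indicat_real S x)"
  by (intro square_integrable_mult assms square_integrable_indicator)

lemma test_functions_mono: "V \<subseteq> \<Omega> \<Longrightarrow> test_functions V \<subseteq> test_functions \<Omega>"
  by (auto simp: test_functions_def)

text \<open>
  Approximating indicators by test functions, $f$ has integral zero over bounded open subsets of
  \<open>\<Omega>\<close>, hence over compact ones, which are differences of two such sets.  A compact
  set on which $f>0$ is therefore null, and inner regularity exhausts the positivity set
  by compact sets up to a null set.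
\<close>

lemma negligible_pos_if_orthogonal:
  fixes f :: "'a::euclidean_space \<Rightarrow> real"
  assumes \<Omega>: "open \<Omega>" and f: "square_integrable f"
    and orth: "\<And>\<phi>. \<phi> \<in> test_functions \<Omega> \<Longrightarrow> integral\<^sup>L lebesgue (\<lambda>x. f x * \<phi> x) = 0"
  shows "negligible {x\<in>\<Omega>. f x > 0}"
proof -
  have fm: "f \<in> borel_measurable lebesgue" using f by (simp add: square_integrable_def)
  have zero_open: "integral\<^sup>L lebesgue (\<lambda>x. f x * indicat_real V x) = 0"
    if V: "open V" "bounded V" "V \<subseteq> \<Omega>" for V
  proof -
    obtain \<phi> where \<phi>: "\<And>n. \<phi> n \<in> test_functions V" "\<And>n x. 0 \<le> \<phi> n x \<and> \<phi> n x \<le> 1"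
      "\<And>x. (\<lambda>n. \<phi> n x) \<longlonglongrightarrow> indicator V x"
      using test_functions_tendsto_indicator[OF V(1)] by metis
    have Vl: "V \<in> lmeasurable" using V by (intro lmeasurable_open)
    have off: "\<phi> n x = 0" if "x \<notin> V" for n x
      using \<phi>(1)[of n] that closure_subset[of "{x. \<phi> n x \<noteq> 0}"]
      by (auto simp: test_functions_def)
    have "(\<lambda>n. integral\<^sup>L lebesgue (\<lambda>x. f x * \<phi> n x)) \<longlonglongrightarrow> integral\<^sup>L lebesgue (\<lambda>x. f x * indicat_real V x)"
    proof (rule integral_dominated_convergence)
      show "integrable lebesgue (\<lambda>x. norm (f x * indicat_real V x))"
        using integrable_square_integrable_on[OF f Vl] by (rule integrable_norm)
      show "(\<lambda>x. f x * indicat_real V x) \<in> borel_measurable lebesgue"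
        using integrable_square_integrable_on[OF f Vl] by (rule borel_measurable_integrable)
      show "(\<lambda>x. f x * \<phi> n x) \<in> borel_measurable lebesgue" for n
        using square_integrable_test_function[OF \<phi>(1)[of n]] fm
        by (intro borel_measurable_times) (simp_all add: square_integrable_def)
      show "AE x in lebesgue. (\<lambda>n. f x * \<phi> n x) \<longlonglongrightarrow> f x * indicat_real V x"
        by (intro AE_I2 tendsto_mult tendsto_const \<phi>(3))
      have "\<bar>f x * \<phi> n x\<bar> \<le> \<bar>f x * indicat_real V x\<bar>" for n x
        using \<phi>(2)[of n x] off[of x n]
        by (cases "x \<in> V") (auto simp: abs_mult intro!: mult_left_le)
      then show "AE x in lebesgue. norm (f x * \<phi> n x) \<le> norm (f x * indicat_real V x)" for n
        by simp
    qed
    moreover have "integral\<^sup>L lebesgue (\<lambda>x. f x * \<phi> n x) = 0" for n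
      using \<phi>(1) test_functions_mono[OF V(3)] by (intro orth) blast
    ultimately show ?thesis by (simp add: LIMSEQ_const_iff)
  qed
  have null_compact: "K \<in> null_sets lebesgue" if K: "compact K" "K \<subseteq> {x\<in>\<Omega>. f x > 0}" for K
  proof -
    obtain R where R: "K \<subseteq> ball 0 R"
      using compact_imp_bounded[OF K(1)] by (metis bounded_subset_ballD)
    define V where "V = \<Omega> \<inter> ball 0 R"
    have V: "open V" "bounded V" "V \<subseteq> \<Omega>" "K \<subseteq> V"
      using \<Omega> R K(2) by (auto simp: V_def)
    have VK: "open (V - K)" "bounded (V - K)" "V - K \<subseteq> \<Omega>"
      using V K(1) by (auto intro: open_Diff compact_imp_closed bounded_subset)
    have Kl: "K \<in> lmeasurable" using K(1) by (rule lmeasurable_compact)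
    have ind: "f x * indicat_real K x = f x * indicat_real V x - f x * indicat_real (V - K) x" for x
      using V(4) by (auto simp: indicator_def)
    have "integral\<^sup>L lebesgue (\<lambda>x. f x * indicat_real K x) = 0"
      unfolding ind
      using integrable_square_integrable_on[OF f lmeasurable_open[OF V(2,1)]]
        integrable_square_integrable_on[OF f lmeasurable_open[OF VK(2,1)]]
        zero_open[OF V(1-3)] zero_open[OF VK]
      by simp
    moreover have nonneg: "0 \<le> f x * indicat_real K x" for x
      using K(2) by (auto simp: indicator_def)
    ultimately have "AE x in lebesgue. f x * indicat_real K x = 0"
      using integral_nonneg_eq_0_iff_AE[OF integrable_square_integrable_on[OF f Kl]] by simp
    then have "AE x in lebesgue. x \<notin> K"
      by eventually_elim (use K(2) in \<open>auto simp: indicator_def\<close>)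
    then show ?thesis
      using Kl by (subst (asm) AE_iff_null_sets[symmetric]) (auto simp: fmeasurableD)
  qed
  have "{x\<in>\<Omega>. f x > 0} = \<Omega> \<inter> (f -` {0<..} \<inter> space lebesgue)" by auto
  moreover have "\<Omega> \<in> sets lebesgue"
    using \<Omega> by (simp add: borel_open)
  ultimately have "{x\<in>\<Omega>. f x > 0} \<in> sets lebesgue"
    using measurable_sets[OF fm, of "{0<..}"] by simp
  then obtain C N where CN: "fsigma C" "N \<in> null_sets lebesgue" "C \<union> N = {x\<in>\<Omega>. f x > 0}"
    by (rule lebesgue_set_almost_fsigma)
  obtain F :: "nat \<Rightarrow> 'a set" where F: "range F \<subseteq> Collect compact" "C = \<Union>(range F)"
    using CN(1) unfolding fsigma_Union_compact by blast
  have "F n \<in> null_sets lebesgue" for n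
    using F CN(3) by (intro null_compact) blast+
  then have "C \<in> null_sets lebesgue" unfolding F(2) by (intro null_sets_UN)
  then show ?thesis
    using CN(2,3) by (metis negligible_iff_null_sets null_sets.Un)
qed

lemma L2_on_eq_0_if_orthogonal:
  assumes \<Omega>: "open \<Omega>" and g: "g \<in> L2_on \<Omega>"
    and orth: "\<And>\<phi>. \<phi> \<in> test_functions \<Omega> \<Longrightarrow> g \<bullet> abs_L2 \<phi> = 0"
  shows "g = 0"
proof -
  let ?f = "rep_L2 g"
  have f: "square_integrable ?f" "square_integrable (\<lambda>x. - ?f x)"
    by (intro square_integrable_uminus square_integrable_rep_L2)+
  have "g \<bullet> abs_L2 \<phi> = integral\<^sup>L lebesgue (\<lambda>x. ?f x * \<phi> x)" if "\<phi> \<in> test_functions \<Omega>" for \<phi>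
    using inner_L2.abs_eq[OF L2_rel_rep, of \<phi> g] square_integrable_test_function[OF that]
    by (simp add: L2_rel_def abs_rep_L2)
  then have I: "integral\<^sup>L lebesgue (\<lambda>x. ?f x * \<phi> x) = 0" if "\<phi> \<in> test_functions \<Omega>" for \<phi>
    using orth that by simp
  have "negligible ({x\<in>\<Omega>. ?f x > 0} \<union> {x\<in>\<Omega>. - ?f x > 0})"
    using negligible_pos_if_orthogonal[OF \<Omega> f(1) I] negligible_pos_if_orthogonal[OF \<Omega> f(2)] I
    by (intro negligible_Un) simp_all
  moreover have "{x\<in>\<Omega>. ?f x > 0} \<union> {x\<in>\<Omega>. - ?f x > 0} = {x\<in>\<Omega>. ?f x \<noteq> 0}" by auto
  ultimately have "AE x in lebesgue. x \<notin> {x\<in>\<Omega>. ?f x \<noteq> 0}"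
    unfolding negligible_iff_null_sets by (metis AE_not_in)
  moreover have "AE x in lebesgue. x \<notin> \<Omega> \<longrightarrow> ?f x = 0" using g by (simp add: L2_on_def)
  ultimately have "AE x in lebesgue. ?f x = 0" by eventually_elim auto
  then have "abs_L2 ?f = abs_L2 (\<lambda>x. 0)"
    using f(1) square_integrable_zero by (subst abs_L2_eq_iff) auto
  then show ?thesis by (simp add: abs_rep_L2 zero_L2_def)
qed

section \<open>Weak derivatives\<close>

lemma L2_on_diff:
  assumes "v \<in> L2_on \<Omega>" "w \<in> L2_on \<Omega>"
  shows "v - w \<in> L2_on \<Omega>"
proof -
  have "AE x in lebesgue. x \<notin> \<Omega> \<longrightarrow> rep_L2 v x = 0" "AE x in lebesgue. x \<notin> \<Omega> \<longrightarrow> rep_L2 w x = 0"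
    using assms by (simp_all add: L2_on_def)
  with rep_L2_diff[of v w] have "AE x in lebesgue. x \<notin> \<Omega> \<longrightarrow> rep_L2 (v - w) x = 0"
    by eventually_elim simp
  then show ?thesis by (simp add: L2_on_def)
qed

lemma abs_L2_test_function_in_L2_on:
  assumes "\<phi> \<in> test_functions \<Omega>"
  shows "abs_L2 \<phi> \<in> L2_on \<Omega>"
proof -
  obtain K where K: "K \<subseteq> \<Omega>" "\<And>x. x \<notin> K \<Longrightarrow> \<phi> x = 0"
    using assms by (rule test_functionsE) blast
  have "AE x in lebesgue. x \<notin> \<Omega> \<longrightarrow> rep_L2 (abs_L2 \<phi>) x = 0"
    using rep_abs_L2[OF square_integrable_test_function[OF assms]]
    by eventually_elim (use K in auto)
  then show ?thesis by (simp add: L2_on_def)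
qed

text \<open>
  The constant \<open>weak_partial\<close> is a definite description, so every computation with it
  rests on this uniqueness.
\<close>

lemma has_weak_partial_unique:
  assumes "open \<Omega>" "has_weak_partial \<Omega> b v g" "has_weak_partial \<Omega> b v g'"
  shows "g = g'"
proof -
  have "g - g' = 0"
    using assms(2,3)
    by (intro L2_on_eq_0_if_orthogonal[OF assms(1)])
      (auto simp: has_weak_partial_def inner_diff_left intro: L2_on_diff)
  then show ?thesis by simp
qed

lemma weak_partial_eq:
  "open \<Omega> \<Longrightarrow> has_weak_partial \<Omega> b v g \<Longrightarrow> weak_partial \<Omega> b v = g"
  unfolding weak_partial_def by (blast intro: has_weak_partial_unique)

lemma has_weak_partial_weak_partial:
  assumes "open \<Omega>" "v \<in> H1 \<Omega>" "b \<in> Basis"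
  shows "has_weak_partial \<Omega> b v (weak_partial \<Omega> b v)"
proof -
  obtain g where "has_weak_partial \<Omega> b v g" using assms by (auto simp: H1_def)
  then show ?thesis using weak_partial_eq[OF assms(1)] by simp
qed

lemma has_weak_partial_diff:
  assumes "has_weak_partial \<Omega> b v g" "has_weak_partial \<Omega> b w h"
  shows "has_weak_partial \<Omega> b (v - w) (g - h)"
  using assms by (auto simp: has_weak_partial_def inner_diff_left intro: L2_on_diff)

lemma H1_diff:
  assumes "v \<in> H1 \<Omega>" "w \<in> H1 \<Omega>"
  shows "v - w \<in> H1 \<Omega>"
  using assms unfolding H1_def by (blast intro: L2_on_diff has_weak_partial_diff)

lemma weak_partial_diff:
  assumes "open \<Omega>" "v \<in> H1 \<Omega>" "w \<in> H1 \<Omega>" "b \<in> Basis"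
  shows "weak_partial \<Omega> b (v - w) = weak_partial \<Omega> b v - weak_partial \<Omega> b w"
  by (intro weak_partial_eq has_weak_partial_diff has_weak_partial_weak_partial assms)

lemma inner_abs_L2:
  assumes "square_integrable f" "square_integrable g"
  shows "abs_L2 f \<bullet> abs_L2 g = integral\<^sup>L lebesgue (\<lambda>x. f x * g x)"
  using assms by (intro inner_L2.abs_eq) (auto simp: L2_rel_def)

text \<open>
  Integration by parts: the derivative of the product \<open>\<phi> \<psi>\<close> has integral zero.
\<close>

lemma has_weak_partial_test_function:
  assumes \<phi>: "\<phi> \<in> test_functions \<Omega>" and b: "b \<in> Basis"
  shows "has_weak_partial \<Omega> b (abs_L2 \<phi>) (abs_L2 (partial_deriv b \<phi>))"
  unfolding has_weak_partial_def
proof (intro conjI ballI)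
  have P\<phi>: "partial_deriv b \<phi> \<in> test_functions \<Omega>"
    using \<phi> b by (rule test_functions_partial_deriv)
  then show "abs_L2 (partial_deriv b \<phi>) \<in> L2_on \<Omega>" by (rule abs_L2_test_function_in_L2_on)
  fix \<psi> assume \<psi>: "\<psi> \<in> test_functions \<Omega>"
  have P\<psi>: "partial_deriv b \<psi> \<in> test_functions \<Omega>"
    using \<psi> b by (rule test_functions_partial_deriv)
  obtain K where K: "\<And>k. times_cont_diff k \<phi>" "compact K" "K \<subseteq> \<Omega>" "\<And>x. x \<notin> K \<Longrightarrow> \<phi> x = 0"
    using \<phi> by (rule test_functionsE) blast
  obtain J where J: "\<And>k. times_cont_diff k \<psi>"
    using \<psi> by (rule test_functionsE) blast
  have "(\<lambda>x. \<phi> x * \<psi> x) \<in> test_functions \<Omega>"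
    using K J by (intro test_functionsI[of _ K] times_cont_diff_mult) auto
  then have "integral\<^sup>L lebesgue (partial_deriv b (\<lambda>x. \<phi> x * \<psi> x)) = 0"
    using b by (rule integral_partial_deriv_eq_0)
  moreover have "partial_deriv b (\<lambda>x. \<phi> x * \<psi> x)
      = (\<lambda>x. \<phi> x * partial_deriv b \<psi> x + partial_deriv b \<phi> x * \<psi> x)"
  proof
    fix x
    show "partial_deriv b (\<lambda>x. \<phi> x * \<psi> x) x = \<phi> x * partial_deriv b \<psi> x + partial_deriv b \<phi> x * \<psi> x"
      using partial_deriv_eq[OF has_derivative_mult[OF
          times_cont_diff_SucD(1)[OF K(1)[of "Suc 0"]] times_cont_diff_SucD(1)[OF J[of "Suc 0"]]], of b x]
      by (simp add: partial_deriv_def)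
  qed
  ultimately show "abs_L2 \<phi> \<bullet> abs_L2 (partial_deriv b \<psi>) = - (abs_L2 (partial_deriv b \<phi>) \<bullet> abs_L2 \<psi>)"
    using \<phi> \<psi> P\<phi> P\<psi>
    by (simp add: inner_abs_L2 square_integrable_test_function square_integrable_mult)
qed

lemma norm_le_H1_norm: "norm v \<le> H1_norm \<Omega> v"
  unfolding H1_norm_def by (intro real_le_rsqrt) (simp add: sum_nonneg)

lemma norm_weak_partial_le_H1_norm:
  assumes "b \<in> Basis"
  shows "norm (weak_partial \<Omega> b v) \<le> H1_norm \<Omega> v"
proof -
  have "(norm (weak_partial \<Omega> b v))\<^sup>2 \<le> (\<Sum>b\<in>Basis. (norm (weak_partial \<Omega> b v))\<^sup>2)"
    using assms by (intro member_le_sum) auto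
  then show ?thesis
    unfolding H1_norm_def by (intro real_le_rsqrt) (simp add: add_increasing)
qed

lemma H1_norm_le_sum: "H1_norm \<Omega> v \<le> norm v + (\<Sum>b\<in>Basis. norm (weak_partial \<Omega> b v))"
proof -
  have "sqrt ((norm v)\<^sup>2 + (\<Sum>b\<in>Basis. (norm (weak_partial \<Omega> b v))\<^sup>2))
      \<le> sqrt ((norm v)\<^sup>2) + sqrt (\<Sum>b\<in>Basis. (norm (weak_partial \<Omega> b v))\<^sup>2)"
    by (rule sqrt_add_le_add_sqrt) (simp_all add: sum_nonneg)
  also have "sqrt (\<Sum>b\<in>Basis. (norm (weak_partial \<Omega> b v))\<^sup>2) \<le> (\<Sum>b\<in>Basis. norm (weak_partial \<Omega> b v))"
    using L2_set_le_sum[of Basis "\<lambda>b. norm (weak_partial \<Omega> b v)"] by (simp add: L2_set_def)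
  finally show ?thesis by (simp add: H1_norm_def)
qed

lemma test_function_in_H1:
  assumes "\<phi> \<in> test_functions \<Omega>"
  shows "abs_L2 \<phi> \<in> H1 \<Omega>"
  using abs_L2_test_function_in_L2_on[OF assms] has_weak_partial_test_function[OF assms]
  by (auto simp: H1_def)

lemma test_function_in_H10:
  fixes \<phi> :: "'a::euclidean_space \<Rightarrow> real"
  assumes \<Omega>: "open \<Omega>" and \<phi>: "\<phi> \<in> test_functions \<Omega>"
  shows "abs_L2 \<phi> \<in> H10 \<Omega>"
proof -
  have "has_weak_partial \<Omega> b (0::'a L2) 0" if "b \<in> Basis" for b
    using has_weak_partial_diff[OF has_weak_partial_test_function[OF \<phi> that] has_weak_partial_test_function[OF \<phi> that]]
    by simp
  then have "weak_partial \<Omega> b (0::'a L2) = 0" if "b \<in> Basis" for b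
    using that by (intro weak_partial_eq[OF \<Omega>])
  then have "H1_norm \<Omega> (abs_L2 \<phi> - abs_L2 \<phi>) = 0"
    by (simp add: H1_norm_def)
  then show ?thesis
    using test_function_in_H1[OF \<phi>] \<phi> unfolding H10_def by force
qed

lemma H10_diff:
  fixes v w :: "'a::euclidean_space L2"
  assumes \<Omega>: "open \<Omega>" and v: "v \<in> H10 \<Omega>" and w: "w \<in> H10 \<Omega>"
  shows "v - w \<in> H10 \<Omega>"
proof -
  have vw: "v \<in> H1 \<Omega>" "w \<in> H1 \<Omega>" using v w by (auto simp: H10_def)
  have "\<exists>\<rho>\<in>test_functions \<Omega>. H1_norm \<Omega> (v - w - abs_L2 \<rho>) < e" if "e > 0" for e
  proof -
    let ?N = "H1_norm \<Omega>"
    define d where "d = e / (2 * (1 + real DIM('a)))"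
    have d: "d > 0" using that by (simp add: d_def)
    obtain \<phi> \<psi> where \<phi>: "\<phi> \<in> test_functions \<Omega>" "?N (v - abs_L2 \<phi>) < d"
      and \<psi>: "\<psi> \<in> test_functions \<Omega>" "?N (w - abs_L2 \<psi>) < d"
      using v w d unfolding H10_def by blast
    let ?p = "v - abs_L2 \<phi>" and ?q = "w - abs_L2 \<psi>"
    have pq: "?p \<in> H1 \<Omega>" "?q \<in> H1 \<Omega>"
      using vw \<phi>(1) \<psi>(1) by (auto intro: H1_diff test_function_in_H1)
    have "abs_L2 (\<lambda>x. \<phi> x - \<psi> x) = abs_L2 \<phi> - abs_L2 \<psi>"
      using \<phi>(1) \<psi>(1) by (simp add: abs_L2_diff square_integrable_test_function)
    then have eq: "v - w - abs_L2 (\<lambda>x. \<phi> x - \<psi> x) = ?p - ?q" by simp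
    have b: "norm (weak_partial \<Omega> b (?p - ?q)) \<le> ?N ?p + ?N ?q" if "b \<in> Basis" for b
      using norm_triangle_ineq4[of "weak_partial \<Omega> b ?p" "weak_partial \<Omega> b ?q"]
        norm_weak_partial_le_H1_norm[OF that, of \<Omega> ?p] norm_weak_partial_le_H1_norm[OF that, of \<Omega> ?q]
      unfolding weak_partial_diff[OF \<Omega> pq that] by linarith
    have "?N (?p - ?q) \<le> norm (?p - ?q) + (\<Sum>b\<in>Basis. norm (weak_partial \<Omega> b (?p - ?q)))"
      by (rule H1_norm_le_sum)
    also have "\<dots> \<le> (?N ?p + ?N ?q) + (\<Sum>b\<in>(Basis::'a set). ?N ?p + ?N ?q)"
    proof (intro add_mono sum_mono b)
      show "norm (?p - ?q) \<le> ?N ?p + ?N ?q"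
        using norm_triangle_ineq4[of ?p ?q] norm_le_H1_norm[of ?p \<Omega>] norm_le_H1_norm[of ?q \<Omega>] by linarith
    qed
    also have "\<dots> = (1 + real DIM('a)) * (?N ?p + ?N ?q)" by (simp add: algebra_simps)
    also have "\<dots> < (1 + real DIM('a)) * (2 * d)"
      using \<phi>(2) \<psi>(2) by (intro mult_strict_left_mono) auto
    also have "\<dots> = e"
    proof -
      have "1 + real DIM('a) > 0" by simp
      then show ?thesis unfolding d_def by (simp add: field_simps del: of_nat_add)
    qed
    finally show ?thesis
      using test_functions_diff[OF \<phi>(1) \<psi>(1)] by (intro bexI[of _ "\<lambda>x. \<phi> x - \<psi> x"]) (simp_all add: eq)
  qed
  then show ?thesis using H1_diff[OF vw] by (simp add: H10_def)
qed

section \<open>The elliptic form\<close>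

text \<open>
  Only subtractivity in each argument and boundedness by \<open>N\<close> are recorded: they suffice
  for subtracting two weak equations and for passing to the limit in the test function.
\<close>

definition bounded_form_on :: "'v::ab_group_add set \<Rightarrow> ('v \<Rightarrow> real) \<Rightarrow> ('v \<Rightarrow> 'v \<Rightarrow> real) \<Rightarrow> bool" where
  "bounded_form_on V N B \<longleftrightarrow>
     (\<forall>u\<in>V. \<forall>v\<in>V. \<forall>w\<in>V. B (u - v) w = B u w - B v w \<and> B w (u - v) = B w u - B w v) \<and>
     (\<exists>C\<ge>0. \<forall>v\<in>V. \<forall>w\<in>V. \<bar>B v w\<bar> \<le> C * N v * N w)"

lemma bounded_form_on_add:
  assumes B: "bounded_form_on V N B" and B': "bounded_form_on V N B'"
  shows "bounded_form_on V N (\<lambda>v w. B v w + B' v w)"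
proof -
  obtain C C' where C: "C \<ge> 0" "\<And>v w. v \<in> V \<Longrightarrow> w \<in> V \<Longrightarrow> \<bar>B v w\<bar> \<le> C * N v * N w"
    and C': "C' \<ge> 0" "\<And>v w. v \<in> V \<Longrightarrow> w \<in> V \<Longrightarrow> \<bar>B' v w\<bar> \<le> C' * N v * N w"
    using B B' unfolding bounded_form_on_def by metis
  have "\<bar>B v w + B' v w\<bar> \<le> (C + C') * N v * N w" if "v \<in> V" "w \<in> V" for v w
    using C(2)[OF that] C'(2)[OF that] by (simp add: algebra_simps)
  then have "\<exists>C\<ge>0. \<forall>v\<in>V. \<forall>w\<in>V. \<bar>B v w + B' v w\<bar> \<le> C * N v * N w"
    using C(1) C'(1) by (intro exI[of _ "C + C'"]) simp
  moreover have "\<forall>u\<in>V. \<forall>v\<in>V. \<forall>w\<in>V. B (u - v) w + B' (u - v) w = B u w + B' u w - (B v w + B' v w)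
      \<and> B w (u - v) + B' w (u - v) = B w u + B' w u - (B w v + B' w v)"
    using B B' by (simp add: bounded_form_on_def)
  ultimately show ?thesis unfolding bounded_form_on_def by blast
qed

lemma bounded_form_on_sum:
  assumes "finite I" "\<And>i. i \<in> I \<Longrightarrow> bounded_form_on V N (B i)"
  shows "bounded_form_on V N (\<lambda>v w. \<Sum>i\<in>I. B i v w)"
  using assms
proof (induction I)
  case empty
  then show ?case by (auto simp: bounded_form_on_def intro!: exI[of _ 0])
next
  case (insert i I)
  then show ?case by (simp add: bounded_form_on_add)
qed

lemma integrable_coefficient_product:
  assumes \<Omega>: "\<Omega> \<in> sets lebesgue" and m: "m \<in> Linfty \<Omega>"
  shows "integrable (lebesgue_on \<Omega>) (\<lambda>x. m x * rep_L2 p x * rep_L2 q x)"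
proof -
  obtain M where mm: "m \<in> borel_measurable (lebesgue_on \<Omega>)" and M: "AE x in lebesgue_on \<Omega>. norm (m x) \<le> M"
    using m by (auto simp: Linfty_def)
  have pm: "rep_L2 p \<in> borel_measurable (lebesgue_on \<Omega>)" for p :: "'a L2"
    using square_integrable_rep_L2[of p] by (intro measurable_restrict_space1) (simp add: square_integrable_def)
  have pq: "integrable (lebesgue_on \<Omega>) (\<lambda>x. M * (rep_L2 p x * rep_L2 q x))"
    using integrable_mult_indicator[OF \<Omega> square_integrable_mult[OF square_integrable_rep_L2 square_integrable_rep_L2], of p q] \<Omega>
    by (intro integrable_mult_right) (simp add: integrable_restrict_space)
  show ?thesis
  proof (rule Bochner_Integration.integrable_bound[OF pq])
    show "(\<lambda>x. m x * rep_L2 p x * rep_L2 q x) \<in> borel_measurable (lebesgue_on \<Omega>)"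
      by (intro borel_measurable_times mm pm)
    show "AE x in lebesgue_on \<Omega>. norm (m x * rep_L2 p x * rep_L2 q x) \<le> norm (M * (rep_L2 p x * rep_L2 q x))"
      using M by eventually_elim (auto simp: abs_mult mult.assoc intro!: mult_right_mono)
  qed
qed

text \<open>
  The elliptic form is a finite sum of these elementary forms, with $p$ and $q$ running through the
  functions and their weak partial derivatives.
\<close>

definition coefficient_form :: "'a::euclidean_space set \<Rightarrow> ('a \<Rightarrow> real) \<Rightarrow> 'a L2 \<Rightarrow> 'a L2 \<Rightarrow> real" where
  "coefficient_form \<Omega> m p q = (LINT x|lebesgue_on \<Omega>. m x * rep_L2 p x * rep_L2 q x)"

lemma coefficient_form_commute: "coefficient_form \<Omega> m p q = coefficient_form \<Omega> m q p"
  by (simp add: coefficient_form_def mult_ac)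

lemma coefficient_form_diff_left:
  assumes \<Omega>: "\<Omega> \<in> sets lebesgue" and m: "m \<in> Linfty \<Omega>"
  shows "coefficient_form \<Omega> m (p - p') q = coefficient_form \<Omega> m p q - coefficient_form \<Omega> m p' q"
proof -
  note int = integrable_coefficient_product[OF assms]
  have "AE x in lebesgue_on \<Omega>. rep_L2 (p - p') x = rep_L2 p x - rep_L2 p' x"
    using rep_L2_diff[of p p'] \<Omega> by (subst AE_restrict_space_iff) auto
  then have "AE x in lebesgue_on \<Omega>. m x * rep_L2 (p - p') x * rep_L2 q x
      = m x * rep_L2 p x * rep_L2 q x - m x * rep_L2 p' x * rep_L2 q x"
    by eventually_elim (simp only: left_diff_distrib right_diff_distrib)
  then have "coefficient_form \<Omega> m (p - p') q
      = (LINT x|lebesgue_on \<Omega>. m x * rep_L2 p x * rep_L2 q x - m x * rep_L2 p' x * rep_L2 q x)"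
    unfolding coefficient_form_def using int
    by (intro integral_cong_AE borel_measurable_integrable Bochner_Integration.integrable_diff)
  then show ?thesis using int by (simp add: coefficient_form_def)
qed

lemma coefficient_form_bound:
  fixes m :: "'a::euclidean_space \<Rightarrow> real"
  assumes \<Omega>: "\<Omega> \<in> sets lebesgue" and m: "m \<in> Linfty \<Omega>"
  obtains M where "M \<ge> 0" "\<And>p q. \<bar>coefficient_form \<Omega> m p q\<bar> \<le> M * norm p * norm q"
proof -
  obtain M' where M': "AE x in lebesgue_on \<Omega>. norm (m x) \<le> M'"
    using m by (auto simp: Linfty_def)
  define M where "M = max M' 0"
  have M: "AE x in lebesgue_on \<Omega>. \<bar>m x\<bar> \<le> M" "M \<ge> 0"
    using M' by (auto simp: M_def elim: eventually_mono)
  have "\<bar>coefficient_form \<Omega> m p q\<bar> \<le> M * norm p * norm q" for p q :: "'a L2"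
  proof -
    have sq: "square_integrable (\<lambda>x. \<bar>rep_L2 p x\<bar>)" and norm_abs: "norm (abs_L2 (\<lambda>x. \<bar>rep_L2 p x\<bar>)) = norm p" for p :: "'a L2"
    proof -
      show sq: "square_integrable (\<lambda>x. \<bar>rep_L2 p x\<bar>)"
        using square_integrable_rep_L2[of p] by (auto simp: square_integrable_def)
      have "(norm (abs_L2 (\<lambda>x. \<bar>rep_L2 p x\<bar>)))\<^sup>2 = (norm p)\<^sup>2"
        by (subst norm_L2_abs[OF sq]) (simp add: norm_L2_rep)
      then show "norm (abs_L2 (\<lambda>x. \<bar>rep_L2 p x\<bar>)) = norm p" by simp
    qed
    let ?pq = "\<lambda>x. \<bar>rep_L2 p x\<bar> * \<bar>rep_L2 q x\<bar>"
    have int: "integrable lebesgue ?pq" by (rule square_integrable_mult[OF sq sq])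
    have int\<Omega>: "integrable (lebesgue_on \<Omega>) ?pq"
      using integrable_mult_indicator[OF \<Omega> int] \<Omega> by (simp add: integrable_restrict_space)
    have "\<bar>coefficient_form \<Omega> m p q\<bar> \<le> (LINT x|lebesgue_on \<Omega>. \<bar>m x * rep_L2 p x * rep_L2 q x\<bar>)"
      unfolding coefficient_form_def by (rule integral_abs_bound)
    also have "\<dots> \<le> (LINT x|lebesgue_on \<Omega>. M * ?pq x)"
    proof (rule integral_mono_AE)
      show "integrable (lebesgue_on \<Omega>) (\<lambda>x. \<bar>m x * rep_L2 p x * rep_L2 q x\<bar>)"
        using integrable_coefficient_product[OF \<Omega> m] by (rule integrable_abs)
      show "integrable (lebesgue_on \<Omega>) (\<lambda>x. M * ?pq x)" using int\<Omega> by (rule integrable_mult_right)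
      show "AE x in lebesgue_on \<Omega>. \<bar>m x * rep_L2 p x * rep_L2 q x\<bar> \<le> M * ?pq x"
        using M(1) by eventually_elim (auto simp: abs_mult mult.assoc intro!: mult_right_mono)
    qed
    also have "\<dots> = M * (LINT x|lebesgue_on \<Omega>. ?pq x)" by simp
    also have "(LINT x|lebesgue_on \<Omega>. ?pq x) = (LINT x|lebesgue. indicator \<Omega> x *\<^sub>R ?pq x)"
      using \<Omega> by (simp add: integral_restrict_space)
    also have "\<dots> \<le> (LINT x|lebesgue. ?pq x)"
      using integrable_mult_indicator[OF \<Omega> int] int
      by (intro integral_mono) (auto simp: indicator_def)
    also have "\<dots> = abs_L2 (\<lambda>x. \<bar>rep_L2 p x\<bar>) \<bullet> abs_L2 (\<lambda>x. \<bar>rep_L2 q x\<bar>)"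
      by (simp add: inner_abs_L2 sq)
    also have "\<dots> \<le> norm p * norm q"
      using norm_cauchy_schwarz[of "abs_L2 (\<lambda>x. \<bar>rep_L2 p x\<bar>)" "abs_L2 (\<lambda>x. \<bar>rep_L2 q x\<bar>)"]
      by (simp add: norm_abs)
    finally show ?thesis using M(2) by (simp add: mult_left_mono mult.assoc)
  qed
  with M(2) show ?thesis by (rule that)
qed

lemma bounded_form_on_coefficient_form:
  fixes D D' :: "'a::euclidean_space L2 \<Rightarrow> 'a L2"
  assumes \<Omega>: "\<Omega> \<in> sets lebesgue" and m: "m \<in> Linfty \<Omega>"
    and D: "\<And>v w. v \<in> V \<Longrightarrow> w \<in> V \<Longrightarrow> D (v - w) = D v - D w" "\<And>v. norm (D v) \<le> N v"
    and D': "\<And>v w. v \<in> V \<Longrightarrow> w \<in> V \<Longrightarrow> D' (v - w) = D' v - D' w" "\<And>v. norm (D' v) \<le> N v"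
  shows "bounded_form_on V N (\<lambda>v w. coefficient_form \<Omega> m (D v) (D' w))"
proof -
  obtain M where M: "M \<ge> 0" "\<And>p q. \<bar>coefficient_form \<Omega> m p q\<bar> \<le> M * norm p * norm q"
    using coefficient_form_bound[OF \<Omega> m] by blast
  have N: "0 \<le> N v" for v using D(2)[of v] norm_ge_zero order_trans by blast
  have "\<bar>coefficient_form \<Omega> m (D v) (D' w)\<bar> \<le> M * N v * N w" for v w
    by (rule order_trans[OF M(2)]) (intro mult_mono D(2) D'(2) M(1) mult_nonneg_nonneg N norm_ge_zero order_refl)
  moreover note coefficient_form_diff_left[OF \<Omega> m]
  moreover have "coefficient_form \<Omega> m q (p - p') = coefficient_form \<Omega> m q p - coefficient_form \<Omega> m q p'" for p p' q
    using coefficient_form_diff_left[OF \<Omega> m, of p p' q] by (simp add: coefficient_form_commute)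
  ultimately show ?thesis
    unfolding bounded_form_on_def using M(1) D(1) D'(1) by auto
qed

lemma Linfty_bounded_linear:
  fixes g :: "'a::euclidean_space \<Rightarrow> 'b::{banach, second_countable_topology}"
    and h :: "'b \<Rightarrow> 'c::{banach, second_countable_topology}"
  assumes h: "bounded_linear h" and g: "g \<in> Linfty S"
  shows "(\<lambda>x. h (g x)) \<in> Linfty S"
proof -
  obtain M where gm: "g \<in> borel_measurable (lebesgue_on S)" and M: "AE x in lebesgue_on S. norm (g x) \<le> M"
    using g by (auto simp: Linfty_def)
  obtain K where K: "K \<ge> 0" "\<And>y. norm (h y) \<le> norm y * K"
    using bounded_linear.nonneg_bounded[OF h] by blast
  have "h \<in> borel_measurable borel"
    by (intro borel_measurable_continuous_onI linear_continuous_on h)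
  then have "(\<lambda>x. h (g x)) \<in> borel_measurable (lebesgue_on S)"
    by (rule measurable_compose[OF gm])
  moreover have "AE x in lebesgue_on S. norm (h (g x)) \<le> M * K"
    using M by eventually_elim (meson K mult_right_mono order_trans)
  ultimately show ?thesis by (auto simp: Linfty_def)
qed

lemma elliptic_operator_bounded_form:
  fixes L :: "(real^'n) L2 \<Rightarrow> (real^'n) L2 \<Rightarrow> real"
  assumes open_\<Omega>: "open \<Omega>" and L: "elliptic_operator \<Omega> L"
  shows "bounded_form_on (H10 \<Omega>) (H1_norm \<Omega>) L"
proof -
  have \<Omega>: "\<Omega> \<in> sets lebesgue" using open_\<Omega> by (simp add: borel_open)
  obtain A :: "real^'n \<Rightarrow> real^'n^'n" and a b :: "real^'n \<Rightarrow> real^'n" and c :: "real^'n \<Rightarrow> real"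
    where coeff: "A \<in> Linfty \<Omega>" "a \<in> Linfty \<Omega>" "b \<in> Linfty \<Omega>" "c \<in> Linfty \<Omega>"
    and L_eq: "\<And>v w. v \<in> H10 \<Omega> \<Longrightarrow> w \<in> H10 \<Omega> \<Longrightarrow> L v w =
           (LINT x|lebesgue_on \<Omega>.
              (A x *v weak_grad \<Omega> v x + rep_L2 v x *\<^sub>R a x) \<bullet> weak_grad \<Omega> w x
              + (b x \<bullet> weak_grad \<Omega> v x + c x * rep_L2 v x) * rep_L2 w x)"
    using L unfolding elliptic_operator_def by blast
  have ab: "(\<lambda>x. a x $ i) \<in> Linfty \<Omega>" "(\<lambda>x. b x $ i) \<in> Linfty \<Omega>" for i
    by (intro Linfty_bounded_linear[OF bounded_linear_vec_nth] coeff)+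
  have A: "(\<lambda>x. A x $ i $ j) \<in> Linfty \<Omega>" for i j
    by (intro Linfty_bounded_linear[OF bounded_linear_vec_nth]
        Linfty_bounded_linear[OF bounded_linear_vec_nth, of A] coeff)
  define G where "G i = weak_partial \<Omega> (axis i 1)" for i :: 'n
  let ?F = "coefficient_form \<Omega>"
  define B where "B v w = (\<Sum>i\<in>UNIV. \<Sum>j\<in>UNIV. ?F (\<lambda>x. A x $ i $ j) (G j v) (G i w))
      + (\<Sum>i\<in>UNIV. ?F (\<lambda>x. a x $ i) v (G i w)) + (\<Sum>i\<in>UNIV. ?F (\<lambda>x. b x $ i) (G i v) w)
      + ?F c v w" for v w
  have LB: "L v w = B v w" if "v \<in> H10 \<Omega>" "w \<in> H10 \<Omega>" for v w
  proof -
    note int = integrable_coefficient_product[OF \<Omega>]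
    have integrand: "(A x *v weak_grad \<Omega> v x + rep_L2 v x *\<^sub>R a x) \<bullet> weak_grad \<Omega> w x
          + (b x \<bullet> weak_grad \<Omega> v x + c x * rep_L2 v x) * rep_L2 w x
        = (\<Sum>i\<in>UNIV. \<Sum>j\<in>UNIV. A x $ i $ j * rep_L2 (G j v) x * rep_L2 (G i w) x)
          + (\<Sum>i\<in>UNIV. a x $ i * rep_L2 v x * rep_L2 (G i w) x)
          + (\<Sum>i\<in>UNIV. b x $ i * rep_L2 (G i v) x * rep_L2 w x)
          + c x * rep_L2 v x * rep_L2 w x" for x
      by (simp add: inner_vec_def matrix_vector_mult_def weak_grad_def G_def sum_distrib_right
          distrib_right sum.distrib mult.commute[of "rep_L2 v x"])
    show ?thesis
      unfolding L_eq[OF that] integrand B_def coefficient_form_def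
      using int[OF A] int[OF ab(1)] int[OF ab(2)] int[OF coeff(4)]
      by simp
  qed
  have G: "G i (v - w) = G i v - G i w" if "v \<in> H10 \<Omega>" "w \<in> H10 \<Omega>" for i v w
    using that unfolding G_def by (intro weak_partial_diff[OF open_\<Omega>]) (auto simp: H10_def axis_in_Basis_iff)
  have norm_G: "norm (G i v) \<le> H1_norm \<Omega> v" for i v
    unfolding G_def by (intro norm_weak_partial_le_H1_norm) (simp add: axis_in_Basis_iff)
  have "bounded_form_on (H10 \<Omega>) (H1_norm \<Omega>) B"
    unfolding B_def
    by (intro bounded_form_on_add bounded_form_on_sum finite
        bounded_form_on_coefficient_form[OF \<Omega>] bounded_form_on_coefficient_form[OF \<Omega>, where D="\<lambda>v. v"]
        bounded_form_on_coefficient_form[OF \<Omega>, where D'="\<lambda>v. v"]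
        A ab coeff G norm_G norm_le_H1_norm) auto
  then show ?thesis
    using LB H10_diff[OF open_\<Omega>] unfolding bounded_form_on_def by simp
qed

text \<open>
  The weak equation is tested against test functions only; since these are dense in the
  \<open>H1_norm\<close> and both sides are continuous, it may be tested with any element of $H^1_0(\Omega)$.
\<close>

lemma weak_equation_extends_to_H10:
  assumes \<Omega>: "open \<Omega>" and B: "bounded_form_on (H10 \<Omega>) (H1_norm \<Omega>) B"
    and v: "v \<in> H10 \<Omega>" and w: "w \<in> H10 \<Omega>"
    and eq: "\<And>\<phi>. \<phi> \<in> test_functions \<Omega> \<Longrightarrow> g \<bullet> abs_L2 \<phi> = B v (abs_L2 \<phi>)"
  shows "g \<bullet> w = B v w"
proof -
  let ?N = "H1_norm \<Omega>"
  obtain C where C: "C \<ge> 0" "\<And>v w. v \<in> H10 \<Omega> \<Longrightarrow> w \<in> H10 \<Omega> \<Longrightarrow> \<bar>B v w\<bar> \<le> C * ?N v * ?N w"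
    using B unfolding bounded_form_on_def by blast
  have N: "?N v \<ge> 0" using norm_le_H1_norm[of v \<Omega>] norm_ge_zero order_trans by blast
  define K where "K = norm g + C * ?N v"
  have K: "K \<ge> 0" unfolding K_def using C(1) N by simp
  have "\<bar>g \<bullet> w - B v w\<bar> \<le> 0 + e" if "e > 0" for e
  proof -
    define d where "d = e / (K + 1)"
    have "d > 0" using that K by (simp add: d_def)
    then obtain \<phi> where \<phi>: "\<phi> \<in> test_functions \<Omega>" "?N (w - abs_L2 \<phi>) < d"
      using w unfolding H10_def by blast
    let ?r = "w - abs_L2 \<phi>"
    have \<phi>H: "abs_L2 \<phi> \<in> H10 \<Omega>" using \<Omega> \<phi>(1) by (rule test_function_in_H10)
    have "B v ?r = B v w - B v (abs_L2 \<phi>)"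
      using B v w \<phi>H unfolding bounded_form_on_def by blast
    then have "g \<bullet> w - B v w = g \<bullet> ?r - B v ?r"
      using eq[OF \<phi>(1)] by (simp add: inner_diff_right)
    also have "\<bar>\<dots>\<bar> \<le> \<bar>g \<bullet> ?r\<bar> + \<bar>B v ?r\<bar>" by (rule abs_triangle_ineq4)
    also have "\<dots> \<le> norm g * ?N ?r + C * ?N v * ?N ?r"
      using Cauchy_Schwarz_ineq2[of g ?r] mult_left_mono[OF norm_le_H1_norm[of ?r \<Omega>] norm_ge_zero[of g]]
        C(2)[OF v H10_diff[OF \<Omega> w \<phi>H]] by linarith
    also have "\<dots> = K * ?N ?r" by (simp add: K_def algebra_simps)
    also have "\<dots> \<le> K * d" using \<phi>(2) K by (intro mult_left_mono) auto
    also have "\<dots> \<le> e" using K that by (simp add: d_def field_simps)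
    finally show ?thesis by simp
  qed
  then have "\<bar>g \<bullet> w - B v w\<bar> \<le> 0" by (rule field_le_epsilon)
  then show ?thesis by simp
qed

section \<open>Lipschitz continuity in time\<close>

lemma times_cont_diff_real_deriv:
  fixes f :: "real \<Rightarrow> real"
  assumes "times_cont_diff (Suc 0) f"
  shows "(f has_real_derivative deriv f x) (at x)" "continuous_on UNIV (deriv f)"
proof -
  have D: "(f has_real_derivative partial_deriv 1 f x) (at x)" for x
  proof -
    note f = times_cont_diff_SucD(1)[OF assms, of x]
    have "frechet_derivative f (at x) = (*) (partial_deriv 1 f x)"
    proof
      fix h
      show "frechet_derivative f (at x) h = partial_deriv 1 f x * h"
        using linear_scale[OF has_derivative_linear[OF f], of h 1] by (simp add: partial_deriv_def mult.commute)
    qed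
    then show ?thesis using f by (simp add: has_field_derivative_def)
  qed
  then have eq: "deriv f = partial_deriv 1 f" by (intro ext DERIV_imp_deriv)
  show "(f has_real_derivative deriv f x) (at x)" unfolding eq by (rule D)
  show "continuous_on UNIV (deriv f)" unfolding eq using assms by simp
qed

lemma bounded_on_subinterval_integrable:
  fixes f :: "real \<Rightarrow> 'b::{banach, second_countable_topology}"
  assumes f: "f \<in> borel_measurable (lebesgue_on {a<..<b})"
    and K: "K \<ge> 0" and cd: "c \<le> d" "{c..d} \<subseteq> {a<..<b}"
    and bound: "AE r in lebesgue_on {a<..<b}. norm (f r) \<le> K * indicator {c..d} r"
  shows "integrable (lebesgue_on {a<..<b}) f"
    and "norm (LINT r|lebesgue_on {a<..<b}. f r) \<le> K * (d - c)"
proof -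
  have ind: "indicat_real {a<..<b} r *\<^sub>R (K * indicat_real {c..d} r) = K * indicat_real {c..d} r" for r
    using cd(2) by (auto simp: indicator_def)
  have sets: "{a<..<b} \<inter> space lebesgue \<in> sets lebesgue" by simp
  have int: "integrable (lebesgue_on {a<..<b}) (\<lambda>r. K * indicat_real {c..d} r)"
    unfolding integrable_restrict_space[OF sets] ind
    by (intro integrable_mult_right integrable_real_indicator) (simp_all add: emeasure_lborel_Icc_eq)
  have val: "(LINT r|lebesgue_on {a<..<b}. K * indicat_real {c..d} r) = K * (d - c)"
    unfolding integral_restrict_space[OF sets] ind using cd(1) by simp
  show int_f: "integrable (lebesgue_on {a<..<b}) f"
  proof (rule Bochner_Integration.integrable_bound[OF int f])
    show "AE r in lebesgue_on {a<..<b}. norm (f r) \<le> norm (K * indicat_real {c..d} r)"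
      using bound by eventually_elim simp
  qed
  have "norm (LINT r|lebesgue_on {a<..<b}. f r) \<le> (LINT r|lebesgue_on {a<..<b}. norm (f r))"
    by (rule integral_norm_bound)
  also have "\<dots> \<le> (LINT r|lebesgue_on {a<..<b}. K * indicat_real {c..d} r)"
    by (intro integral_mono_AE integrable_norm int_f int bound)
  finally show "norm (LINT r|lebesgue_on {a<..<b}. f r) \<le> K * (d - c)" unfolding val .
qed

text \<open>
  An approximate delta function, carried by the interval of length \<open>\<delta>\<close> to the right of \<open>s\<close>;
  its primitive is a rescaled \<open>smooth_step\<close>.
\<close>

definition step_kernel :: "real \<Rightarrow> real \<Rightarrow> real \<Rightarrow> real" where
  "step_kernel s \<delta> r = deriv smooth_step ((r - s) / \<delta>) / \<delta>"

lemma step_kernel_has_antiderivative: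
  "((\<lambda>r. smooth_step ((r - s) / \<delta>)) has_real_derivative step_kernel s \<delta> r) (at r)"
proof -
  have "((\<lambda>r. (r - s) / \<delta>) has_real_derivative 1 / \<delta>) (at r)"
    by (cases "\<delta> = 0") (auto intro!: derivative_eq_intros)
  from DERIV_chain2[OF times_cont_diff_real_deriv(1)[OF times_cont_diff_smooth_step] this]
  show ?thesis by (simp add: step_kernel_def)
qed

lemma continuous_step_kernel: "continuous_on S (step_kernel s \<delta>)"
  unfolding step_kernel_def[abs_def]
  using times_cont_diff_real_deriv(2)[OF times_cont_diff_smooth_step]
  by (cases "\<delta> = 0") (auto intro!: continuous_on_divide continuous_on_compose2[of UNIV "deriv smooth_step"]
      continuous_on_diff continuous_on_id continuous_on_const)

lemma deriv_smooth_step_eq_0: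
  assumes "x \<notin> {0..1}"
  shows "deriv smooth_step x = 0"
proof -
  have *: "deriv smooth_step x = 0"
    if "open S" "x \<in> S" "\<And>y. y \<in> S \<Longrightarrow> smooth_step y = c" for S c
  proof (rule DERIV_imp_deriv)
    show "(smooth_step has_real_derivative 0) (at x)"
      by (rule has_field_derivative_transform_within_open[of "\<lambda>y. c" _ _ S]) (use that in auto)
  qed
  show ?thesis
    using assms *[of "{..<0}" 0] *[of "{1<..}" 1]
    by (cases "x < 0") (auto simp: smooth_step_eq_0 smooth_step_eq_1)
qed

lemma step_kernel_bound:
  obtains C where "C \<ge> 0"
    "\<And>s \<delta> r. \<delta> > 0 \<Longrightarrow> \<bar>step_kernel s \<delta> r\<bar> \<le> C / \<delta> * indicator {s..s + \<delta>} r"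
proof -
  have "bounded (deriv smooth_step ` {0..1})"
    using times_cont_diff_real_deriv(2)[OF times_cont_diff_smooth_step]
    by (intro compact_imp_bounded compact_continuous_image) (auto intro: continuous_on_subset)
  then obtain C where C: "C > 0" "\<And>x. x \<in> {0..1} \<Longrightarrow> \<bar>deriv smooth_step x\<bar> \<le> C"
    by (auto simp: bounded_pos)
  have "\<bar>step_kernel s \<delta> r\<bar> \<le> C / \<delta> * indicator {s..s + \<delta>} r" if "\<delta> > 0" for s \<delta> r
  proof (cases "r \<in> {s..s + \<delta>}")
    case True
    then have "(r - s) / \<delta> \<in> {0..1}" using that by auto
    then show ?thesis using C(2) that True by (simp add: step_kernel_def divide_right_mono)
  next
    case False
    then have "(r - s) / \<delta> \<notin> {0..1}" using that by (auto simp: field_simps)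
    then show ?thesis using deriv_smooth_step_eq_0 that C(1) by (simp add: step_kernel_def)
  qed
  then show ?thesis using C(1) by (intro that[of C]) auto
qed

lemma step_kernel_integral_1:
  assumes "\<delta> > 0" "a < s" "s + \<delta> < b"
  shows "integrable (lebesgue_on {a<..<b}) (step_kernel s \<delta>)"
    and "(LINT r|lebesgue_on {a<..<b}. step_kernel s \<delta> r) = 1"
proof -
  obtain C where C: "C \<ge> 0"
    "\<And>s \<delta> r. \<delta> > 0 \<Longrightarrow> \<bar>step_kernel s \<delta> r\<bar> \<le> C / \<delta> * indicator {s..s + \<delta>} r"
    using step_kernel_bound by blast
  show int: "integrable (lebesgue_on {a<..<b}) (step_kernel s \<delta>)"
  proof (rule bounded_on_subinterval_integrable(1))
    show "step_kernel s \<delta> \<in> borel_measurable (lebesgue_on {a<..<b})"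
      by (intro continuous_imp_measurable_on_sets_lebesgue continuous_step_kernel) simp
    show "AE r in lebesgue_on {a<..<b}. norm (step_kernel s \<delta> r) \<le> C / \<delta> * indicator {s..s + \<delta>} r"
      using C(2)[OF assms(1)] by simp
  qed (use assms C(1) in auto)
  have "(step_kernel s \<delta> has_integral (smooth_step ((b - s) / \<delta>) - smooth_step ((a - s) / \<delta>))) {a..b}"
    using assms step_kernel_has_antiderivative
    by (intro fundamental_theorem_of_calculus)
      (auto simp: has_real_derivative_iff_has_vector_derivative[symmetric] intro: has_field_derivative_at_within)
  moreover have "smooth_step ((b - s) / \<delta>) = 1" "smooth_step ((a - s) / \<delta>) = 0"
    using assms by (auto intro!: smooth_step_eq_1 smooth_step_eq_0 simp: field_simps)
  ultimately have "integral {a..b} (step_kernel s \<delta>) = 1" by (simp add: integral_unique)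
  then show "(LINT r|lebesgue_on {a<..<b}. step_kernel s \<delta> r) = 1"
    using lebesgue_integral_eq_integral[OF int] integral_open_interval_real[of a b "step_kernel s \<delta>"] by simp
qed

text \<open>
  The kernel has mass one and shrinking support, and its $L_1$ norm is bounded uniformly in
  \<open>\<delta>\<close>; this gives convergence of the averages without knowing its sign.
\<close>

lemma step_kernel_tendsto:
  fixes y :: "real \<Rightarrow> 'b::{banach, second_countable_topology}"
  assumes y: "y \<in> Linfty {a<..<b}" "continuous_on {a<..<b} y" and s: "s \<in> {a<..<b}"
  shows "((\<lambda>\<delta>. LINT r|lebesgue_on {a<..<b}. step_kernel s \<delta> r *\<^sub>R y r) \<longlongrightarrow> y s) (at_right 0)"
    and "\<delta> > 0 \<Longrightarrow> s + \<delta> < b \<Longrightarrow> integrable (lebesgue_on {a<..<b}) (\<lambda>r. step_kernel s \<delta> r *\<^sub>R y r)"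
proof -
  let ?M = "lebesgue_on {a<..<b}"
  obtain C where C: "C \<ge> 0"
    "\<And>s \<delta> r. \<delta> > 0 \<Longrightarrow> \<bar>step_kernel s \<delta> r\<bar> \<le> C / \<delta> * indicator {s..s + \<delta>} r"
    using step_kernel_bound by blast
  obtain B' where ym: "y \<in> borel_measurable ?M" and B': "AE r in ?M. norm (y r) \<le> B'"
    using y(1) by (auto simp: Linfty_def)
  define B where "B = max B' 0"
  have B: "B \<ge> 0" "AE r in ?M. norm (y r) \<le> B"
    using B' by (auto simp: B_def elim: eventually_mono)
  have km: "step_kernel s \<delta> \<in> borel_measurable ?M" for \<delta>
    by (intro continuous_imp_measurable_on_sets_lebesgue continuous_step_kernel) simp
  have int: "integrable ?M (\<lambda>r. step_kernel s \<delta> r *\<^sub>R y r)" if "\<delta> > 0" "s + \<delta> < b" for \<delta>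
  proof (rule bounded_on_subinterval_integrable(1))
    show "(\<lambda>r. step_kernel s \<delta> r *\<^sub>R y r) \<in> borel_measurable ?M"
      by (intro borel_measurable_scaleR km ym)
    show "AE r in ?M. norm (step_kernel s \<delta> r *\<^sub>R y r) \<le> (C / \<delta> * B) * indicator {s..s + \<delta>} r"
      using B(2)
    proof eventually_elim
      case (elim r)
      have "norm (step_kernel s \<delta> r *\<^sub>R y r) \<le> (C / \<delta> * indicator {s..s + \<delta>} r) * B"
        unfolding norm_scaleR real_norm_def
        by (intro mult_mono C(2) elim norm_ge_zero) (use C(1) that in auto)
      then show ?case by (simp add: mult_ac)
    qed
  qed (use that s C(1) B(1) in auto)
  then show "integrable ?M (\<lambda>r. step_kernel s \<delta> r *\<^sub>R y r)" if "\<delta> > 0" "s + \<delta> < b" for \<delta>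
    using that by blast
  show "((\<lambda>\<delta>. LINT r|?M. step_kernel s \<delta> r *\<^sub>R y r) \<longlongrightarrow> y s) (at_right 0)"
  proof (rule tendstoI)
    fix e :: real assume "e > 0"
    define e' where "e' = e / (C + 1)"
    have e': "e' > 0" "C * e' < e" using \<open>e > 0\<close> C(1) by (auto simp: e'_def field_simps)
    have "isCont y s" using y(2) s by (simp add: continuous_on_eq_continuous_at)
    then obtain \<eta> where \<eta>: "\<eta> > 0" "\<And>r. dist r s < \<eta> \<Longrightarrow> dist (y r) (y s) < e'"
      using e'(1) unfolding continuous_at_eps_delta by metis
    have "dist (LINT r|?M. step_kernel s \<delta> r *\<^sub>R y r) (y s) < e"
      if \<delta>: "0 < \<delta>" "\<delta> < min \<eta> (b - s)" for \<delta>
    proof -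
      have \<delta>b: "a < s" "s + \<delta> < b" using \<delta> s by auto
      note k1 = step_kernel_integral_1[OF \<delta>(1) \<delta>b]
      have "(LINT r|?M. step_kernel s \<delta> r *\<^sub>R y r) - y s
          = (LINT r|?M. step_kernel s \<delta> r *\<^sub>R y r) - (LINT r|?M. step_kernel s \<delta> r *\<^sub>R y s)"
        using k1 by simp
      also have "\<dots> = (LINT r|?M. step_kernel s \<delta> r *\<^sub>R y r - step_kernel s \<delta> r *\<^sub>R y s)"
        using int[OF \<delta>(1) \<delta>b(2)] k1(1)
        by (intro Bochner_Integration.integral_diff[symmetric] integrable_scaleR_left) auto
      also have "\<dots> = (LINT r|?M. step_kernel s \<delta> r *\<^sub>R (y r - y s))"
        by (simp add: scaleR_diff_right)
      finally have eq: "(LINT r|?M. step_kernel s \<delta> r *\<^sub>R y r) - y s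
          = (LINT r|?M. step_kernel s \<delta> r *\<^sub>R (y r - y s))" .
      have "norm (LINT r|?M. step_kernel s \<delta> r *\<^sub>R (y r - y s)) \<le> (C / \<delta> * e') * (s + \<delta> - s)"
      proof (rule bounded_on_subinterval_integrable(2))
        show "(\<lambda>r. step_kernel s \<delta> r *\<^sub>R (y r - y s)) \<in> borel_measurable ?M"
          by (intro borel_measurable_scaleR borel_measurable_diff km ym) simp
        show "AE r in ?M. norm (step_kernel s \<delta> r *\<^sub>R (y r - y s)) \<le> (C / \<delta> * e') * indicator {s..s + \<delta>} r"
        proof (rule AE_I2)
          fix r
          show "norm (step_kernel s \<delta> r *\<^sub>R (y r - y s)) \<le> (C / \<delta> * e') * indicator {s..s + \<delta>} r"
          proof (cases "r \<in> {s..s + \<delta>}")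
            case True
            then have "norm (y r - y s) \<le> e'"
              using \<eta>(2)[of r] \<delta> by (auto simp: dist_norm)
            then have "\<bar>step_kernel s \<delta> r\<bar> * norm (y r - y s) \<le> (C / \<delta>) * e'"
              using C(2)[OF \<delta>(1), of s r] True C(1) \<delta>(1) by (intro mult_mono) auto
            then show ?thesis using True by simp
          next
            case False
            then have "step_kernel s \<delta> r = 0" using C(2)[OF \<delta>(1), of s r] by simp
            then show ?thesis using False by simp
          qed
        qed
      qed (use \<delta> \<delta>b C(1) e' in auto)
      then show ?thesis using eq e' \<delta>(1) by (simp add: dist_norm)
    qed
    moreover have "min \<eta> (b - s) > 0" using \<eta>(1) s by simp
    ultimately show "\<forall>\<^sub>F \<delta> in at_right 0. dist (LINT r|?M. step_kernel s \<delta> r *\<^sub>R y r) (y s) < e"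
      unfolding eventually_at_right_field by blast
  qed
qed

text \<open>
  Testing the weak time derivative with a smoothed indicator of $[s,t]$, whose derivative is the
  difference of two approximate delta functions, bounds the difference of the averages of $y$ near
  $s$ and near $t$ by $\|z\|_\infty$ times the length of the support.  Continuity of $y$ turns
  the averages into values as the smoothing disappears.
\<close>

lemma W1_infty_lipschitz:
  fixes y :: "real \<Rightarrow> 'b::{banach, second_countable_topology}"
  assumes W: "y \<in> W1_infty a b" and cont: "continuous_on {a<..<b} y"
  obtains K where "K \<ge> 0"
    "\<And>s t. a < s \<Longrightarrow> s < t \<Longrightarrow> t < b \<Longrightarrow> norm (y t - y s) \<le> K * (t - s)"
proof -
  let ?M = "lebesgue_on {a<..<b}"
  obtain z where y: "y \<in> Linfty {a<..<b}" and z: "z \<in> Linfty {a<..<b}"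
    and weak: "\<And>\<phi>. \<phi> \<in> test_functions {a<..<b} \<Longrightarrow>
      (LINT t|?M. deriv \<phi> t *\<^sub>R y t) = - (LINT t|?M. \<phi> t *\<^sub>R z t)"
    using W unfolding W1_infty_def by blast
  obtain K' where zm: "z \<in> borel_measurable ?M" and K': "AE r in ?M. norm (z r) \<le> K'"
    using z by (auto simp: Linfty_def)
  define K where "K = max K' 0"
  have K: "K \<ge> 0" "AE r in ?M. norm (z r) \<le> K"
    using K' by (auto simp: K_def elim: eventually_mono)
  have "norm (y t - y s) \<le> K * (t - s)" if st: "a < s" "s < t" "t < b" for s t
  proof -
    let ?A = "\<lambda>s \<delta>. LINT r|?M. step_kernel s \<delta> r *\<^sub>R y r"
    have in_ab: "s \<in> {a<..<b}" "t \<in> {a<..<b}" using st by auto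
    have le: "norm (?A s \<delta> - ?A t \<delta>) \<le> K * (t + \<delta> - s)"
      if \<delta>: "0 < \<delta>" "\<delta> < min (t - s) (b - t)" for \<delta>
    proof -
      define \<phi> where "\<phi> r = smooth_step ((r - s) / \<delta>) - smooth_step ((r - t) / \<delta>)" for r
      have off: "\<phi> r = 0" if "r \<notin> {s..t + \<delta>}" for r
      proof (cases "r < s")
        case True
        then show ?thesis using \<delta> st by (simp add: \<phi>_def smooth_step_eq_0 divide_nonpos_pos)
      next
        case False
        then have "(r - s) / \<delta> \<ge> 1" "(r - t) / \<delta> \<ge> 1"
          using that \<delta> st by (auto simp: field_simps)
        then show ?thesis by (simp add: \<phi>_def smooth_step_eq_1)
      qed
      have \<phi>_le: "\<bar>\<phi> r\<bar> \<le> indicator {s..t + \<delta>} r" for r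
        using off[of r] smooth_step_bounds[of "(r - s) / \<delta>"] smooth_step_bounds[of "(r - t) / \<delta>"]
        by (cases "r \<in> {s..t + \<delta>}") (auto simp: \<phi>_def)
      have smooth: "times_cont_diff k \<phi>" for k
      proof -
        have "times_cont_diff k (\<lambda>r. smooth_step (r / \<delta> + - (c / \<delta>)))" for c
          by (rule times_cont_diff_compose_affine[OF bounded_linear_divide times_cont_diff_smooth_step])
        then have "times_cont_diff k (\<lambda>r. smooth_step ((r - c) / \<delta>))" for c
          by (simp add: diff_divide_distrib)
        then show ?thesis unfolding \<phi>_def by (intro times_cont_diff_diff)
      qed
      have test: "\<phi> \<in> test_functions {a<..<b}"
        by (rule test_functionsI[OF smooth, of "{s..t + \<delta>}"]) (use off st \<delta> in auto)
      have deriv: "deriv \<phi> r = step_kernel s \<delta> r - step_kernel t \<delta> r" for r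
        unfolding \<phi>_def by (intro DERIV_imp_deriv DERIV_diff step_kernel_has_antiderivative)
      have "?A s \<delta> - ?A t \<delta> = (LINT r|?M. deriv \<phi> r *\<^sub>R y r)"
        unfolding deriv scaleR_diff_left
        using \<delta> st by (intro Bochner_Integration.integral_diff[symmetric] step_kernel_tendsto(2) y cont in_ab) auto
      also have "\<dots> = - (LINT r|?M. \<phi> r *\<^sub>R z r)" by (rule weak[OF test])
      also have "norm \<dots> \<le> K * (t + \<delta> - s)"
        unfolding norm_minus_cancel
      proof (rule bounded_on_subinterval_integrable(2))
        show "(\<lambda>r. \<phi> r *\<^sub>R z r) \<in> borel_measurable ?M"
          by (intro borel_measurable_scaleR zm continuous_imp_measurable_on_sets_lebesgue
              continuous_on_test_function[OF test]) simp
        show "AE r in ?M. norm (\<phi> r *\<^sub>R z r) \<le> K * indicator {s..t + \<delta>} r"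
          using K(2)
        proof eventually_elim
          case (elim r)
          have "\<bar>\<phi> r\<bar> * norm (z r) \<le> indicator {s..t + \<delta>} r * K"
            using \<phi>_le[of r] elim by (intro mult_mono) auto
          then show ?case by (simp add: mult.commute)
        qed
      qed (use K st \<delta> in auto)
      finally show ?thesis .
    qed
    have "norm (y s - y t) \<le> K * (t + 0 - s)"
    proof (rule tendsto_le)
      show "((\<lambda>\<delta>. K * (t + \<delta> - s)) \<longlongrightarrow> K * (t + 0 - s)) (at_right 0)"
        by (intro tendsto_intros)
      show "((\<lambda>\<delta>. norm (?A s \<delta> - ?A t \<delta>)) \<longlongrightarrow> norm (y s - y t)) (at_right 0)"
        by (intro tendsto_norm tendsto_diff step_kernel_tendsto(1) y cont in_ab)
      have "min (t - s) (b - t) > 0" using st by simp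
      then show "\<forall>\<^sub>F \<delta> in at_right 0. norm (?A s \<delta> - ?A t \<delta>) \<le> K * (t + \<delta> - s)"
        using le unfolding eventually_at_right_field by blast
    qed simp
    then show ?thesis by (simp add: norm_minus_commute)
  qed
  with K(1) show ?thesis by (rule that)
qed

text \<open>
  For $s\ge t/2$ the Lipschitz bound away from time zero applies, and it reaches $t=T$ by left
  limits; for $s<t/2$ the increment is bounded and $t-s>t/2$.
\<close>

lemma W1_infty_pointwise_lipschitz:
  fixes y :: "real \<Rightarrow> 'b::{banach, second_countable_topology}"
  assumes W: "\<And>\<epsilon>. 0 < \<epsilon> \<Longrightarrow> \<epsilon> < T \<Longrightarrow> y \<in> W1_infty \<epsilon> T"
    and cont: "continuous_on {0..T} y" and t: "0 < t" "t \<le> T"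
  obtains C where "C \<ge> 0" "\<And>s. s \<in> {0..t} \<Longrightarrow> norm (y t - y s) \<le> C * (t - s)"
proof -
  have "continuous_on {t/4<..<T} y"
    using t by (intro continuous_on_subset[OF cont]) auto
  moreover have "y \<in> W1_infty (t/4) T" using t by (intro W) auto
  ultimately obtain K where K: "K \<ge> 0"
    "\<And>s r. t/4 < s \<Longrightarrow> s < r \<Longrightarrow> r < T \<Longrightarrow> norm (y r - y s) \<le> K * (r - s)"
    using W1_infty_lipschitz by metis
  have near: "norm (y t - y s) \<le> K * (t - s)" if s: "t/2 \<le> s" "s < t" for s
  proof -
    have "(y \<longlongrightarrow> y t) (at t within {0..T})"
      using cont t by (simp add: continuous_on_def)
    then have lim: "(y \<longlongrightarrow> y t) (at t within {s<..<t})"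
      by (rule tendsto_within_subset) (use s t in auto)
    show ?thesis
    proof (rule tendsto_le)
      show "((\<lambda>r. K * (r - s)) \<longlongrightarrow> K * (t - s)) (at t within {s<..<t})" by (intro tendsto_intros)
      show "((\<lambda>r. norm (y r - y s)) \<longlongrightarrow> norm (y t - y s)) (at t within {s<..<t})"
        by (intro tendsto_intros lim)
      show "\<forall>\<^sub>F r in at t within {s<..<t}. norm (y r - y s) \<le> K * (r - s)"
        unfolding eventually_at_filter using K(2)[of s] s t by (intro always_eventually) auto
      show "at t within {s<..<t} \<noteq> bot"
        using s by (simp add: trivial_limit_within islimpt_greaterThanLessThan2)
    qed
  qed
  obtain B where B: "B > 0" "\<And>s. s \<in> {0..T} \<Longrightarrow> norm (y s) \<le> B"
    using compact_imp_bounded[OF compact_continuous_image[OF cont]] by (auto simp: bounded_pos)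
  define C where "C = max K (4 * B / t)"
  have "norm (y t - y s) \<le> C * (t - s)" if s: "s \<in> {0..t}" for s
  proof -
    consider "s = t" | "t/2 \<le> s" "s < t" | "s < t/2" using s by force
    then show ?thesis
    proof cases
      case 1
      then show ?thesis by simp
    next
      case 2
      have "K * (t - s) \<le> C * (t - s)" using 2 by (intro mult_right_mono) (auto simp: C_def)
      with near[OF 2] show ?thesis by linarith
    next
      case 3
      have "norm (y t - y s) \<le> B + B"
        using norm_triangle_ineq4[of "y t" "y s"] B(2)[of t] B(2)[of s] s t by auto
      also have "\<dots> = (4 * B / t) * (t / 2)" using t by simp
      also have "\<dots> \<le> C * (t - s)"
        using 3 B(1) t by (intro mult_mono) (auto simp: C_def max.coboundedI2)
      finally show ?thesis .
    qed
  qed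
  then show ?thesis using K(1) by (intro that[of C]) (auto simp: C_def)
qed

section \<open>Fractional derivatives in time\<close>

text \<open>
  The domain on which \<open>time_deriv\<close> is meaningful: elsewhere it returns an arbitrary vector (for $\alpha=1$) or drops the
  divergent integral, and it is not linear.
\<close>

definition has_time_deriv :: "real \<Rightarrow> (real \<Rightarrow> 'b::{banach, second_countable_topology}) \<Rightarrow> real \<Rightarrow> bool" where
  "has_time_deriv \<alpha> y t \<longleftrightarrow>
     (if \<alpha> = 1 then y differentiable (at_left t)
      else set_integrable lborel {0..t} (\<lambda>s. (\<alpha> * (t - s) powr (- \<alpha> - 1)) *\<^sub>R (y t - y s)))"

lemma set_integrable_powr_at_endpoint:
  fixes \<alpha> t :: real
  assumes "\<alpha> < 1" "0 \<le> t"
  shows "set_integrable lborel {0..t} (\<lambda>s. (t - s) powr (- \<alpha>))"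
proof -
  have "(\<lambda>s::real. s powr (- \<alpha>)) absolutely_integrable_on {0..t}"
    using assms by (intro nonnegative_absolutely_integrable_1 integrable_on_powr_from_0) auto
  then have "integrable lborel (\<lambda>s. indicat_real {0..t} s *\<^sub>R (s powr (- \<alpha>)))"
    unfolding set_integrable_def by (subst (asm) integrable_completion) auto
  then have "integrable lborel (\<lambda>s. indicat_real {0..t} (t + (-1) * s) *\<^sub>R ((t + (-1) * s) powr (- \<alpha>)))"
    by (intro lborel_integrable_real_affine) auto
  moreover have "indicat_real {0..t} (t + (-1) * s) = indicat_real {0..t} s" for s
    by (auto simp: indicator_def)
  ultimately show ?thesis by (simp add: set_integrable_def)
qed

text \<open>
  The Lipschitz bound at \<open>t\<close> takes one order off the singularity of the kernel and leaves the
  integrable majorant $(t-s)^{-\alpha}$.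
\<close>

lemma has_time_derivI:
  fixes y :: "real \<Rightarrow> 'b::{banach, second_countable_topology}"
  assumes \<alpha>: "0 < \<alpha>" "\<alpha> \<le> 1" and t: "0 \<le> t" and cont: "continuous_on {0..t} y"
    and lip: "\<And>s. s \<in> {0..t} \<Longrightarrow> norm (y t - y s) \<le> C * (t - s)"
    and diff: "\<alpha> = 1 \<Longrightarrow> y differentiable (at_left t)"
  shows "has_time_deriv \<alpha> y t"
proof (cases "\<alpha> = 1")
  case True
  then show ?thesis using diff by (simp add: has_time_deriv_def)
next
  case False
  have "set_integrable lborel {0..t} (\<lambda>s. (\<alpha> * C) * (t - s) powr (- \<alpha>))"
    using \<alpha> False t by (intro set_integrable_mult_right set_integrable_powr_at_endpoint) auto
  then have "set_integrable lborel {0..t} (\<lambda>s. (\<alpha> * (t - s) powr (- \<alpha> - 1)) *\<^sub>R (y t - y s))"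
    unfolding set_integrable_def
  proof (rule Bochner_Integration.integrable_bound)
    have "(\<lambda>s. indicator {0..t} s *\<^sub>R (y t - y s)) \<in> borel_measurable borel"
      using cont by (intro borel_measurable_continuous_on_indicator continuous_on_diff continuous_on_const) auto
    then have "(\<lambda>s. (\<alpha> * (t - s) powr (- \<alpha> - 1)) *\<^sub>R (indicator {0..t} s *\<^sub>R (y t - y s))) \<in> borel_measurable borel"
      by (rule borel_measurable_scaleR[rotated]) simp
    then show "(\<lambda>s. indicator {0..t} s *\<^sub>R ((\<alpha> * (t - s) powr (- \<alpha> - 1)) *\<^sub>R (y t - y s))) \<in> borel_measurable lborel"
      by (simp add: mult.commute)
    show "AE s in lborel. norm (indicator {0..t} s *\<^sub>R ((\<alpha> * (t - s) powr (- \<alpha> - 1)) *\<^sub>R (y t - y s)))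
        \<le> norm (indicator {0..t} s *\<^sub>R ((\<alpha> * C) * (t - s) powr (- \<alpha>)))"
    proof (rule AE_I2)
      fix s
      show "norm (indicator {0..t} s *\<^sub>R ((\<alpha> * (t - s) powr (- \<alpha> - 1)) *\<^sub>R (y t - y s)))
          \<le> norm (indicator {0..t} s *\<^sub>R ((\<alpha> * C) * (t - s) powr (- \<alpha>)))"
      proof (cases "s \<in> {0..<t}")
        case True
        then have pos: "t - s > 0" by simp
        have "(t - s) powr (- \<alpha> - 1) * (t - s) = (t - s) powr (- \<alpha>)"
          using pos powr_add[of "t - s" "- \<alpha> - 1" 1] by simp
        then have eq: "\<alpha> * (t - s) powr (- \<alpha> - 1) * (C * (t - s)) = \<alpha> * C * (t - s) powr (- \<alpha>)"
          by (metis mult.assoc mult.left_commute)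
        have "\<alpha> * (t - s) powr (- \<alpha> - 1) * norm (y t - y s) \<le> \<alpha> * (t - s) powr (- \<alpha> - 1) * (C * (t - s))"
          using lip[of s] True \<alpha>(1) by (intro mult_left_mono) auto
        also have "\<dots> \<le> \<bar>\<alpha> * C * (t - s) powr (- \<alpha>)\<bar>" unfolding eq by simp
        finally show ?thesis using True \<alpha>(1) by (simp add: abs_mult)
      next
        case False
        then show ?thesis by (cases "s = t") (auto simp: indicator_def)
      qed
    qed
  qed
  then show ?thesis using False by (simp add: has_time_deriv_def)
qed

lemma time_deriv_at_left:
  assumes "y differentiable (at_left t)"
  shows "(y has_vector_derivative time_deriv 1 y t) (at_left t)"
  using assms by (simp add: time_deriv_def vector_derivative_works)

lemma time_deriv_1_eqI:
  assumes "(y has_vector_derivative y') (at_left t)"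
  shows "time_deriv 1 y t = y'" "has_time_deriv 1 y t"
  using vector_derivative_within[OF trivial_limit_at_left_real assms] assms
  by (auto simp: time_deriv_def has_time_deriv_def intro: differentiableI_vector)

lemma time_deriv_bounded_linear:
  fixes y :: "real \<Rightarrow> 'b::{banach, second_countable_topology}"
    and h :: "'b \<Rightarrow> 'c::{banach, second_countable_topology}"
  assumes h: "bounded_linear h" and y: "has_time_deriv \<alpha> y t"
  shows "has_time_deriv \<alpha> (\<lambda>s. h (y s)) t"
    and "time_deriv \<alpha> (\<lambda>s. h (y s)) t = h (time_deriv \<alpha> y t)"
proof -
  interpret h: bounded_linear h by (rule h)
  have "has_time_deriv \<alpha> (\<lambda>s. h (y s)) t \<and> time_deriv \<alpha> (\<lambda>s. h (y s)) t = h (time_deriv \<alpha> y t)"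
  proof (cases "\<alpha> = 1")
    case True
    have "((\<lambda>s. h (y s)) has_vector_derivative h (time_deriv 1 y t)) (at_left t)"
      using y True by (intro h.has_vector_derivative time_deriv_at_left) (simp add: has_time_deriv_def)
    then show ?thesis using time_deriv_1_eqI True by blast
  next
    case False
    let ?k = "\<lambda>s. indicat_real {0..t} s *\<^sub>R ((\<alpha> * (t - s) powr (- \<alpha> - 1)) *\<^sub>R (y t - y s))"
    have int: "integrable lborel ?k"
      using y False by (simp add: has_time_deriv_def set_integrable_def)
    have hk: "indicat_real {0..t} s *\<^sub>R ((\<alpha> * (t - s) powr (- \<alpha> - 1)) *\<^sub>R (h (y t) - h (y s))) = h (?k s)" for s
      by (simp add: h.scaleR h.diff)
    show ?thesis
      using False integrable_bounded_linear[OF h int] integral_bounded_linear[OF h int]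
      unfolding has_time_deriv_def time_deriv_def set_integrable_def set_lebesgue_integral_def hk
      by (simp add: h.scaleR h.add h.diff)
  qed
  then show "has_time_deriv \<alpha> (\<lambda>s. h (y s)) t" "time_deriv \<alpha> (\<lambda>s. h (y s)) t = h (time_deriv \<alpha> y t)"
    by blast+
qed

lemma time_deriv_diff:
  fixes x y :: "real \<Rightarrow> 'b::{banach, second_countable_topology}"
  assumes x: "has_time_deriv \<alpha> x t" and y: "has_time_deriv \<alpha> y t"
  shows "has_time_deriv \<alpha> (\<lambda>s. x s - y s) t"
    and "time_deriv \<alpha> (\<lambda>s. x s - y s) t = time_deriv \<alpha> x t - time_deriv \<alpha> y t"
proof -
  have "has_time_deriv \<alpha> (\<lambda>s. x s - y s) t
      \<and> time_deriv \<alpha> (\<lambda>s. x s - y s) t = time_deriv \<alpha> x t - time_deriv \<alpha> y t"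
  proof (cases "\<alpha> = 1")
    case True
    have "((\<lambda>s. x s - y s) has_vector_derivative time_deriv 1 x t - time_deriv 1 y t) (at_left t)"
      using x y True
      by (intro has_vector_derivative_diff time_deriv_at_left) (simp_all add: has_time_deriv_def)
    then show ?thesis using time_deriv_1_eqI True by blast
  next
    case False
    let ?k = "\<lambda>y s. indicat_real {0..t} s *\<^sub>R ((\<alpha> * (t - s) powr (- \<alpha> - 1)) *\<^sub>R (y t - y s))"
    have int: "integrable lborel (?k x)" "integrable lborel (?k y)"
      using x y False by (simp_all add: has_time_deriv_def set_integrable_def)
    have k: "?k (\<lambda>s. x s - y s) = (\<lambda>s. ?k x s - ?k y s)"
      by (intro ext) (simp add: algebra_simps)
    define I where "I z = integral\<^sup>L lborel (?k z)" for z :: "real \<Rightarrow> 'b"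
    have eq: "time_deriv \<alpha> z t = inverse (Gamma (1 - \<alpha>)) *\<^sub>R
        (t powr (- \<alpha>) *\<^sub>R (z t - z 0) + I z)" for z :: "real \<Rightarrow> 'b"
      using False by (simp add: time_deriv_def set_lebesgue_integral_def I_def)
    have I_diff: "I (\<lambda>s. x s - y s) = I x - I y"
      unfolding I_def k by (rule Bochner_Integration.integral_diff[OF int])
    have "time_deriv \<alpha> (\<lambda>s. x s - y s) t = time_deriv \<alpha> x t - time_deriv \<alpha> y t"
      unfolding eq I_diff by (simp add: algebra_simps)
    moreover have "has_time_deriv \<alpha> (\<lambda>s. x s - y s) t"
      using False Bochner_Integration.integrable_diff[OF int]
      unfolding has_time_deriv_def set_integrable_def k by simp
    ultimately show ?thesis by blast
  qed
  then show "has_time_deriv \<alpha> (\<lambda>s. x s - y s) t"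
    "time_deriv \<alpha> (\<lambda>s. x s - y s) t = time_deriv \<alpha> x t - time_deriv \<alpha> y t" by blast+
qed

text \<open>
  At a maximum over the past every fractional derivative is positive, because the kernel weighs
  nonnegative increments and the increment from time zero is positive; the linear rate \<open>c\<close> takes
  care of the local derivative $\alpha=1$.
\<close>

lemma time_deriv_pos_at_maximum:
  fixes g :: "real \<Rightarrow> real"
  assumes \<alpha>: "0 < \<alpha>" "\<alpha> \<le> 1" and t: "0 < t" and c: "0 < c"
    and g: "has_time_deriv \<alpha> g t"
    and g0: "g 0 < g t" and max: "\<And>s. s \<in> {0..t} \<Longrightarrow> c * (t - s) \<le> g t - g s"
  shows "0 < time_deriv \<alpha> g t"
proof (cases "\<alpha> = 1")
  case True
  have "(g has_vector_derivative time_deriv 1 g t) (at_left t)"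
    using g True by (intro time_deriv_at_left) (simp add: has_time_deriv_def)
  then have "((\<lambda>s. (g s - g t) / (s - t)) \<longlongrightarrow> time_deriv 1 g t) (at_left t)"
    by (simp add: has_real_derivative_iff_has_vector_derivative[symmetric] has_field_derivative_iff)
  moreover have "\<forall>\<^sub>F s in at_left t. c \<le> (g s - g t) / (s - t)"
    unfolding eventually_at_left_field
  proof (intro exI[of _ 0] conjI allI impI t)
    fix s assume "0 < s" "s < t"
    then show "c \<le> (g s - g t) / (s - t)" using max[of s] by (simp add: neg_le_divide_eq algebra_simps)
  qed
  ultimately have "c \<le> time_deriv 1 g t"
    by (rule tendsto_lowerbound) simp
  then show ?thesis using True c by simp
next
  case False
  have "0 \<le> (LBINT s:{0..t}. (\<alpha> * (t - s) powr (- \<alpha> - 1)) *\<^sub>R (g t - g s))"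
    unfolding set_lebesgue_integral_def
  proof (rule Bochner_Integration.integral_nonneg)
    fix s
    have "0 \<le> g t - g s" if "s \<in> {0..t}"
    proof -
      have "0 \<le> c * (t - s)" using that c by simp
      with max[OF that] show ?thesis by linarith
    qed
    then show "0 \<le> indicat_real {0..t} s *\<^sub>R ((\<alpha> * (t - s) powr (- \<alpha> - 1)) *\<^sub>R (g t - g s))"
      using \<alpha>(1) by (auto simp: indicator_def)
  qed
  moreover have "0 < t powr (- \<alpha>) *\<^sub>R (g t - g 0)" using t g0 by simp
  moreover have "0 < inverse (Gamma (1 - \<alpha>))" using \<alpha> False by (simp add: Gamma_real_pos)
  ultimately show ?thesis
    using False by (simp add: time_deriv_def add_pos_nonneg)
qed

section \<open>Comparison with the barrier\<close>

text \<open>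
  If \<open>norm (e r) > E r\<close> for some \<open>r\<close>, then $E-\|e\|$, tilted by a small multiple of $t$, has a
  negative minimum at some $t>0$.  By Cauchy--Schwarz the scalar function
  $g(s)=\langle e(s),e(t)\rangle-\|e(t)\|\,E(s)$ then has a strict maximum over $[0,t]$ at $t$, so all
  its fractional derivatives there are positive.  Working with $g$ avoids differentiating
  $\|e\|$, and the tilt is needed because the derivative of order one is only nonnegative at a maximum.
\<close>

lemma multiterm_comparison:
  fixes e :: "real \<Rightarrow> 'b::{real_inner, banach, second_countable_topology}" and E :: "real \<Rightarrow> real"
  assumes \<alpha>: "\<And>i. i \<in> {1..l} \<Longrightarrow> 0 < \<alpha> i \<and> \<alpha> i \<le> 1"
    and q: "\<And>i t. i \<in> {1..l} \<Longrightarrow> t \<in> {0..T} \<Longrightarrow> 0 \<le> q i t"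
      "\<And>t. t \<in> {0..T} \<Longrightarrow> 0 < (\<Sum>i=1..l. q i t)"
    and lam: "0 \<le> lam"
    and cont: "continuous_on {0..T} e" "continuous_on {0..T} E"
    and deriv: "\<And>i t. i \<in> {1..l} \<Longrightarrow> t \<in> {0<..T} \<Longrightarrow> has_time_deriv (\<alpha> i) e t"
      "\<And>i t. i \<in> {1..l} \<Longrightarrow> t \<in> {0<..T} \<Longrightarrow> has_time_deriv (\<alpha> i) E t"
    and init: "e 0 = 0" and E: "\<And>t. t \<in> {0..T} \<Longrightarrow> 0 \<le> E t"
    and ineq: "\<And>t. t \<in> {0<..T} \<Longrightarrow> multiterm_deriv l \<alpha> q e t \<bullet> e t + lam * (norm (e t))\<^sup>2
      \<le> norm (e t) * (multiterm_deriv l \<alpha> q E t + lam * E t)"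
    and r: "r \<in> {0..T}"
  shows "norm (e r) \<le> E r"
proof (rule ccontr)
  assume "\<not> norm (e r) \<le> E r"
  then have neg: "E r - norm (e r) < 0" by simp
  have E0: "0 \<le> E 0" using r by (intro E) auto
  have "r \<noteq> 0" using neg init E0 by force
  then have r0: "0 < r" using r by simp
  \<comment> \<open>With this slope the tilt removes half of the violation at \<open>r\<close>, so the tilted minimum stays negative.\<close>
  define c where "c = (norm (e r) - E r) / (2 * r)"
  have c: "c > 0" using neg r0 by (simp add: c_def)
  define v where "v s = E s - norm (e s) + c * s" for s
  have "c * r = (norm (e r) - E r) / 2" using r0 by (simp add: c_def)
  then have vr: "v r < 0" using neg by (simp add: v_def)
  have "continuous_on {0..T} v"
    unfolding v_def by (intro continuous_intros cont)
  then obtain t where t: "t \<in> {0..T}" "\<And>s. s \<in> {0..T} \<Longrightarrow> v t \<le> v s"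
    using continuous_attains_inf[of "{0..T}" v] r by auto
  have vt: "v t < 0" using t(2)[OF r] vr by simp
  have "t \<noteq> 0" using vt init E0 by (force simp: v_def)
  then have t0: "0 < t" using t(1) by simp
  have tT: "t \<in> {0<..T}" using t(1) t0 by simp
  let ?n = "norm (e t)"
  have E_less: "E t < ?n" using vt mult_pos_pos[OF c t0] by (simp add: v_def)
  have n: "0 < ?n" using E_less E[OF t(1)] by linarith
  define g where "g s = e s \<bullet> e t - ?n *\<^sub>R E s" for s
  have gt: "g t = ?n * (?n - E t)"
    by (simp add: g_def power2_norm_eq_inner[symmetric] power2_eq_square algebra_simps)
  have g0: "g 0 < g t"
  proof -
    have "g 0 \<le> 0" using init E0 by (simp add: g_def)
    moreover have "0 < g t" unfolding gt using n E_less by simp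
    ultimately show ?thesis by linarith
  qed
  have gmax: "(?n * c) * (t - s) \<le> g t - g s" if s: "s \<in> {0..t}" for s
  proof -
    have "e s \<bullet> e t \<le> norm (e s) * ?n" by (rule norm_cauchy_schwarz)
    moreover have gs: "g s = e s \<bullet> e t - ?n * E s" by (simp add: g_def)
    ultimately have "?n * (?n - E t - norm (e s) + E s) \<le> g t - g s"
      unfolding gt gs by (simp add: algebra_simps)
    moreover have "c * (t - s) \<le> ?n - E t - norm (e s) + E s"
      using t(2)[of s] s t(1) by (simp add: v_def algebra_simps)
    then have "?n * (c * (t - s)) \<le> ?n * (?n - E t - norm (e s) + E s)"
      using n by (intro mult_left_mono) auto
    ultimately show ?thesis by (simp add: mult.assoc)
  qed
  have bl: "bounded_linear (\<lambda>x. x \<bullet> e t)" "bounded_linear (\<lambda>x::real. ?n *\<^sub>R x)"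
    by (rule bounded_linear_inner_left, rule bounded_linear_scaleR_right)
  have Dg: "0 < time_deriv (\<alpha> i) g t" "time_deriv (\<alpha> i) g t = time_deriv (\<alpha> i) e t \<bullet> e t - ?n * time_deriv (\<alpha> i) E t"
    if i: "i \<in> {1..l}" for i
  proof -
    note de = time_deriv_bounded_linear[OF bl(1) deriv(1)[OF i tT]]
    note dE = time_deriv_bounded_linear[OF bl(2) deriv(2)[OF i tT]]
    show "0 < time_deriv (\<alpha> i) g t"
    proof (rule time_deriv_pos_at_maximum)
      show "has_time_deriv (\<alpha> i) g t" unfolding g_def by (rule time_deriv_diff(1)[OF de(1) dE(1)])
      show "0 < ?n * c" using n c by simp
    qed (use \<alpha>[OF i] t0 g0 gmax in auto)
    show "time_deriv (\<alpha> i) g t = time_deriv (\<alpha> i) e t \<bullet> e t - ?n * time_deriv (\<alpha> i) E t"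
      unfolding g_def using time_deriv_diff(2)[OF de(1) dE(1)] de(2) dE(2) by simp
  qed
  have "multiterm_deriv l \<alpha> q e t \<bullet> e t - ?n * multiterm_deriv l \<alpha> q E t
      = (\<Sum>i=1..l. q i t * time_deriv (\<alpha> i) g t)"
    unfolding multiterm_deriv_def inner_sum_left sum_distrib_left sum_subtractf[symmetric]
    by (intro sum.cong refl) (simp only: Dg(2), simp add: algebra_simps)
  also have "\<dots> > 0"
  proof -
    obtain j where j: "j \<in> {1..l}" "0 < q j t"
      using q(2)[OF t(1)] by (metis not_less sum_nonpos)
    show ?thesis
      using q(1)[OF _ t(1)] Dg(1) j by (intro sum_pos2[of _ j]) (auto simp: less_imp_le)
  qed
  finally have "?n * multiterm_deriv l \<alpha> q E t < multiterm_deriv l \<alpha> q e t \<bullet> e t" by simp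
  moreover have "lam * (?n * E t) \<le> lam * ?n\<^sup>2"
    using E_less n lam by (intro mult_left_mono) (auto simp: power2_eq_square)
  ultimately show False using ineq[OF tT] by (simp add: algebra_simps)
qed

lemma multiterm_deriv_diff:
  assumes "\<And>i. i \<in> {1..l} \<Longrightarrow> has_time_deriv (\<alpha> i) x t" "\<And>i. i \<in> {1..l} \<Longrightarrow> has_time_deriv (\<alpha> i) y t"
  shows "multiterm_deriv l \<alpha> q (\<lambda>s. x s - y s) t = multiterm_deriv l \<alpha> q x t - multiterm_deriv l \<alpha> q y t"
  using time_deriv_diff(2)[OF assms]
  by (simp add: multiterm_deriv_def sum_subtractf[symmetric] scaleR_diff_right)

lemma decreasing_orders:
  fixes \<alpha> :: "nat \<Rightarrow> real"
  assumes \<alpha>: "0 < \<alpha> l" "\<forall>i\<in>{1..<l}. \<alpha> (Suc i) < \<alpha> i" "\<alpha> 1 \<le> 1" and i: "i \<in> {1..l}"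
  shows "0 < \<alpha> i" "\<alpha> i \<le> 1" "\<alpha> i = 1 \<Longrightarrow> \<alpha> 1 = 1"
proof -
  have mono: "\<alpha> k \<le> \<alpha> j" if "j \<le> k" "1 \<le> j" "k \<le> l" for j k
    using that
  proof (induction k rule: dec_induct)
    case (step k)
    then have "\<alpha> (Suc k) < \<alpha> k" "\<alpha> k \<le> \<alpha> j" using \<alpha>(2) by auto
    then show ?case by simp
  qed simp
  have "\<alpha> l \<le> \<alpha> i" "\<alpha> i \<le> \<alpha> 1" using i by (auto intro: mono)
  then show "0 < \<alpha> i" "\<alpha> i \<le> 1" "\<alpha> i = 1 \<Longrightarrow> \<alpha> 1 = 1" using \<alpha> by auto
qed

lemma W1_infty_has_time_deriv:
  fixes y :: "real \<Rightarrow> 'b::{banach, second_countable_topology}"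
  assumes W: "\<And>\<epsilon>. 0 < \<epsilon> \<Longrightarrow> \<epsilon> < T \<Longrightarrow> y \<in> W1_infty \<epsilon> T"
    and cont: "continuous_on {0..T} y" and t: "t \<in> {0<..T}"
    and \<alpha>: "0 < \<alpha>" "\<alpha> \<le> 1" and diff: "\<alpha> = 1 \<Longrightarrow> y differentiable (at_left t)"
  shows "has_time_deriv \<alpha> y t"
proof -
  obtain C where "\<And>s. s \<in> {0..t} \<Longrightarrow> norm (y t - y s) \<le> C * (t - s)"
    using W1_infty_pointwise_lipschitz[OF W cont, of t] t by (metis greaterThanAtMost_iff)
  moreover have "continuous_on {0..t} y" using cont by (rule continuous_on_subset) (use t in auto)
  ultimately show ?thesis using t by (intro has_time_derivI[OF \<alpha>] diff) auto
qed

theorem theorem3p2: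
  fixes \<Omega> :: "(real^'n) set"
    and T lam :: real
    and l :: nat
    and \<alpha> :: "nat \<Rightarrow> real"
    and q :: "nat \<Rightarrow> real \<Rightarrow> real"
    and L :: "(real^'n) L2 \<Rightarrow> (real^'n) L2 \<Rightarrow> real"
    and f :: "real^'n \<Rightarrow> real \<Rightarrow> real"
    and u0 :: "(real^'n) L2"
    and u u_h R_h :: "real \<Rightarrow> (real^'n) L2"
    and E :: "real \<Rightarrow> real"
  assumes dim: "CARD('n) \<in> {1, 2, 3}"
    and \<Omega>: "bounded_Lipschitz_domain \<Omega>"
    and T: "T > 0"
    and l: "l \<ge> 1"
    and \<alpha>: "0 < \<alpha> l" "\<forall>i\<in>{1..<l}. \<alpha> (Suc i) < \<alpha> i" "\<alpha> 1 \<le> 1"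
    and q: "\<forall>i\<in>{1..l}. continuous_on {0..T} (q i)"
      "\<forall>i\<in>{1..l}. \<forall>t\<in>{0..T}. q i t \<ge> 0"
      "\<forall>t\<in>{0..T}. (\<Sum>i=1..l. q i t) > 0"
    and L: "elliptic_operator \<Omega> L"
    and lam: "lam \<ge> 0"
    and coercive: "\<forall>r\<in>H10 \<Omega>. L r r \<ge> lam * (norm r)\<^sup>2"
    and f: "\<forall>t\<in>{0<..T}. (\<lambda>x. f x t) locally_integrable_on \<Omega>"
    and u: "solves_problem \<Omega> T l \<alpha> q L f u0 u"
    and u_unique: "\<forall>v. solves_problem \<Omega> T l \<alpha> q L f u0 v \<longrightarrow> (\<forall>t\<in>{0..T}. v t = u t)"
    and u_h: "u_h \<in> solution_class \<Omega> T \<alpha>" "u_h 0 = u 0"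
    and R_h: "\<forall>t\<in>{0<..T}. R_h t \<in> L2_on \<Omega> \<and>
      (\<forall>\<phi>\<in>test_functions \<Omega>. R_h t \<bullet> abs_L2 \<phi> = residual \<Omega> l \<alpha> q L f u_h t \<phi>)"
    and E: "E \<in> barrier_class T \<alpha>"
    and R_h_bound: "\<forall>t\<in>{0<..T}. norm (R_h t) \<le> multiterm_deriv l \<alpha> q E t + lam * E t"
  shows "\<forall>t\<in>{0..T}. norm (u_h t - u t) \<le> E t"
proof -
  have open_\<Omega>: "open \<Omega>" using \<Omega> by (simp add: bounded_Lipschitz_domain_def)
  have B: "bounded_form_on (H10 \<Omega>) (H1_norm \<Omega>) L"
    using open_\<Omega> L by (rule elliptic_operator_bounded_form)
  have u_class: "u \<in> solution_class \<Omega> T \<alpha>" using u by (simp add: solves_problem_def)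
  note orders = decreasing_orders[OF \<alpha>]
  have class_deriv: "has_time_deriv (\<alpha> i) y t"
    if y: "y \<in> solution_class \<Omega> T \<alpha>" and "i \<in> {1..l}" "t \<in> {0<..T}" for y i t
    using that orders[OF that(2)] unfolding solution_class_def
    by (intro W1_infty_has_time_deriv[of T]) auto
  have E_deriv: "has_time_deriv (\<alpha> i) E t" if "i \<in> {1..l}" "t \<in> {0<..T}" for i t
    using that orders[OF that(1)] E unfolding barrier_class_def
    by (intro W1_infty_has_time_deriv[of T]) auto
  define e where "e s = u_h s - u s" for s
  have e_deriv: "has_time_deriv (\<alpha> i) e t" if "i \<in> {1..l}" "t \<in> {0<..T}" for i t
    unfolding e_def by (intro time_deriv_diff(1) class_deriv u_h(1) u_class that)
  have ineq: "multiterm_deriv l \<alpha> q e t \<bullet> e t + lam * (norm (e t))\<^sup>2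
      \<le> norm (e t) * (multiterm_deriv l \<alpha> q E t + lam * E t)" if t: "t \<in> {0<..T}" for t
  proof -
    have H: "u_h t \<in> H10 \<Omega>" "u t \<in> H10 \<Omega>"
      using u_h(1) u_class t by (auto simp: solution_class_def)
    then have eH: "e t \<in> H10 \<Omega>" unfolding e_def by (intro H10_diff[OF open_\<Omega>])
    have De: "multiterm_deriv l \<alpha> q e t = multiterm_deriv l \<alpha> q u_h t - multiterm_deriv l \<alpha> q u t"
      unfolding e_def using class_deriv[OF u_h(1) _ t] class_deriv[OF u_class _ t] by (rule multiterm_deriv_diff)
    have "(R_h t - multiterm_deriv l \<alpha> q e t) \<bullet> e t = L (e t) (e t)"
    proof (rule weak_equation_extends_to_H10[OF open_\<Omega> B eH eH])
      fix \<phi> assume \<phi>: "\<phi> \<in> test_functions \<Omega>"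
      have "R_h t \<bullet> abs_L2 \<phi> = residual \<Omega> l \<alpha> q L f u_h t \<phi>" "residual \<Omega> l \<alpha> q L f u t \<phi> = 0"
        using R_h u t \<phi> by (auto simp: solves_problem_def)
      moreover have "L (e t) (abs_L2 \<phi>) = L (u_h t) (abs_L2 \<phi>) - L (u t) (abs_L2 \<phi>)"
        using B H test_function_in_H10[OF open_\<Omega> \<phi>] unfolding e_def bounded_form_on_def by blast
      ultimately show "(R_h t - multiterm_deriv l \<alpha> q e t) \<bullet> abs_L2 \<phi> = L (e t) (abs_L2 \<phi>)"
        unfolding De by (simp add: residual_def inner_diff_left)
    qed
    moreover have "lam * (norm (e t))\<^sup>2 \<le> L (e t) (e t)" using coercive eH by blast
    moreover have "R_h t \<bullet> e t \<le> norm (e t) * norm (R_h t)"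
      using norm_cauchy_schwarz[of "R_h t" "e t"] by (simp add: mult.commute)
    moreover have "norm (e t) * norm (R_h t) \<le> norm (e t) * (multiterm_deriv l \<alpha> q E t + lam * E t)"
      using R_h_bound t by (intro mult_left_mono) auto
    ultimately show ?thesis by (simp add: inner_diff_left)
  qed
  have cont: "continuous_on {0..T} e" "continuous_on {0..T} E"
    using u_h(1) u_class E unfolding e_def solution_class_def barrier_class_def
    by (auto intro: continuous_on_diff)
  have "norm (e t) \<le> E t" if "t \<in> {0..T}" for t
  proof (rule multiterm_comparison[OF _ _ _ lam cont e_deriv E_deriv _ _ ineq that])
    show "0 < \<alpha> i \<and> \<alpha> i \<le> 1" if "i \<in> {1..l}" for i using orders[OF that] by simp
    show "0 \<le> q i t" if "i \<in> {1..l}" "t \<in> {0..T}" for i t using q(2) that by blast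
    show "0 < (\<Sum>i=1..l. q i t)" if "t \<in> {0..T}" for t using q(3) that by blast
    show "e 0 = 0" by (simp add: e_def u_h(2))
    show "0 \<le> E t" if "t \<in> {0..T}" for t using E that by (simp add: barrier_class_def)
  qed
  then show ?thesis by (simp add: e_def)
qed

end
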